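(* Let $C\subset[0,1]$ be the (ternary) Cantor set. There exists a function $f\in W^{1,2}_{loc}(\mathbb{R}^2)\cap\mathscr{C}^1_{\mathbb{W}}(\mathbb{R}^2)$ that is locally Lipschitz on $\mathbb{R}^2\setminus(\{0\}\times C)$, such that $f$ is stable but its intrinsic graph $\Gamma_f$ is not an intrinsic plane.
   Context: The Heisenberg group $\mathbb{H}$ is $\mathbb{R}^3$ with the group law $(x,y,z)(x',y',z')=\left(x+x',y+y',z+z'+\frac12(xy'-x'y)\right)$. An intrinsic plane is a coset of a two-dimensional Lie subgroup of $\mathbb{H}$. For $f:\omega\to\mathbb{R}$, $\omega\subset\mathbb{R}^2$ (coordinates $(y,t)$), the intrinsic graph of $f$ is $\Gamma_f=\{(0,y,t)(f(y,t),0,0):(y,t)\in\omega\}=\{(f(y,t),y,t-\frac12 yf(y,t)):(y,t)\in\omega\}$. For $\omega$ open and $f\in W^{1,1}_{loc}(\omega)$, set $\nabla^f=\partial_y+f\,\partial_t$, so that $\nabla^f f=\partial_y f+f\partial_t f$. $f\in\mathscr{C}^1_{\mathbb{W}}(\omega)$ means that $f\in C^0(\omega)$ and $\nabla^f f\in C^0(\omega)$. The graph area functional is $\mathscr{A}_f(E)=\int_E\sqrt{1+(\nabla^f f)^2}\,d\mathcal{L}^2$ for measurable $E\subset\omega$. For $\varphi\in C^\infty_c(\omega)$ define $$I_f(\varphi)=\frac{d}{d\epsilon}\Big|_{\epsilon=0}\mathscr{A}_{f+\epsilon\varphi}(\mathrm{spt}(\varphi)),\qquad II_f(\varphi)=\frac{d^2}{d\epsilon^2}\Big|_{\epsilon=0}\mathscr{A}_{f+\epsilon\varphi}(\mathrm{spt}(\varphi)).$$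 $f$ is stationary (on $\omega$) if $I_f(\varphi)=0$ for all $\varphi\in C^\infty_c(\omega)$; $f$ is stable if it is stationary and $II_f(\varphi)\ge 0$ for all $\varphi\in C^\infty_c(\omega)$. Here $\omega=\mathbb{R}^2$. *)

theory Defs
  imports "HOL-Analysis.Analysis" "HOL-Algebra.Coset"
begin

section \<open>The Heisenberg group\<close>

type_synonym pt = "real \<times> real \<times> real"

definition Heis :: "pt monoid" where
  "Heis = \<lparr>carrier = UNIV,
           mult = (\<lambda>(x, y, z) (x', y', z'). (x + x', y + y', z + z' + (x * y' - x' * y) / 2)),
           one = (0, 0, 0)\<rparr>"

lemma group_Heis: "group Heis"
proof (rule groupI)
  fix a assume "a \<in> carrier Heis"
  show "\<exists>b\<in>carrier Heis. b \<otimes>\<^bsub>Heis\<^esub> a = \<one>\<^bsub>Heis\<^esub>"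
    by (rule bexI[of _ "- a"]) (auto simp: Heis_def split: prod.splits)
qed (auto simp: Heis_def algebra_simps add_divide_distrib diff_divide_distrib split: prod.splits)


section \<open>Smooth functions\<close>

text \<open>Meant for open \<open>S\<close>.\<close>

fun Ck_on :: "nat \<Rightarrow> 'a set \<Rightarrow> ('a::real_normed_vector \<Rightarrow> 'b::real_normed_vector) \<Rightarrow> bool" where
  "Ck_on 0 S f \<longleftrightarrow> continuous_on S f"
| "Ck_on (Suc k) S f \<longleftrightarrow>
     (\<forall>x\<in>S. f differentiable (at x)) \<and> (\<forall>v. Ck_on k S (\<lambda>x. frechet_derivative f (at x) v))"

definition smooth_on :: "'a set \<Rightarrow> ('a::real_normed_vector \<Rightarrow> 'b::real_normed_vector) \<Rightarrow> bool" where
  "smooth_on S f \<longleftrightarrow> (\<forall>k. Ck_on k S f)"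


section \<open>Intrinsic planes and intrinsic graphs\<close>

text \<open>
  A two-dimensional Lie subgroup is taken in the general (immersed) sense: a subgroup with a
  second countable group topology \<open>T\<close>, possibly finer than the subspace topology, having local
  parametrizations by open subsets of the plane that are smooth immersions into the ambient
  space. The Hausdorff property of \<open>T\<close>, the smoothness of the transition maps and that of the
  group operations in these parametrizations need not be required, since they follow: the
  inclusion is continuous, and an immersion has local smooth left inverses.
\<close>

definition lie_subgroup2 :: "pt set \<Rightarrow> bool" where
  "lie_subgroup2 W \<longleftrightarrow> subgroup W Heis \<and>
     (\<exists>T. topspace T = W \<and> second_countable T \<and>
        continuous_map (prod_topology T T) T (\<lambda>(p, q). p \<otimes>\<^bsub>Heis\<^esub> q) \<and>
        continuous_map T T (\<lambda>p. inv\<^bsub>Heis\<^esub> p) \<and>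
        (\<forall>p\<in>W. \<exists>U :: (real \<times> real) set. \<exists>\<psi> :: real \<times> real \<Rightarrow> pt.
           open U \<and> p \<in> \<psi> ` U \<and> openin T (\<psi> ` U) \<and>
           homeomorphic_map (top_of_set U) (subtopology T (\<psi> ` U)) \<psi> \<and>
           smooth_on U \<psi> \<and> (\<forall>u\<in>U. inj (frechet_derivative \<psi> (at u)))))"

definition intrinsic_plane :: "pt set \<Rightarrow> bool" where
  "intrinsic_plane P \<longleftrightarrow>
     (\<exists>W p. lie_subgroup2 W \<and> (P = p <#\<^bsub>Heis\<^esub> W \<or> P = W #>\<^bsub>Heis\<^esub> p))"

definition intrinsic_graph :: "(real \<times> real) set \<Rightarrow> (real \<times> real \<Rightarrow> real) \<Rightarrow> pt set" where
  "intrinsic_graph \<omega> f = (\<lambda>(y, t). (0, y, t) \<otimes>\<^bsub>Heis\<^esub> (f (y, t), 0, 0)) ` \<omega>"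

lemma intrinsic_graph_eq:
  "intrinsic_graph \<omega> f = (\<lambda>(y, t). (f (y, t), y, t - y * f (y, t) / 2)) ` \<omega>"
  by (auto simp: intrinsic_graph_def Heis_def image_iff Bex_def mult.commute)


section \<open>Sobolev functions on open subsets of the plane\<close>

definition spt :: "(real \<times> real \<Rightarrow> real) \<Rightarrow> (real \<times> real) set" where
  "spt \<phi> = closure {p. \<phi> p \<noteq> 0}"

definition test_functions :: "(real \<times> real) set \<Rightarrow> (real \<times> real \<Rightarrow> real) set" where
  "test_functions \<omega> = {\<phi>. smooth_on UNIV \<phi> \<and> compact (spt \<phi>) \<and> spt \<phi> \<subseteq> \<omega>}"

definition Lp_loc :: "real \<Rightarrow> (real \<times> real) set \<Rightarrow> (real \<times> real \<Rightarrow> real) set" where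
  "Lp_loc p \<omega> = {u. \<forall>K. compact K \<and> K \<subseteq> \<omega> \<longrightarrow>
     set_borel_measurable lebesgue K u \<and> set_integrable lebesgue K (\<lambda>x. \<bar>u x\<bar> powr p)}"

text \<open>\<open>g\<close> is the weak derivative of \<open>u\<close> in the direction \<open>v\<close>.\<close>

definition has_weak_derivative ::
  "(real \<times> real) set \<Rightarrow> real \<times> real \<Rightarrow> (real \<times> real \<Rightarrow> real) \<Rightarrow> (real \<times> real \<Rightarrow> real) \<Rightarrow> bool" where
  "has_weak_derivative \<omega> v u g \<longleftrightarrow> u \<in> Lp_loc 1 \<omega> \<and> g \<in> Lp_loc 1 \<omega> \<and>
     (\<forall>\<phi>\<in>test_functions \<omega>.
        (LINT x:\<omega>|lebesgue. u x * frechet_derivative \<phi> (at x) v) = - (LINT x:\<omega>|lebesgue. g x * \<phi> x))"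

definition W1p_loc :: "real \<Rightarrow> (real \<times> real) set \<Rightarrow> (real \<times> real \<Rightarrow> real) set" where
  "W1p_loc p \<omega> = {u \<in> Lp_loc p \<omega>. \<forall>v\<in>{(1, 0), (0, 1)}. \<exists>g\<in>Lp_loc p \<omega>. has_weak_derivative \<omega> v u g}"

text \<open>A representative; it is determined almost everywhere in \<open>\<omega>\<close> when a weak derivative exists.\<close>

definition weak_derivative ::
  "(real \<times> real) set \<Rightarrow> real \<times> real \<Rightarrow> (real \<times> real \<Rightarrow> real) \<Rightarrow> real \<times> real \<Rightarrow> real" where
  "weak_derivative \<omega> v u = (SOME g. has_weak_derivative \<omega> v u g)"


section \<open>The intrinsic gradient and the area functional\<close>

text \<open>\<open>nabla \<omega> f h\<close> is \<open>\<nabla>\<^sup>f h = \<partial>\<^sub>y h + f \<partial>\<^sub>t h\<close>.\<close>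

definition nabla ::
  "(real \<times> real) set \<Rightarrow> (real \<times> real \<Rightarrow> real) \<Rightarrow> (real \<times> real \<Rightarrow> real) \<Rightarrow> real \<times> real \<Rightarrow> real" where
  "nabla \<omega> f h x = weak_derivative \<omega> (1, 0) h x + f x * weak_derivative \<omega> (0, 1) h x"

text \<open>Continuity of \<open>\<nabla>\<^sup>f f\<close>, an almost-everywhere class, means having a continuous representative.\<close>

definition C1W :: "(real \<times> real) set \<Rightarrow> (real \<times> real \<Rightarrow> real) set" where
  "C1W \<omega> = {f \<in> W1p_loc 1 \<omega>. continuous_on \<omega> f \<and>
     (\<exists>g. continuous_on \<omega> g \<and> (AE x in lebesgue. x \<in> \<omega> \<longrightarrow> nabla \<omega> f f x = g x))}"

definition area :: "(real \<times> real) set \<Rightarrow> (real \<times> real \<Rightarrow> real) \<Rightarrow> (real \<times> real) set \<Rightarrow> ennreal" where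
  "area \<omega> f E = (\<integral>\<^sup>+x\<in>E. ennreal (sqrt (1 + (nabla \<omega> f f x)\<^sup>2)) \<partial>lebesgue)"

definition area_along ::
  "(real \<times> real) set \<Rightarrow> (real \<times> real \<Rightarrow> real) \<Rightarrow> (real \<times> real \<Rightarrow> real) \<Rightarrow> real \<Rightarrow> ennreal" where
  "area_along \<omega> f \<phi> \<epsilon> = area \<omega> (\<lambda>x. f x + \<epsilon> * \<phi> x) (spt \<phi>)"

text \<open>
  The variations are stated relationally: \<open>I\<^sub>f(\<phi>) = a\<close>, respectively \<open>II\<^sub>f(\<phi>) = b\<close>, includes that
  the area is finite for small \<open>\<epsilon>\<close> and that the derivative exists.
\<close>

definition has_first_variation ::
  "(real \<times> real) set \<Rightarrow> (real \<times> real \<Rightarrow> real) \<Rightarrow> (real \<times> real \<Rightarrow> real) \<Rightarrow> real \<Rightarrow> bool" where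
  "has_first_variation \<omega> f \<phi> a \<longleftrightarrow>
     (\<forall>\<^sub>F \<epsilon> in nhds 0. area_along \<omega> f \<phi> \<epsilon> < \<infinity>) \<and>
     ((\<lambda>\<epsilon>. enn2real (area_along \<omega> f \<phi> \<epsilon>)) has_real_derivative a) (at 0)"

definition has_second_variation ::
  "(real \<times> real) set \<Rightarrow> (real \<times> real \<Rightarrow> real) \<Rightarrow> (real \<times> real \<Rightarrow> real) \<Rightarrow> real \<Rightarrow> bool" where
  "has_second_variation \<omega> f \<phi> b \<longleftrightarrow>
     (\<forall>\<^sub>F \<epsilon> in nhds 0. area_along \<omega> f \<phi> \<epsilon> < \<infinity>) \<and>
     (\<exists>G. (\<forall>\<^sub>F \<epsilon> in nhds 0.
             ((\<lambda>\<epsilon>. enn2real (area_along \<omega> f \<phi> \<epsilon>)) has_real_derivative G \<epsilon>) (at \<epsilon>)) \<and>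
          (G has_real_derivative b) (at 0))"

definition stationary_on :: "(real \<times> real) set \<Rightarrow> (real \<times> real \<Rightarrow> real) \<Rightarrow> bool" where
  "stationary_on \<omega> f \<longleftrightarrow>
     f \<in> W1p_loc 1 \<omega> \<and> (\<forall>\<phi>\<in>test_functions \<omega>. has_first_variation \<omega> f \<phi> 0)"

definition stable_on :: "(real \<times> real) set \<Rightarrow> (real \<times> real \<Rightarrow> real) \<Rightarrow> bool" where
  "stable_on \<omega> f \<longleftrightarrow>
     stationary_on \<omega> f \<and> (\<forall>\<phi>\<in>test_functions \<omega>. \<exists>b\<ge>0. has_second_variation \<omega> f \<phi> b)"


section \<open>Local Lipschitz continuity and the Cantor set\<close>

definition locally_lipschitz_on ::
  "'a set \<Rightarrow> ('a::metric_space \<Rightarrow> 'b::metric_space) \<Rightarrow> bool" where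
  "locally_lipschitz_on X f \<longleftrightarrow> (\<forall>x\<in>X. \<exists>r>0. \<exists>L. L-lipschitz_on (cball x r \<inter> X) f)"

fun cantor_level :: "nat \<Rightarrow> real set" where
  "cantor_level 0 = {0..1}"
| "cantor_level (Suc n) =
     (\<lambda>x. x / 3) ` cantor_level n \<union> (\<lambda>x. (x + 2) / 3) ` cantor_level n"

definition cantor_set :: "real set" where
  "cantor_set = (\<Inter>n. cantor_level n)"

end

theory Submission
  imports Defs "HOL-Real_Asymp.Real_Asymp"
begin

text \<open>
  Let \<open>c\<close> be the Cantor function and foliate the plane by the parabolas
  \<open>t = u + c(u) y\<^sup>2 / 2\<close>, \<open>u \<in> \<real>\<close>. The slope of the leaf through \<open>(y, t)\<close> defines
  \<open>f(y, t) = y c(u)\<close>, so that \<open>\<nabla>\<^sup>f f = c(u)\<close> is continuous. Since \<open>c\<close> is constant off the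
  Cantor set and \<open>t \<mapsto> c(u)\<close> is Lipschitz for \<open>y \<noteq> 0\<close>, \<open>f\<close> is singular only on \<open>{0} \<times> C\<close>.

  In the coordinates \<open>(y, u)\<close>, \<open>dt = du + (y\<^sup>2 / 2) dc(u)\<close>, where the measure \<open>dc\<close> lives on the
  null set \<open>C\<close>; we parametrize it by \<open>v = c(u) \<in> (0, 1)\<close>. On the regular part \<open>\<partial>\<^sub>t f = 0\<close>, on the
  singular part \<open>\<partial>\<^sub>t f = 2 / y\<close>. Along each leaf the first variation is then the integral of an
  exact derivative. Writing \<open>X\<close> for the derivative along the leaf, and with the weight
  \<open>G(v) = (1 + v\<^sup>2) powr (- 3 / 2)\<close>, the singular part contributes to the second variation
  \<open>G (y X\<phi> + 2 \<phi>)\<^sup>2 / 2 - G \<phi>\<^sup>2 = G (X(y \<phi>))\<^sup>2 / 2 + G X(y \<phi>\<^sup>2) / 2\<close>,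
  whose last term integrates to zero, and the regular part is a square.

  The graph is not a coset of any subgroup: it contains the identity, so it would be a subgroup,
  but it is not closed under the group operations.
\<close>

section \<open>Smooth bump functions\<close>

text \<open>The obstacle is that the passage from \<open>(y, u)\<close> to \<open>(y, t)\<close> is
  not absolutely continuous: the null set \<open>C\<close> of feet carries leaves that together fill
  positive area, so neither a Jacobian formula nor a pointwise chain rule is available for
  \<open>f\<close>. Derivatives are therefore taken along single leaves, which are honest parabolas,
  and differentiation of functions of \<open>A\<close> in \<open>t\<close> is replaced by a
  layer-cake formula over the values \<open>v\<close> of \<open>c\<close>. On the singular part dt =
  (y^2 / 2) dv, so the \<open>t\<close>-derivative of \<open>A\<close> is 2 / y^2 and that of f = y
  A is 2 / y. Its square times the weight y^2 / 2 is the constant 2; this is why \<open>f\<close>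
  has square integrable weak derivatives although the one in \<open>t\<close> is unbounded near y =
  0. The term - G \<phi>^2 of the second variation arises from 2 \<phi> \<phi>_t A / sqrt (1 + A^2)
  by integrating by parts in \<open>t\<close>: the function p / sqrt (1 + p^2) has derivative G, and
  the derivative of \<open>A\<close> in \<open>t\<close> lives on the singular part only. Since
  \<open>nabla\<close> is built from arbitrarily chosen weak derivatives, their uniqueness must come
  before any computation of areas; the bump functions serve that purpose.\<close>

lemma smooth_onI_class:
  assumes "\<And>f x. f \<in> F \<Longrightarrow> f differentiable (at x)"
    and "\<And>f v. f \<in> F \<Longrightarrow> (\<lambda>x. frechet_derivative f (at x) v) \<in> F"
    and "f \<in> F"
  shows "smooth_on UNIV f"
proof -
  have "Ck_on k UNIV f" if "f \<in> F" for k f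
    using that
  proof (induction k arbitrary: f)
    case 0
    then show ?case
      using assms(1) by (auto intro!: differentiable_imp_continuous_on simp: differentiable_on_def)
  next
    case (Suc k)
    then show ?case using assms(1,2) by auto
  qed
  then show ?thesis using assms(3) by (auto simp: smooth_on_def)
qed

lemma smooth_on_UNIV_differentiable:
  assumes "smooth_on UNIV f" shows "f differentiable (at x)"
proof -
  have "Ck_on (Suc 0) UNIV f" using assms unfolding smooth_on_def by blast
  then show ?thesis by simp
qed

lemma smooth_on_UNIV_continuous: "smooth_on UNIV f \<Longrightarrow> continuous_on UNIV f"
  by (intro differentiable_imp_continuous_on) (simp add: differentiable_on_def smooth_on_UNIV_differentiable)

lemma smooth_on_UNIV_continuous_derivative:
  assumes "smooth_on UNIV f"
  shows "continuous_on UNIV (\<lambda>x. frechet_derivative f (at x) v)"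
proof -
  have "Ck_on (Suc 0) UNIV f" using assms unfolding smooth_on_def by blast
  then show ?thesis by simp
qed

text \<open>The power of \<open>u\<close> in the denominator is carried along so that the derivative
  of a member of the family is again a combination of members.\<close>

definition flat :: "nat \<Rightarrow> real \<Rightarrow> real" where
  "flat k u = (if u > 0 then exp (- (1 / u)) / u ^ k else 0)"

lemma flat_tendsto_0: "(flat k \<longlongrightarrow> 0) (at 0)"
proof -
  have "((\<lambda>u. (1 / u) ^ k / exp (1 / u)) \<longlongrightarrow> (0::real)) (at_right 0)"
    by (rule filterlim_compose[OF tendsto_power_div_exp_0])
       (simp add: filterlim_inverse_at_top_right[unfolded inverse_eq_divide])
  then have "(flat k \<longlongrightarrow> 0) (at_right 0)"
    by (rule Lim_transform_eventually)
       (auto simp: flat_def eventually_at_right_field exp_minus power_divide field_simps intro!: exI[of _ 1])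
  moreover have "(flat k \<longlongrightarrow> 0) (at_left 0)"
    by (rule Lim_transform_eventually[OF tendsto_const])
       (auto simp: flat_def eventually_at_left_field intro!: exI[of _ "-1"])
  ultimately show ?thesis by (simp add: filterlim_split_at)
qed

lemma DERIV_flat: "(flat k has_real_derivative flat (k + 2) u - k * flat (Suc k) u) (at u)"
proof (cases u "0::real" rule: linorder_cases)
  case greater
  have "((\<lambda>u. exp (- (1 / u)) / u ^ k) has_real_derivative flat (k + 2) u - k * flat (Suc k) u) (at u)"
  proof (cases k)
    case 0
    show ?thesis using greater unfolding 0
      by (auto intro!: derivative_eq_intros simp: flat_def power2_eq_square)
  next
    case (Suc m)
    show ?thesis using greater unfolding Suc
      by (auto intro!: derivative_eq_intros simp: flat_def) (cases m; auto simp: divide_simps power2_eq_square algebra_simps)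
  qed
  then show ?thesis
    by (rule DERIV_cong_ev[THEN iffD1, rotated -1])
       (use eventually_nhds_in_open[of "{0<..}" u] greater in \<open>auto simp: flat_def elim!: eventually_mono\<close>)
next
  case less
  have "((\<lambda>u. 0) has_real_derivative flat (k + 2) u - k * flat (Suc k) u) (at u)"
    using less by (auto simp: flat_def)
  then show ?thesis
    by (rule DERIV_cong_ev[THEN iffD1, rotated -1])
       (use eventually_nhds_in_open[of "{..<0}" u] less in \<open>auto simp: flat_def elim!: eventually_mono\<close>)
next
  case equal
  \<comment> \<open>At 0 the difference quotient of \<open>flat k\<close> is
    \<open>flat (Suc k)\<close> itself, whose limit is already known.\<close>
  have "((\<lambda>h. flat (Suc k) h) \<longlongrightarrow> 0) (at 0)" by (rule flat_tendsto_0)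
  moreover have "flat (Suc k) h = flat k h / h" for h by (auto simp: flat_def)
  ultimately show ?thesis using equal by (simp add: DERIV_def flat_def)
qed

text \<open>Closed under directional derivatives, hence consisting of smooth functions.\<close>

inductive_set flat_algebra :: "(real \<times> real \<Rightarrow> real) set" where
  const: "(\<lambda>x. a) \<in> flat_algebra"
| fst: "fst \<in> flat_algebra"
| snd: "snd \<in> flat_algebra"
| add: "p \<in> flat_algebra \<Longrightarrow> q \<in> flat_algebra \<Longrightarrow> (\<lambda>x. p x + q x) \<in> flat_algebra"
| mult: "p \<in> flat_algebra \<Longrightarrow> q \<in> flat_algebra \<Longrightarrow> (\<lambda>x. p x * q x) \<in> flat_algebra"
| flat: "p \<in> flat_algebra \<Longrightarrow> (\<lambda>x. flat k (p x)) \<in> flat_algebra"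

lemma flat_algebra_derivative:
  assumes "f \<in> flat_algebra"
  shows "\<exists>f'. (\<forall>x. (f has_derivative f' x) (at x)) \<and> (\<forall>v. (\<lambda>x. f' x v) \<in> flat_algebra)"
  using assms
proof induction
  case (const a)
  show ?case by (intro exI[of _ "\<lambda>x v. 0"]) (auto intro: flat_algebra.intros)
next
  case fst
  show ?case by (intro exI[of _ "\<lambda>x. fst"]) (auto intro!: flat_algebra.intros derivative_eq_intros)
next
  case snd
  show ?case by (intro exI[of _ "\<lambda>x. snd"]) (auto intro!: flat_algebra.intros derivative_eq_intros)
next
  case (add p q)
  then obtain p' q' where "\<And>x. (p has_derivative p' x) (at x)" "\<And>v. (\<lambda>x. p' x v) \<in> flat_algebra"
    "\<And>x. (q has_derivative q' x) (at x)" "\<And>v. (\<lambda>x. q' x v) \<in> flat_algebra" by blast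
  then show ?case by (intro exI[of _ "\<lambda>x v. p' x v + q' x v"]) (auto intro!: flat_algebra.intros derivative_eq_intros)
next
  case (mult p q)
  then obtain p' q' where "\<And>x. (p has_derivative p' x) (at x)" "\<And>v. (\<lambda>x. p' x v) \<in> flat_algebra"
    "\<And>x. (q has_derivative q' x) (at x)" "\<And>v. (\<lambda>x. q' x v) \<in> flat_algebra" by blast
  then show ?case using mult
    by (intro exI[of _ "\<lambda>x v. p x * q' x v + p' x v * q x"]) (auto intro!: flat_algebra.intros has_derivative_mult)
next
  case (flat p k)
  then obtain p' where p: "\<And>x. (p has_derivative p' x) (at x)" "\<And>v. (\<lambda>x. p' x v) \<in> flat_algebra" by blast
  have "((\<lambda>x. flat k (p x)) has_derivative
      (\<lambda>v. (flat (k + 2) (p x) + (- real k) * flat (Suc k) (p x)) * p' x v)) (at x)" for x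
    using has_derivative_compose[OF p(1)[of x] DERIV_flat[unfolded has_field_derivative_def, of k "p x"]]
    by simp
  moreover have "(\<lambda>x. (flat (k + 2) (p x) + (- real k) * flat (Suc k) (p x)) * p' x v) \<in> flat_algebra" for v
    by (intro flat_algebra.intros p(2) flat.hyps)
  ultimately show ?case
    by (intro exI[of _ "\<lambda>x v. (flat (k + 2) (p x) + (- real k) * flat (Suc k) (p x)) * p' x v"] conjI allI)
qed

lemma smooth_on_flat_algebra:
  assumes "f \<in> flat_algebra" shows "smooth_on UNIV f"
proof (rule smooth_onI_class[OF _ _ assms])
  fix f :: "real \<times> real \<Rightarrow> real" and x v assume "f \<in> flat_algebra"
  then obtain f' where f': "\<And>x. (f has_derivative f' x) (at x)" "\<And>v. (\<lambda>x. f' x v) \<in> flat_algebra"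
    using flat_algebra_derivative by blast
  show "f differentiable (at x)" using f'(1) unfolding differentiable_def by blast
  have "frechet_derivative f (at x) = f' x" for x
    using frechet_derivative_at[OF f'(1)] by simp
  then show "(\<lambda>x. frechet_derivative f (at x) v) \<in> flat_algebra" using f'(2) by simp
qed

text \<open>Each factor exp (- 1 / (n w)) tends to 1 where w > 0 and vanishes elsewhere, so the
  parameter \<open>n\<close> makes the bumps converge boundedly to the indicator of the open
  box.\<close>

definition box_bump :: "real \<Rightarrow> real \<Rightarrow> real \<Rightarrow> real \<Rightarrow> nat \<Rightarrow> real \<times> real \<Rightarrow> real" where
  "box_bump a b c d n x =
     flat 0 (real n * ((fst x - a) * (b - fst x))) * flat 0 (real n * ((snd x - c) * (d - snd x)))"

lemma flat_0_bounds: "0 \<le> flat 0 u" "flat 0 u \<le> 1"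
  by (auto simp: flat_def)

lemma smooth_box_bump: "smooth_on UNIV (box_bump a b c d n)"
proof (rule smooth_on_flat_algebra)
  have "(\<lambda>x. flat 0 (real n * ((fst x + - a) * (b + (-1) * fst x))) * flat 0 (real n * ((snd x + - c) * (d + (-1) * snd x)))) \<in> flat_algebra"
    by (intro flat_algebra.intros)
  then show "box_bump a b c d n \<in> flat_algebra"
    by (simp add: box_bump_def[abs_def])
qed

lemma box_bump_zero_outside:
  assumes "a < b" "c < d" "x \<notin> box (a, c) (b, d)" shows "box_bump a b c d n x = 0"
proof -
  have "u \<in> {p<..<q}" if "0 < real n * ((u - p) * (q - u))" "p < q" for u p q :: real
    using that by (auto simp: zero_less_mult_iff)
  then have "flat 0 (real n * ((u - p) * (q - u))) = 0" if "u \<notin> {p<..<q}" "p < q" for u p q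
    using that unfolding flat_def by meson
  moreover have "fst x \<notin> {a<..<b} \<or> snd x \<notin> {c<..<d}"
    using assms(3) by (cases x) (auto simp: box_def Basis_prod_def)
  ultimately show ?thesis using assms(1,2) by (auto simp: box_bump_def)
qed

lemma box_bump_test_function:
  assumes "a < b" "c < d" shows "box_bump a b c d n \<in> test_functions UNIV"
proof -
  have "spt (box_bump a b c d n) \<subseteq> cbox (a, c) (b, d)"
    unfolding spt_def
  proof (rule closure_minimal)
    show "{p. box_bump a b c d n p \<noteq> 0} \<subseteq> cbox (a, c) (b, d)"
      using box_bump_zero_outside[OF assms] box_subset_cbox[of "(a, c)" "(b, d)"] by blast
  qed (rule closed_cbox)
  then have "compact (spt (box_bump a b c d n))"
    unfolding spt_def by (metis bounded_cbox bounded_subset closed_closure compact_eq_bounded_closed)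
  then show ?thesis by (simp add: test_functions_def smooth_box_bump)
qed

lemma box_bump_tendsto:
  assumes "a < b" "c < d"
  shows "(\<lambda>n. box_bump a b c d n x) \<longlonglongrightarrow> indicator (box (a, c) (b, d)) x"
proof (cases "x \<in> box (a, c) (b, d)")
  case False
  then show ?thesis by (simp add: box_bump_zero_outside[OF assms])
next
  case True
  have "(\<lambda>n. flat 0 (real n * w)) \<longlonglongrightarrow> 1" if "w > 0" for w
  proof -
    have "filterlim (\<lambda>n. real n * w) at_top sequentially"
      using that filterlim_real_sequentially
      by (subst mult.commute) (rule filterlim_tendsto_pos_mult_at_top[OF tendsto_const])
    then have "(\<lambda>n. exp (- (1 / (real n * w)))) \<longlonglongrightarrow> exp (- 0)"
      by (intro tendsto_intros) (auto intro: tendsto_divide_0 filterlim_at_top_imp_at_infinity)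
    then show ?thesis
      by (simp, elim Lim_transform_eventually)
         (use eventually_gt_at_top[of "0::nat"] that in \<open>auto simp: flat_def zero_less_mult_iff elim!: eventually_mono\<close>)
  qed
  from tendsto_mult[OF this this, of "(fst x - a) * (b - fst x)" "(snd x - c) * (d - snd x)"] True
  show ?thesis by (cases x) (auto simp: box_bump_def[abs_def] box_def Basis_prod_def)
qed

lemma abs_box_bump_le:
  assumes "a < b" "c < d"
  shows "\<bar>box_bump a b c d n x\<bar> \<le> indicator (cbox (a, c) (b, d)) x"
proof (cases "x \<in> box (a, c) (b, d)")
  case False
  then show ?thesis by (simp add: box_bump_zero_outside[OF assms])
next
  case True
  then have "x \<in> cbox (a, c) (b, d)" using box_subset_cbox by blast
  then show ?thesis
    using flat_0_bounds by (auto simp: box_bump_def abs_mult intro!: mult_le_one)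
qed

section \<open>Uniqueness of weak derivatives\<close>

lemma borel_measurable_lborel_eq: "f \<in> borel_measurable borel \<Longrightarrow> f \<in> borel_measurable lborel"
  by simp

text \<open>Open boxes are stable under intersection and generate the Borel sets, so a Dynkin
  argument extends the vanishing to all Borel sets; a density is determined by its
  integrals.\<close>

lemma integral_zero_on_boxes_imp_AE_zero:
  fixes f :: "'a::euclidean_space \<Rightarrow> real"
  assumes int: "integrable lborel f"
    and box: "\<And>a b. (LINT x:box a b|lborel. f x) = 0"
  shows "AE x in lborel. f x = 0"
proof -
  have si: "set_integrable lborel A f" if "A \<in> sets borel" for A
    unfolding set_integrable_def
    by (rule integrable_mult_indicator) (use that int in auto)
  \<comment> \<open>Complements in the Dynkin system need the integral over the whole space,
    obtained by exhausting it with boxes.\<close>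
  have total: "(LINT x:UNIV|lborel. f x) = 0"
  proof -
    define B where "B n = box (- real n *\<^sub>R One) (real n *\<^sub>R (One :: 'a))" for n
    have inc: "incseq B"
      unfolding incseq_def B_def
      by (intro allI impI subset_box_imp) auto
    have "(\<lambda>n. LINT x:B n|lborel. f x) \<longlonglongrightarrow> (LINT x:(\<Union>n. B n)|lborel. f x)"
      by (rule set_integral_cont_up[OF _ inc]) (auto simp: B_def intro!: si)
    moreover have "(\<Union>n. B n) = UNIV"
      unfolding B_def using UN_box_eq_UNIV by simp
    moreover have "(LINT x:B n|lborel. f x) = 0" for n by (simp add: B_def box)
    ultimately show ?thesis by (simp add: LIMSEQ_unique)
  qed
  have "(LINT x:A|lborel. f x) = 0" if "A \<in> sets borel" for A
  proof -
    have "Int_stable (range (\<lambda>(a, b). box a b :: 'a set))"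
      by (auto simp: Int_stable_def box_Int_box)
    moreover have "range (\<lambda>(a, b). box a b :: 'a set) \<subseteq> Pow UNIV" by simp
    moreover have "A \<in> sigma_sets UNIV (range (\<lambda>(a, b). box a b))"
      using that by (simp add: borel_eq_box)
    ultimately show ?thesis
    proof (induction rule: sigma_sets_induct_disjoint)
      case (basic A)
      then show ?case using box by auto
    next
      case empty
      show ?case by (simp add: set_lebesgue_integral_def)
    next
      case (compl A)
      then have "A \<in> sets borel" by (simp add: borel_eq_box)
      then have "(LINT x:A \<union> (UNIV - A)|lborel. f x) = (LINT x:A|lborel. f x) + (LINT x:UNIV - A|lborel. f x)"
        by (intro set_integral_Un si) auto
      then show ?case using total compl by simp
    next
      case (union A)
      then have "A i \<in> sets borel" for i by (auto simp: borel_eq_box)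
      then have "(LINT x:(\<Union>i. A i)|lborel. f x) = (\<Sum>i. LINT x:A i|lborel. f x)"
        using union(1) by (intro lebesgue_integral_countable_add si) (auto simp: disjoint_family_on_def)
      then show ?case using union by simp
    qed
  qed
  then have "AE x in lborel. f x = (\<lambda>x. 0) x"
    by (intro density_unique_real int) auto
  then show ?thesis by simp
qed

lemma Lp_loc_1_set_integrable:
  assumes "g \<in> Lp_loc 1 \<omega>" "compact K" "K \<subseteq> \<omega>"
  shows "set_integrable lebesgue K g"
proof -
  have m: "set_borel_measurable lebesgue K g" and i: "set_integrable lebesgue K (\<lambda>x. \<bar>g x\<bar> powr 1)"
    using assms by (auto simp: Lp_loc_def)
  show ?thesis
    unfolding set_integrable_def
    by (rule Bochner_Integration.integrable_bound[OF i[unfolded set_integrable_def]])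
       (use m in \<open>auto simp: set_borel_measurable_def indicator_def\<close>)
qed

text \<open>Testing with bumps that converge to the indicator of a box gives, by dominated
  convergence, a zero integral over every box.\<close>

lemma fundamental_lemma_calculus_of_variations:
  assumes g: "g \<in> Lp_loc 1 UNIV"
    and zero: "\<And>\<phi>. \<phi> \<in> test_functions UNIV \<Longrightarrow> (LINT x|lebesgue. g x * \<phi> x) = 0"
  shows "AE x in lebesgue. g x = 0"
proof -
  have box0: "(LINT x:box p q|lebesgue. g x) = 0" for p q :: "real \<times> real"
  proof (cases "box p q = {}")
    case False
    obtain a c b d where pq: "p = (a, c)" "q = (b, d)" by (metis surj_pair)
    have less: "a < b" "c < d" using False by (auto simp: pq box_ne_empty Basis_prod_def)
    have gi: "set_integrable lebesgue (cbox p q) g"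
      by (rule Lp_loc_1_set_integrable[OF g]) auto
    let ?K = "cbox p q"
    have "(\<lambda>n. LINT x|lebesgue. (indicator ?K x * g x) * box_bump a b c d n x) \<longlonglongrightarrow>
          (LINT x|lebesgue. (indicator ?K x * g x) * indicator (box p q) x)"
    proof (rule integral_dominated_convergence[where w = "\<lambda>x. \<bar>indicator ?K x * g x\<bar>"])
      have gm: "(\<lambda>x. indicator ?K x * g x) \<in> borel_measurable lebesgue"
        using gi by (auto simp: set_integrable_def dest: borel_measurable_integrable)
      have bm: "box_bump a b c d n \<in> borel_measurable lebesgue" for n
        using smooth_on_UNIV_differentiable[OF smooth_box_bump]
        by (intro measurable_completion borel_measurable_continuous_onI[THEN borel_measurable_lborel_eq]
              differentiable_imp_continuous_on) (auto simp: differentiable_on_def)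
      show "(\<lambda>x. (indicator ?K x * g x) * indicator (box p q) x) \<in> borel_measurable lebesgue"
        by (rule borel_measurable_times[OF gm borel_measurable_indicator]) (rule fmeasurableD[OF lmeasurable_box])
      show "(\<lambda>x. (indicator ?K x * g x) * box_bump a b c d n x) \<in> borel_measurable lebesgue" for n
        by (rule borel_measurable_times[OF gm bm])
      show "integrable lebesgue (\<lambda>x. \<bar>indicator ?K x * g x\<bar>)"
        using gi by (auto simp: set_integrable_def)
      show "AE x in lebesgue. (\<lambda>n. (indicator ?K x * g x) * box_bump a b c d n x)
              \<longlonglongrightarrow> (indicator ?K x * g x) * indicator (box p q) x"
        using box_bump_tendsto[OF less] by (auto simp: pq intro!: tendsto_mult)
      have "\<bar>(indicator ?K x * g x) * box_bump a b c d n x\<bar> \<le> \<bar>indicator ?K x * g x\<bar>" for x n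
        using order_trans[OF abs_box_bump_le[OF less, of n x] indicator_le_1]
        by (simp add: abs_mult mult_left_le)
      then show "AE x in lebesgue. norm ((indicator ?K x * g x) * box_bump a b c d n x) \<le> \<bar>indicator ?K x * g x\<bar>" for n
        by simp
    qed
    moreover have "(indicator ?K x * g x) * box_bump a b c d n x = g x * box_bump a b c d n x" for x n
      using abs_box_bump_le[OF less, of n x] by (auto simp: pq indicator_def split: if_splits)
    moreover have "(LINT x|lebesgue. g x * box_bump a b c d n x) = 0" for n
      by (rule zero) (rule box_bump_test_function[OF less])
    ultimately have "(LINT x|lebesgue. (indicator ?K x * g x) * indicator (box p q) x) = 0"
      by (simp add: LIMSEQ_unique)
    also have "(\<lambda>x. (indicator ?K x * g x) * indicator (box p q) x) = (\<lambda>x. indicator (box p q) x *\<^sub>R g x)"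
      using box_subset_cbox[of p q] by (intro ext) (auto simp: indicator_def)
    finally show ?thesis by (simp add: set_lebesgue_integral_def)
  qed (simp add: set_lebesgue_integral_def)
  \<comment> \<open>As \<open>g\<close> is only locally integrable, it is cut off to growing boxes
    before the criterion for integrable functions is applied; countably many exceptional sets are
    then united.\<close>
  have "AE x in lebesgue. x \<in> box (- real n, - real n) (real n, real n) \<longrightarrow> g x = 0" for n
  proof -
    let ?B = "box (- real n, - real n) (real n, real n)"
    have "set_integrable lebesgue (cbox (- real n, - real n) (real n, real n)) g"
      by (rule Lp_loc_1_set_integrable[OF g]) auto
    then have gi: "integrable lebesgue (\<lambda>x. indicator ?B x *\<^sub>R g x)"
      unfolding set_integrable_def[symmetric]
      by (rule set_integrable_subset) (auto simp: box_subset_cbox)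
    \<comment> \<open>The box criterion concerns \<open>lborel\<close>, while \<open>g\<close> is
      merely Lebesgue measurable, so a Borel representative of the cut-off function takes its
      place.\<close>
    obtain h where h: "h \<in> borel_measurable lborel" "AE x in lborel. indicator ?B x *\<^sub>R g x = h x"
      using completion_ex_borel_measurable_real[OF borel_measurable_integrable[OF gi]] by blast
    have hm: "h \<in> borel_measurable lebesgue" by (rule measurable_completion[OF h(1)])
    have "integrable lebesgue h"
      by (rule integrable_cong_AE[THEN iffD1, OF borel_measurable_integrable[OF gi] hm AE_completion[OF h(2)] gi])
    then have hi: "integrable lborel h"
      using integrable_completion[OF h(1)] by blast
    have "AE x in lborel. h x = 0"
    proof (rule integral_zero_on_boxes_imp_AE_zero[OF hi])
      fix p q :: "real \<times> real"
      obtain p' q' where pq: "?B \<inter> box p q = box p' q'" by (rule that[OF box_Int_box])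
      have "(LINT x:box p q|lborel. h x) = (LINT x|lebesgue. indicator (box p q) x *\<^sub>R h x)"
        unfolding set_lebesgue_integral_def using h(1) by (intro integral_completion[symmetric]) auto
      also have "\<dots> = (LINT x|lebesgue. indicator (box p q) x *\<^sub>R indicator ?B x *\<^sub>R g x)"
      proof (rule integral_cong_AE)
        have b: "box p q \<in> sets lebesgue" by (rule fmeasurableD[OF lmeasurable_box])
        show "(\<lambda>x. indicator (box p q) x *\<^sub>R h x) \<in> borel_measurable lebesgue"
          "(\<lambda>x. indicator (box p q) x *\<^sub>R indicator ?B x *\<^sub>R g x) \<in> borel_measurable lebesgue"
          by (rule borel_measurable_scaleR[OF borel_measurable_indicator[OF b] hm],
              rule borel_measurable_scaleR[OF borel_measurable_indicator[OF b] borel_measurable_integrable[OF gi]])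
        show "AE x in lebesgue. indicator (box p q) x *\<^sub>R h x = indicator (box p q) x *\<^sub>R indicator ?B x *\<^sub>R g x"
          using AE_completion[OF h(2)] by eventually_elim simp
      qed
      also have "\<dots> = (LINT x:box p' q'|lebesgue. g x)"
        unfolding set_lebesgue_integral_def pq[symmetric] indicator_inter_arith
        by (intro Bochner_Integration.integral_cong) simp_all
      finally show "(LINT x:box p q|lborel. h x) = 0" using box0 by simp
    qed
    then have "AE x in lborel. x \<in> ?B \<longrightarrow> g x = 0"
      using h(2) by eventually_elim (auto simp: indicator_def split: if_splits)
    then show ?thesis by (rule AE_completion)
  qed
  then have "AE x in lebesgue. \<forall>n. x \<in> box (- real n, - real n) (real n, real n) \<longrightarrow> g x = 0"
    by (subst AE_all_countable) (rule allI)
  moreover have "\<exists>n. x \<in> box (- real n, - real n) (real n, real n)" for x :: "real \<times> real"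
  proof -
    obtain n where "real n > \<bar>fst x\<bar> + \<bar>snd x\<bar>" using reals_Archimedean2 by blast
    then show ?thesis by (cases x) (auto simp: box_def Basis_prod_def intro!: exI[of _ n])
  qed
  ultimately show ?thesis by auto
qed

lemma outside_spt: "x \<notin> spt \<phi> \<Longrightarrow> \<phi> x = 0"
  using closure_subset[of "{p. \<phi> p \<noteq> 0}"] unfolding spt_def by (metis (mono_tags) mem_Collect_eq subsetD)

lemma continuous_on_imp_borel_measurable_lebesgue:
  fixes f :: "'a::euclidean_space \<Rightarrow> 'b::topological_space"
  assumes "continuous_on UNIV f" shows "f \<in> borel_measurable lebesgue"
  using borel_measurable_continuous_onI[OF assms] by (intro measurable_completion) simp

lemma continuous_on_compact_bound:
  fixes \<phi> :: "'a::topological_space \<Rightarrow> real"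
  assumes "continuous_on UNIV \<phi>" "compact K"
  obtains M where "M \<ge> 0" "\<forall>x\<in>K. \<bar>\<phi> x\<bar> \<le> M"
proof -
  have "compact (\<phi> ` K)" using assms compact_continuous_image continuous_on_subset by blast
  then have "bounded (\<phi> ` K)" by (rule compact_imp_bounded)
  then obtain M where "\<forall>z\<in>\<phi> ` K. norm z \<le> M" unfolding bounded_iff by blast
  then have M: "\<bar>\<phi> x\<bar> \<le> M" if "x \<in> K" for x using that by (metis imageI real_norm_def)
  show thesis
  proof (rule that)
    show "\<forall>x\<in>K. \<bar>\<phi> x\<bar> \<le> max M 0" using M by (simp add: le_max_iff_disj)
  qed simp
qed

lemma integrable_mult_compact_support:
  fixes \<phi> k :: "'a::euclidean_space \<Rightarrow> real"
  assumes cont: "continuous_on UNIV \<phi>" and K: "compact K" and out: "\<And>x. x \<notin> K \<Longrightarrow> \<phi> x = 0"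
    and k: "set_integrable lebesgue K k"
  shows "integrable lebesgue (\<lambda>x. k x * \<phi> x)"
proof -
  obtain M where M: "M \<ge> 0" "\<forall>x\<in>K. \<bar>\<phi> x\<bar> \<le> M" by (rule continuous_on_compact_bound[OF cont K])
  have ki: "integrable lebesgue (\<lambda>x. indicator K x *\<^sub>R k x)"
    using k by (simp add: set_integrable_def)
  have "integrable lebesgue (\<lambda>x. (indicator K x *\<^sub>R k x) * \<phi> x)"
  proof (rule Bochner_Integration.integrable_bound)
    show "integrable lebesgue (\<lambda>x. M * (indicator K x *\<^sub>R k x))" using ki by simp
    show "(\<lambda>x. indicator K x *\<^sub>R k x * \<phi> x) \<in> borel_measurable lebesgue"
      by (rule borel_measurable_times[OF borel_measurable_integrable[OF ki]
            continuous_on_imp_borel_measurable_lebesgue[OF cont]])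
    have "norm (indicator K x *\<^sub>R k x * \<phi> x) \<le> norm (M * (indicator K x *\<^sub>R k x))" for x
    proof (cases "x \<in> K")
      case True
      then have "\<bar>k x\<bar> * \<bar>\<phi> x\<bar> \<le> \<bar>k x\<bar> * M" using M by (intro mult_left_mono) auto
      then show ?thesis using True M(1) by (simp add: abs_mult mult.commute)
    qed simp
    then show "AE x in lebesgue. norm (indicator K x *\<^sub>R k x * \<phi> x) \<le> norm (M * (indicator K x *\<^sub>R k x))"
      by simp
  qed
  moreover have "(\<lambda>x. (indicator K x *\<^sub>R k x) * \<phi> x) = (\<lambda>x. k x * \<phi> x)"
  proof
    fix x show "(indicator K x *\<^sub>R k x) * \<phi> x = k x * \<phi> x"
      using out[of x] by (cases "x \<in> K") simp_all
  qed
  ultimately show ?thesis by simp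
qed

lemma integrable_Lp_loc_mult:
  assumes "k \<in> Lp_loc 1 UNIV" "continuous_on UNIV \<phi>" "compact K" "\<And>x. x \<notin> K \<Longrightarrow> \<phi> x = 0"
  shows "integrable lebesgue (\<lambda>x. k x * \<phi> x)"
  using assms by (intro integrable_mult_compact_support[where K = K] Lp_loc_1_set_integrable) auto

lemma Lp_loc_1I:
  assumes "\<And>K. compact K \<Longrightarrow> set_integrable lebesgue K g"
  shows "g \<in> Lp_loc 1 UNIV"
  unfolding Lp_loc_def
proof safe
  fix K :: "(real \<times> real) set" assume K: "compact K"
  show "set_borel_measurable lebesgue K g"
    using assms[OF K] by (simp add: set_borel_measurable_def set_integrable_def borel_measurable_integrable)
  show "set_integrable lebesgue K (\<lambda>x. \<bar>g x\<bar> powr 1)"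
    using set_integrable_abs[OF assms[OF K]] by simp
qed

text \<open>This is what allows the \<open>SOME\<close> in \<open>weak_derivative\<close> to be
  replaced almost everywhere by any explicitly known weak derivative.\<close>

lemma has_weak_derivative_unique:
  assumes "has_weak_derivative UNIV v u g" "has_weak_derivative UNIV v u h"
  shows "AE x in lebesgue. g x = h x"
proof -
  have g: "g \<in> Lp_loc 1 UNIV" and h: "h \<in> Lp_loc 1 UNIV"
    using assms by (auto simp: has_weak_derivative_def)
  have i: "integrable lebesgue (\<lambda>x. k x * \<phi> x)" if "\<phi> \<in> test_functions UNIV" "k \<in> Lp_loc 1 UNIV" for k \<phi>
    using that by (intro integrable_Lp_loc_mult[where K = "spt \<phi>"])
      (auto simp: test_functions_def outside_spt smooth_on_UNIV_continuous)
  have "(\<lambda>x. g x - h x) \<in> Lp_loc 1 UNIV"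
    using g h by (intro Lp_loc_1I set_integral_diff Lp_loc_1_set_integrable) auto
  then have "AE x in lebesgue. g x - h x = 0"
  proof (rule fundamental_lemma_calculus_of_variations)
    fix \<phi> assume \<phi>: "\<phi> \<in> test_functions UNIV"
    then have "(LINT x|lebesgue. g x * \<phi> x) = (LINT x|lebesgue. h x * \<phi> x)"
      using assms by (simp add: has_weak_derivative_def set_lebesgue_integral_def)
    then show "(LINT x|lebesgue. (g x - h x) * \<phi> x) = 0"
      using i[OF \<phi> g] i[OF \<phi> h] by (simp add: left_diff_distrib)
  qed
  then show ?thesis by simp
qed

section \<open>Differentiation under the integral sign\<close>

text \<open>The mean value inequality bounds the difference quotients by \<open>w\<close>, and
  dominated convergence does the rest. Measurability of \<open>h' e0\<close> is a conclusion: it is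
  a pointwise limit of difference quotients.\<close>

lemma has_real_derivative_integral:
  fixes h h' :: "real \<Rightarrow> 'a \<Rightarrow> real"
  assumes "r > 0"
    and int: "\<And>e. \<bar>e - e0\<bar> < r \<Longrightarrow> integrable M (h e)"
    and der: "\<And>e x. \<bar>e - e0\<bar> < r \<Longrightarrow> ((\<lambda>e. h e x) has_real_derivative h' e x) (at e)"
    and bound: "\<And>e x. \<bar>e - e0\<bar> < r \<Longrightarrow> \<bar>h' e x\<bar> \<le> w x"
    and w: "integrable M w"
  shows "h' e0 \<in> borel_measurable M"
    and "((\<lambda>e. \<integral>x. h e x \<partial>M) has_real_derivative (\<integral>x. h' e0 x \<partial>M)) (at e0)"
proof -
  define q where "q e x = (h e x - h e0 x) / (e - e0)" for e x
  have lim: "(\<lambda>n. q (X n) x) \<longlonglongrightarrow> h' e0 x" if "X \<longlonglongrightarrow> e0" "\<And>n. X n \<noteq> e0" for X x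
  proof -
    have "((\<lambda>e. q e x) \<longlongrightarrow> h' e0 x) (at e0)"
      using der[of e0 x] \<open>r > 0\<close> by (simp add: has_field_derivative_iff q_def)
    then show ?thesis using that by (auto simp: tendsto_at_iff_sequentially o_def)
  qed
  have qb: "\<bar>q e x\<bar> \<le> w x" if "\<bar>e - e0\<bar> < r" "e \<noteq> e0" for e x
  proof -
    have "\<bar>h e x - h e0 x\<bar> \<le> w x * \<bar>e - e0\<bar>"
      using field_differentiable_bound[of "ball e0 r" "\<lambda>e. h e x" "\<lambda>e. h' e x" "w x" e0 e] der bound that \<open>r > 0\<close>
      by (auto simp: dist_real_def abs_minus_commute has_field_derivative_at_within)
    then show ?thesis using that by (simp add: q_def divide_simps)
  qed
  have qm: "q e \<in> borel_measurable M" if "\<bar>e - e0\<bar> < r" for e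
    unfolding q_def using int[OF that] int[of e0] \<open>r > 0\<close>
    by (intro borel_measurable_divide borel_measurable_diff borel_measurable_integrable) auto
  \<comment> \<open>Any sequence that tends to \<open>e0\<close>, avoids it and stays within
    distance \<open>r\<close> would serve.\<close>
  define Y where "Y n = e0 + r / (real n + 2)" for n
  have "Y \<longlonglongrightarrow> e0 + 0" unfolding Y_def by real_asymp
  have Y: "Y n \<noteq> e0" "\<bar>Y n - e0\<bar> < r" for n using \<open>r > 0\<close> by (auto simp: Y_def field_simps add_pos_nonneg)
  show m: "h' e0 \<in> borel_measurable M"
  proof (rule borel_measurable_LIMSEQ_real)
    show "(\<lambda>n. q (Y n) x) \<longlonglongrightarrow> h' e0 x" for x
      using \<open>Y \<longlonglongrightarrow> e0 + 0\<close> Y(1) by (intro lim) simp_all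
    show "q (Y n) \<in> borel_measurable M" for n by (rule qm[OF Y(2)])
  qed
  show "((\<lambda>e. \<integral>x. h e x \<partial>M) has_real_derivative (\<integral>x. h' e0 x \<partial>M)) (at e0)"
    unfolding has_field_derivative_iff tendsto_at_iff_sequentially
  proof (intro allI impI)
    fix X :: "nat \<Rightarrow> real" assume X: "\<forall>i. X i \<in> UNIV - {e0}" "X \<longlonglongrightarrow> e0"
    then obtain N where "\<forall>n\<ge>N. norm (X n - e0) < r"
      using \<open>r > 0\<close> X(2) unfolding LIMSEQ_iff by blast
    then have N: "\<bar>X (n + N) - e0\<bar> < r" for n by simp
    have "(\<lambda>n. \<integral>x. q (X (n + N)) x \<partial>M) \<longlonglongrightarrow> (\<integral>x. h' e0 x \<partial>M)"
    proof (rule integral_dominated_convergence[where w = w])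
      show "AE x in M. (\<lambda>n. q (X (n + N)) x) \<longlonglongrightarrow> h' e0 x"
        using X by (intro AE_I2 lim LIMSEQ_ignore_initial_segment) auto
      show "AE x in M. norm (q (X (n + N)) x) \<le> w x" for n
        using X N by (intro AE_I2) (auto intro!: qb)
    qed (use m w qm N in auto)
    moreover have "(\<integral>x. q (X (n + N)) x \<partial>M) = ((\<integral>x. h (X (n + N)) x \<partial>M) - (\<integral>x. h e0 x \<partial>M)) / (X (n + N) - e0)" for n
      unfolding q_def using int[of e0] int[OF N] \<open>r > 0\<close> by simp
    ultimately have "(\<lambda>n. ((\<integral>x. h (X (n + N)) x \<partial>M) - (\<integral>x. h e0 x \<partial>M)) / (X (n + N) - e0)) \<longlonglongrightarrow> (\<integral>x. h' e0 x \<partial>M)"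
      by simp
    then show "((\<lambda>y. ((\<integral>x. h y x \<partial>M) - (\<integral>x. h e0 x \<partial>M)) / (y - e0)) \<circ> X) \<longlonglongrightarrow> (\<integral>x. h' e0 x \<partial>M)"
      unfolding o_def by (rule LIMSEQ_offset)
  qed
qed

section \<open>Compactly supported functions of class C1\<close>

text \<open>The partial derivatives are explicit data, so that products such as \<phi>^2 or y^2
  \<eta> enter the integral identities with their derivatives written out by the product
  rule.\<close>

definition C1_compact :: "(real \<times> real \<Rightarrow> real) \<Rightarrow> (real \<times> real \<Rightarrow> real) \<Rightarrow> (real \<times> real \<Rightarrow> real) \<Rightarrow> bool" where
  "C1_compact \<phi> \<phi>y \<phi>t \<longleftrightarrow> continuous_on UNIV \<phi>y \<and> continuous_on UNIV \<phi>t \<and> compact (spt \<phi>) \<and>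
     (\<forall>x. (\<phi> has_derivative (\<lambda>v. \<phi>y x * fst v + \<phi>t x * snd v)) (at x))"

lemma test_function_C1_compact:
  assumes "\<phi> \<in> test_functions UNIV"
  shows "C1_compact \<phi> (\<lambda>x. frechet_derivative \<phi> (at x) (1, 0)) (\<lambda>x. frechet_derivative \<phi> (at x) (0, 1))"
proof -
  have s: "smooth_on UNIV \<phi>" and K: "compact (spt \<phi>)" using assms by (auto simp: test_functions_def)
  have "(\<phi> has_derivative (\<lambda>v. frechet_derivative \<phi> (at x) (1, 0) * fst v + frechet_derivative \<phi> (at x) (0, 1) * snd v)) (at x)" for x
  proof -
    have d: "(\<phi> has_derivative frechet_derivative \<phi> (at x)) (at x)"
      using smooth_on_UNIV_differentiable[OF s] frechet_derivative_works by blast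
    interpret linear "frechet_derivative \<phi> (at x)" using d by (rule has_derivative_linear)
    have e: "frechet_derivative \<phi> (at x) v = frechet_derivative \<phi> (at x) (1, 0) * fst v + frechet_derivative \<phi> (at x) (0, 1) * snd v" for v
    proof -
      have "v = fst v *\<^sub>R (1, 0) + snd v *\<^sub>R (0, 1)" by (cases v) simp
      then have "frechet_derivative \<phi> (at x) v = frechet_derivative \<phi> (at x) (fst v *\<^sub>R (1, 0) + snd v *\<^sub>R (0, 1))" by simp
      then show ?thesis by (simp add: add scale mult.commute del: scaleR_Pair)
    qed
    show ?thesis by (rule has_derivative_eq_rhs[OF d]) (rule ext, rule e)
  qed
  then show ?thesis
    unfolding C1_compact_def using K smooth_on_UNIV_continuous_derivative[OF s] by blast
qed

lemma C1_compactD: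
  assumes "C1_compact \<phi> \<phi>y \<phi>t"
  shows "continuous_on UNIV \<phi>" "continuous_on UNIV \<phi>y" "continuous_on UNIV \<phi>t" "compact (spt \<phi>)"
    and "(\<phi> has_derivative (\<lambda>v. \<phi>y x * fst v + \<phi>t x * snd v)) (at x)"
proof -
  show "continuous_on UNIV \<phi>"
    using assms unfolding C1_compact_def
    by (intro continuous_at_imp_continuous_on ballI) (blast intro: has_derivative_continuous)
qed (use assms in \<open>unfold C1_compact_def, blast\<close>)+

lemma C1_compact_outside_spt:
  assumes "C1_compact \<phi> \<phi>y \<phi>t" "x \<notin> spt \<phi>"
  shows "\<phi> x = 0" "\<phi>y x = 0" "\<phi>t x = 0"
proof -
  show "\<phi> x = 0" by (rule outside_spt[OF assms(2)])
  have "open (- spt \<phi>)" unfolding spt_def by (rule open_Compl[OF closed_closure])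
  then have "(\<phi> has_derivative (\<lambda>v. 0)) (at x)"
    using assms(2) outside_spt[of _ \<phi>]
    by (intro has_derivative_transform_within_open[OF has_derivative_const[of 0]]) auto
  from has_derivative_unique[OF this C1_compactD(5)[OF assms(1)]]
  have "0 = \<phi>y x * fst v + \<phi>t x * snd v" for v by metis
  from this[of "(1, 0)"] this[of "(0, 1)"] show "\<phi>y x = 0" "\<phi>t x = 0" by auto
qed

lemma spt_bounded:
  assumes "compact (spt \<phi>)"
  obtains R where "R > 0" "\<And>y t. (y, t) \<in> spt \<phi> \<Longrightarrow> \<bar>y\<bar> \<le> R \<and> \<bar>t\<bar> \<le> R"
proof -
  obtain R where R: "R > 0" "\<forall>x\<in>spt \<phi>. norm x \<le> R"
    using compact_imp_bounded[OF assms] unfolding bounded_pos by blast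
  show thesis
  proof (rule that[OF R(1)])
    fix y t assume "(y, t) \<in> spt \<phi>"
    then have "norm (y, t) \<le> R" using R(2) by blast
    then show "\<bar>y\<bar> \<le> R \<and> \<bar>t\<bar> \<le> R"
      using norm_fst_le[of y t] norm_snd_le[of t y] by auto
  qed
qed

lemma C1_compact_times:
  assumes \<phi>: "C1_compact \<phi> \<phi>y \<phi>t"
    and p: "continuous_on UNIV p" "continuous_on UNIV py" "continuous_on UNIV pt"
    and dp: "\<And>x. (p has_derivative (\<lambda>v. py x * fst v + pt x * snd v)) (at x)"
  shows "C1_compact (\<lambda>x. p x * \<phi> x) (\<lambda>x. p x * \<phi>y x + py x * \<phi> x) (\<lambda>x. p x * \<phi>t x + pt x * \<phi> x)"
  unfolding C1_compact_def
proof (intro conjI allI)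
  have "{x. p x * \<phi> x \<noteq> 0} \<subseteq> {x. \<phi> x \<noteq> 0}" by auto
  then have "spt (\<lambda>x. p x * \<phi> x) \<subseteq> spt \<phi>" unfolding spt_def by (rule closure_mono)
  moreover have "compact (spt \<phi> \<inter> spt (\<lambda>x. p x * \<phi> x))"
    by (rule compact_Int_closed[OF C1_compactD(4)[OF \<phi>]]) (simp add: spt_def)
  ultimately show "compact (spt (\<lambda>x. p x * \<phi> x))" by (simp add: Int_absorb1)
  fix x
  have "((\<lambda>x. p x * \<phi> x) has_derivative
      (\<lambda>v. p x * (\<phi>y x * fst v + \<phi>t x * snd v) + (py x * fst v + pt x * snd v) * \<phi> x)) (at x)"
    by (rule has_derivative_mult[OF dp C1_compactD(5)[OF \<phi>]])
  then show "((\<lambda>x. p x * \<phi> x) has_derivative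
      (\<lambda>v. (p x * \<phi>y x + py x * \<phi> x) * fst v + (p x * \<phi>t x + pt x * \<phi> x) * snd v)) (at x)"
    by (simp add: algebra_simps)
qed (use C1_compactD(1-3)[OF \<phi>] p in \<open>auto intro!: continuous_intros\<close>)

lemma C1_compact_compose:
  assumes "C1_compact \<phi> \<phi>y \<phi>t"
    and "(a has_real_derivative a') (at s)" "(b has_real_derivative b') (at s)"
  shows "((\<lambda>s. \<phi> (a s, b s)) has_real_derivative \<phi>y (a s, b s) * a' + \<phi>t (a s, b s) * b') (at s)"
proof -
  have "((\<lambda>s. (a s, b s)) has_derivative (\<lambda>h. (a' * h, b' * h))) (at s)"
    using assms(2,3) by (intro has_derivative_Pair) (auto simp: has_field_derivative_def)
  from has_derivative_compose[OF this C1_compactD(5)[OF assms(1)]]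
  show ?thesis unfolding has_field_derivative_def
    by (rule has_derivative_eq_rhs) (auto simp: algebra_simps)
qed

text \<open>The fundamental theorem of calculus on a large interval. The half-line version is what
  the layer-cake argument integrates above a leaf.\<close>

lemma integral_derivative_bounded_support:
  fixes Q q :: "real \<Rightarrow> real"
  assumes "\<And>s. (Q has_real_derivative q s) (at s)" "continuous_on UNIV q"
    and "\<And>s. \<bar>s\<bar> > R \<Longrightarrow> Q s = 0" "\<And>s. \<bar>s\<bar> > R \<Longrightarrow> q s = 0"
  shows "integrable lborel q" "(LINT s|lborel. q s) = 0" "(LINT s|lborel. indicator {p<..} s * q s) = - Q p"
proof -
  \<comment> \<open>Large enough for \<open>Q\<close> to vanish at both ends of the interval from -
    S to S and for \<open>p\<close> to lie inside it.\<close>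
  define S where "S = max \<bar>R\<bar> \<bar>p\<bar> + 1"
  have c: "isCont q s" for s using assms(2) by (simp add: continuous_on_eq_continuous_at)
  have "has_bochner_integral lborel (\<lambda>s. q s * indicator {- S .. S} s) (Q S - Q (- S))"
    by (rule has_bochner_integral_FTC_Icc_real) (use assms c in \<open>auto simp: S_def\<close>)
  moreover have "(\<lambda>s. q s * indicator {- S .. S} s) = q"
  proof
    fix s show "q s * indicator {- S .. S} s = q s"
      using assms(4)[of s] by (cases "\<bar>s\<bar> > R") (auto simp: S_def indicator_def)
  qed
  moreover have "Q S = 0" "Q (- S) = 0" by (auto intro!: assms(3) simp: S_def)
  ultimately show "integrable lborel q" "(LINT s|lborel. q s) = 0"
    by (auto simp: has_bochner_integral_iff)
  have "(LINT s|lborel. q s * indicator {p .. S} s) = Q S - Q p"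
    by (rule integral_FTC_Icc_real) (use assms c in \<open>auto simp: S_def\<close>)
  moreover have "(LINT s|lborel. q s * indicator {p .. S} s) = (LINT s|lborel. indicator {p<..} s * q s)"
  proof (rule integral_cong_AE)
    have [measurable]: "q \<in> borel_measurable borel" by (rule borel_measurable_continuous_onI[OF assms(2)])
    show "(\<lambda>s. q s * indicator {p .. S} s) \<in> borel_measurable lborel" "(\<lambda>s. indicator {p<..} s * q s) \<in> borel_measurable lborel"
      by measurable
    show "AE s in lborel. q s * indicator {p .. S} s = indicator {p<..} s * q s"
      using AE_lborel_singleton[of p]
    proof eventually_elim
      case (elim s)
      then show ?case using assms(4)[of s] by (auto simp: S_def indicator_def)
    qed
  qed
  ultimately show "(LINT s|lborel. indicator {p<..} s * q s) = - Q p"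
    using \<open>Q S = 0\<close> by simp
qed

lemma integral_zero_of_slices:
  fixes q :: "real \<times> real \<Rightarrow> real"
  assumes "integrable lborel q" "\<And>v. (LINT y|lborel. q (y, v)) = 0"
  shows "integral\<^sup>L lborel q = 0"
proof -
  have "(LINT v|lborel. LINT y|lborel. q (y, v)) = integral\<^sup>L lborel (\<lambda>(y, v). q (y, v))"
    using assms(1) lborel_pair.integral_snd[of "\<lambda>y v. q (y, v)"] by (simp add: lborel_prod case_prod_eta)
  then show ?thesis using assms(2) by simp
qed

lemma integrable_continuous_compact_support:
  fixes q :: "'a::euclidean_space \<Rightarrow> real"
  assumes "continuous_on UNIV q" "compact K" "\<And>x. x \<notin> K \<Longrightarrow> q x = 0"
  shows "integrable lborel q"
proof -
  have "integrable lborel (\<lambda>x. indicator K x *\<^sub>R q x)"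
    by (rule borel_integrable_compact[OF assms(2) continuous_on_subset[OF assms(1)]]) simp
  moreover have "(\<lambda>x. indicator K x *\<^sub>R q x) = q"
  proof
    fix x show "indicator K x *\<^sub>R q x = q x" using assms(3)[of x] by (cases "x \<in> K") simp_all
  qed
  ultimately show ?thesis by simp
qed

lemma C1_compact_integral_partial:
  assumes \<phi>: "C1_compact \<phi> \<phi>y \<phi>t"
  shows "integral\<^sup>L lborel \<phi>y = 0" "integral\<^sup>L lborel \<phi>t = 0"
proof -
  note D = C1_compactD[OF \<phi>] and out = C1_compact_outside_spt[OF \<phi>]
  obtain R where R: "R > 0" "\<And>y t. (y, t) \<in> spt \<phi> \<Longrightarrow> \<bar>y\<bar> \<le> R \<and> \<bar>t\<bar> \<le> R"
    using spt_bounded[OF D(4)] by blast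
  have z: "(y, t) \<notin> spt \<phi>" if "R < \<bar>y\<bar> \<or> R < \<bar>t\<bar>" for y t
    using R(2)[of y t] that by linarith
  show "integral\<^sup>L lborel \<phi>y = 0"
  proof (rule integral_zero_of_slices)
    show "integrable lborel \<phi>y"
      by (rule integrable_continuous_compact_support[OF D(2) D(4)]) (rule out)
    fix v
    have "((\<lambda>s. \<phi> (s, v)) has_real_derivative \<phi>y (s, v)) (at s)" for s
      using C1_compact_compose[OF \<phi> DERIV_ident DERIV_const, of v s] by simp
    moreover have "continuous_on UNIV (\<lambda>s. \<phi>y (s, v))"
      by (rule continuous_on_compose2[OF D(2)]) (auto intro!: continuous_intros)
    ultimately show "(LINT y|lborel. \<phi>y (y, v)) = 0"
      by (rule integral_derivative_bounded_support(2)[where R = R]) (simp_all add: out z)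
  qed
  show "integral\<^sup>L lborel \<phi>t = 0"
  proof -
    have "integrable lborel \<phi>t"
      by (rule integrable_continuous_compact_support[OF D(3) D(4)]) (rule out)
    then have "integral\<^sup>L lborel \<phi>t = (LINT y|lborel. LINT t|lborel. \<phi>t (y, t))"
      using lborel_pair.integral_fst[of "\<lambda>y t. \<phi>t (y, t)"] by (simp add: lborel_prod case_prod_eta)
    moreover have "(LINT t|lborel. \<phi>t (y, t)) = 0" for y
    proof (rule integral_derivative_bounded_support(2)[where R = R])
      show "((\<lambda>s. \<phi> (y, s)) has_real_derivative \<phi>t (y, s)) (at s)" for s
        using C1_compact_compose[OF \<phi> DERIV_const DERIV_ident, of y s] by simp
      show "continuous_on UNIV (\<lambda>s. \<phi>t (y, s))"
        by (rule continuous_on_compose2[OF D(3)]) (auto intro!: continuous_intros)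
    qed (simp_all add: out z)
    ultimately show ?thesis by simp
  qed
qed

section \<open>The first and second variation of the area\<close>

lemma integrable_indicator_compact:
  fixes K :: "'a::euclidean_space set"
  assumes "compact K" shows "integrable lborel (indicator K :: 'a \<Rightarrow> real)"
  by (rule integrable_real_indicator) (use assms emeasure_compact_finite[OF assms] in \<open>simp_all add: borel_compact less_top\<close>)

lemma Lp_loc_locally_bounded:
  fixes u :: "real \<times> real \<Rightarrow> real"
  assumes m: "u \<in> borel_measurable borel" and "p \<ge> 0"
    and bd: "\<And>K. compact K \<Longrightarrow> \<exists>M. \<forall>x\<in>K. \<bar>u x\<bar> \<le> M"
  shows "u \<in> Lp_loc p UNIV"
  unfolding Lp_loc_def
proof (intro CollectI allI impI conjI)
  fix K :: "(real \<times> real) set" assume K: "compact K \<and> K \<subseteq> UNIV"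
  then have Km: "K \<in> sets borel" by (simp add: borel_compact)
  have "(\<lambda>x. indicator K x *\<^sub>R u x) \<in> borel_measurable lborel"
    using m Km by simp
  from measurable_completion[OF this] show "set_borel_measurable lebesgue K u"
    by (simp add: set_borel_measurable_def)
  obtain M where M: "\<forall>x\<in>K. \<bar>u x\<bar> \<le> M" using bd K by blast
  have "integrable lborel (\<lambda>x. indicator K x *\<^sub>R (\<bar>u x\<bar> powr p))"
  proof (rule Bochner_Integration.integrable_bound)
    show "integrable lborel (\<lambda>x. M powr p * indicator K x)"
      using K by (simp add: integrable_indicator_compact)
    show "(\<lambda>x. indicator K x *\<^sub>R (\<bar>u x\<bar> powr p)) \<in> borel_measurable lborel"
      using m Km by simp
    have "norm (indicator K x *\<^sub>R (\<bar>u x\<bar> powr p)) \<le> norm (M powr p * indicator K x)" for x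
      using M \<open>p \<ge> 0\<close> by (cases "x \<in> K") (simp_all add: powr_mono2)
    then show "AE x in lborel. norm (indicator K x *\<^sub>R (\<bar>u x\<bar> powr p)) \<le> norm (M powr p * indicator K x)"
      by simp
  qed
  then show "set_integrable lebesgue K (\<lambda>x. \<bar>u x\<bar> powr p)"
    unfolding set_integrable_def using integrable_completion[of "\<lambda>x. indicator K x *\<^sub>R (\<bar>u x\<bar> powr p)" lborel]
    by (simp add: borel_measurable_integrable)
qed

lemma Lp_loc_continuous:
  assumes "continuous_on UNIV u" "p \<ge> 0" shows "u \<in> Lp_loc p UNIV"
proof (rule Lp_loc_locally_bounded[OF borel_measurable_continuous_onI[OF assms(1)] assms(2)])
  fix K :: "(real \<times> real) set" assume "compact K"
  then show "\<exists>M. \<forall>x\<in>K. \<bar>u x\<bar> \<le> M" using continuous_on_compact_bound[OF assms(1)] by blast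
qed

lemma set_integrable_lebesgue_iff_lborel:
  fixes u :: "real \<times> real \<Rightarrow> real"
  assumes "u \<in> borel_measurable borel" "compact K"
  shows "set_integrable lebesgue K u \<longleftrightarrow> set_integrable lborel K u"
proof -
  have [measurable]: "K \<in> sets borel" "u \<in> borel_measurable borel" using assms by (simp_all add: borel_compact)
  show ?thesis unfolding set_integrable_def by (intro integrable_completion) measurable
qed

section \<open>Weak derivatives of C1 functions and of linear perturbations\<close>

lemma test_function_derivative:
  assumes "\<eta> \<in> test_functions UNIV" "v = (1, 0) \<or> v = (0, 1)"
  shows "continuous_on UNIV (\<lambda>x. frechet_derivative \<eta> (at x) v)"
    and "x \<notin> spt \<eta> \<Longrightarrow> frechet_derivative \<eta> (at x) v = 0"
  using C1_compactD(2,3)[OF test_function_C1_compact[OF assms(1)]]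
    C1_compact_outside_spt(2,3)[OF test_function_C1_compact[OF assms(1)], of x] assms(2) by blast+

text \<open>Integration by parts: the partial derivatives of the product of \<phi> with a test
  function have integral zero.\<close>

lemma has_weak_derivative_C1_compact:
  assumes \<phi>: "C1_compact \<phi> \<phi>y \<phi>t"
  shows "has_weak_derivative UNIV (1, 0) \<phi> \<phi>y" "has_weak_derivative UNIV (0, 1) \<phi> \<phi>t"
proof -
  note D = C1_compactD[OF \<phi>]
  have *: "(LINT x|lebesgue. \<phi> x * \<eta>v x) = - (LINT x|lebesgue. \<phi>v x * \<eta> x)"
    if c: "continuous_on UNIV \<eta>" "continuous_on UNIV \<eta>v" "continuous_on UNIV \<phi>v"
      and z: "\<And>x. x \<notin> spt \<phi> \<Longrightarrow> \<phi>v x = 0" and 0: "(LINT x|lborel. \<phi> x * \<eta>v x + \<phi>v x * \<eta> x) = 0" for \<eta> \<eta>v \<phi>v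
  proof -
    have c': "continuous_on UNIV (\<lambda>x. \<phi> x * \<eta>v x)" "continuous_on UNIV (\<lambda>x. \<phi>v x * \<eta> x)"
      using c D(1) by (auto intro!: continuous_on_mult)
    have "integrable lborel (\<lambda>x. \<phi> x * \<eta>v x)" "integrable lborel (\<lambda>x. \<phi>v x * \<eta> x)"
      by (rule integrable_continuous_compact_support[OF c'(1) D(4)] integrable_continuous_compact_support[OF c'(2) D(4)],
          simp add: z outside_spt)+
    then have "(LINT x|lborel. \<phi> x * \<eta>v x) = - (LINT x|lborel. \<phi>v x * \<eta> x)"
      using 0 by simp
    then show ?thesis
      using borel_measurable_continuous_onI[OF c'(1)] borel_measurable_continuous_onI[OF c'(2)]
      by (simp add: integral_completion)
  qed
  have L: "\<phi> \<in> Lp_loc 1 UNIV" "\<phi>y \<in> Lp_loc 1 UNIV" "\<phi>t \<in> Lp_loc 1 UNIV"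
    using D by (simp_all add: Lp_loc_continuous)
  have z: "(LINT x|lborel. \<phi> x * frechet_derivative \<eta> (at x) (1, 0) + \<phi>y x * \<eta> x) = 0"
    "(LINT x|lborel. \<phi> x * frechet_derivative \<eta> (at x) (0, 1) + \<phi>t x * \<eta> x) = 0"
    if "\<eta> \<in> test_functions UNIV" for \<eta>
    by (rule C1_compact_integral_partial[OF C1_compact_times[OF test_function_C1_compact[OF that] D(1) D(2) D(3) D(5)]])+
  have c: "continuous_on UNIV \<eta>" if "\<eta> \<in> test_functions UNIV" for \<eta>
    using that by (simp add: test_functions_def smooth_on_UNIV_continuous)
  show "has_weak_derivative UNIV (1, 0) \<phi> \<phi>y"
    unfolding has_weak_derivative_def set_lebesgue_integral_def
  proof (intro conjI ballI)
    fix \<eta> assume "\<eta> \<in> test_functions UNIV"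
    from *[OF c[OF this] test_function_derivative(1)[OF this] D(2) C1_compact_outside_spt(2)[OF \<phi>] z(1)[OF this]]
    show "(LINT x|lebesgue. indicator UNIV x *\<^sub>R (\<phi> x * frechet_derivative \<eta> (at x) (1, 0))) =
      - (LINT x|lebesgue. indicator UNIV x *\<^sub>R (\<phi>y x * \<eta> x))" by simp
  qed (use L in auto)
  show "has_weak_derivative UNIV (0, 1) \<phi> \<phi>t"
    unfolding has_weak_derivative_def set_lebesgue_integral_def
  proof (intro conjI ballI)
    fix \<eta> assume "\<eta> \<in> test_functions UNIV"
    from *[OF c[OF this] test_function_derivative(1)[OF this] D(3) C1_compact_outside_spt(3)[OF \<phi>] z(2)[OF this]]
    show "(LINT x|lebesgue. indicator UNIV x *\<^sub>R (\<phi> x * frechet_derivative \<eta> (at x) (0, 1))) =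
      - (LINT x|lebesgue. indicator UNIV x *\<^sub>R (\<phi>t x * \<eta> x))" by simp
  qed (use L in auto)
qed

lemma Lp_loc_1_add_scale:
  assumes "u \<in> Lp_loc 1 UNIV" "w \<in> Lp_loc 1 UNIV"
  shows "(\<lambda>x. u x + \<epsilon> * w x) \<in> Lp_loc 1 UNIV"
  using assms by (intro Lp_loc_1I set_integral_add(1) set_integrable_mult_right Lp_loc_1_set_integrable) auto

lemma has_weak_derivative_add_scale:
  assumes u: "has_weak_derivative UNIV v u g" and w: "has_weak_derivative UNIV v w h"
    and v: "v = (1, 0) \<or> v = (0, 1)"
  shows "has_weak_derivative UNIV v (\<lambda>x. u x + \<epsilon> * w x) (\<lambda>x. g x + \<epsilon> * h x)"
  unfolding has_weak_derivative_def
proof (intro conjI ballI)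
  have L: "u \<in> Lp_loc 1 UNIV" "w \<in> Lp_loc 1 UNIV" "g \<in> Lp_loc 1 UNIV" "h \<in> Lp_loc 1 UNIV"
    using u w by (simp_all add: has_weak_derivative_def)
  show "(\<lambda>x. u x + \<epsilon> * w x) \<in> Lp_loc 1 UNIV" "(\<lambda>x. g x + \<epsilon> * h x) \<in> Lp_loc 1 UNIV"
    using L by (simp_all add: Lp_loc_1_add_scale)
  fix \<eta> assume \<eta>: "\<eta> \<in> test_functions UNIV"
  then have K: "compact (spt \<eta>)" and c: "continuous_on UNIV \<eta>"
    by (simp_all add: test_functions_def smooth_on_UNIV_continuous)
  have i: "integrable lebesgue (\<lambda>x. k x * \<eta> x)" "integrable lebesgue (\<lambda>x. k x * frechet_derivative \<eta> (at x) v)"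
    if "k \<in> Lp_loc 1 UNIV" for k
    by (rule integrable_Lp_loc_mult[OF that c K outside_spt[of _ \<eta>]]
        integrable_Lp_loc_mult[OF that test_function_derivative(1)[OF \<eta> v] K test_function_derivative(2)[OF \<eta> v]], assumption)+
  have "(LINT x|lebesgue. u x * frechet_derivative \<eta> (at x) v) = - (LINT x|lebesgue. g x * \<eta> x)"
    "(LINT x|lebesgue. w x * frechet_derivative \<eta> (at x) v) = - (LINT x|lebesgue. h x * \<eta> x)"
    using u w \<eta> by (simp_all add: has_weak_derivative_def set_lebesgue_integral_def)
  then have "(LINT x|lebesgue. u x * frechet_derivative \<eta> (at x) v + \<epsilon> * (w x * frechet_derivative \<eta> (at x) v))
      = - (LINT x|lebesgue. g x * \<eta> x + \<epsilon> * (h x * \<eta> x))"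
    using i L by simp
  then show "(LINT x:UNIV|lebesgue. (u x + \<epsilon> * w x) * frechet_derivative \<eta> (at x) v) =
      - (LINT x:UNIV|lebesgue. (g x + \<epsilon> * h x) * \<eta> x)"
    by (simp add: set_lebesgue_integral_def algebra_simps)
qed

lemma AE_nabla:
  assumes "has_weak_derivative UNIV (1, 0) h hy" "has_weak_derivative UNIV (0, 1) h ht"
  shows "AE x in lebesgue. nabla UNIV f h x = hy x + f x * ht x"
proof -
  have "has_weak_derivative UNIV (1, 0) h (weak_derivative UNIV (1, 0) h)"
    "has_weak_derivative UNIV (0, 1) h (weak_derivative UNIV (0, 1) h)"
    unfolding weak_derivative_def
    using someI[of "has_weak_derivative UNIV (1, 0) h", OF assms(1)]
      someI[of "has_weak_derivative UNIV (0, 1) h", OF assms(2)] by simp_all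
  from has_weak_derivative_unique[OF this(1) assms(1)] has_weak_derivative_unique[OF this(2) assms(2)]
  show ?thesis by eventually_elim (simp add: nabla_def)
qed

section \<open>The area integrand and its first two derivatives\<close>

lemma DERIV_sqrt_one_plus_square:
  "((\<lambda>p. sqrt (1 + p\<^sup>2)) has_real_derivative p / sqrt (1 + p\<^sup>2)) (at p)"
proof -
  have "1 + p\<^sup>2 > 0" by (simp add: add_pos_nonneg)
  then show ?thesis by (auto intro!: derivative_eq_intros simp: field_simps)
qed

text \<open>This second derivative of the area integrand is the weight G of the second
  variation.\<close>

lemma DERIV_div_sqrt_one_plus_square:
  "((\<lambda>p. p / sqrt (1 + p\<^sup>2)) has_real_derivative 1 / sqrt (1 + p\<^sup>2) ^ 3) (at p)"
proof -
  have p: "1 + p\<^sup>2 > 0" by (simp add: add_pos_nonneg)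
  define s where "s = sqrt (1 + p\<^sup>2)"
  have s: "s > 0" "s\<^sup>2 = 1 + p\<^sup>2" using p by (simp_all add: s_def)
  have "((\<lambda>p. p / sqrt (1 + p\<^sup>2)) has_real_derivative (1 * s - p * (p / s)) / (s * s)) (at p)"
    unfolding s_def by (rule DERIV_divide[OF DERIV_ident DERIV_sqrt_one_plus_square]) (use p in auto)
  moreover have "(1 * s - p * (p / s)) / (s * s) = 1 / s ^ 3"
    using s by (simp add: field_simps power2_eq_square power3_eq_cube)
  ultimately show ?thesis by (simp add: s_def)
qed

text \<open>Linear growth of the integrand and boundedness of its first two derivatives supply the
  dominating functions for the area and for its two derivatives in \<epsilon>.\<close>

lemma sqrt_one_plus_square_bounds:
  "sqrt (1 + p\<^sup>2) \<le> 1 + \<bar>p\<bar>" "\<bar>p / sqrt (1 + p\<^sup>2)\<bar> \<le> 1" "\<bar>1 / sqrt (1 + p\<^sup>2) ^ 3\<bar> \<le> (1::real)" "sqrt (1 + p\<^sup>2) \<ge> 1"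
proof -
  have "sqrt (1 + p\<^sup>2) \<le> sqrt ((1 + \<bar>p\<bar>)\<^sup>2)" by (rule real_sqrt_le_mono) (simp add: power2_eq_square algebra_simps)
  then show "sqrt (1 + p\<^sup>2) \<le> 1 + \<bar>p\<bar>" by simp
  have "sqrt (p\<^sup>2) \<le> sqrt (1 + p\<^sup>2)" by (rule real_sqrt_le_mono) simp
  then have "\<bar>p\<bar> \<le> sqrt (1 + p\<^sup>2)" by simp
  moreover show 1: "sqrt (1 + p\<^sup>2) \<ge> 1" by simp
  ultimately show "\<bar>p / sqrt (1 + p\<^sup>2)\<bar> \<le> 1"
    using add_pos_nonneg[of 1 "p\<^sup>2"] by (simp add: abs_divide divide_le_eq)
  have "\<bar>1 / c\<bar> \<le> 1" if "1 \<le> c" for c :: real using that by simp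
  from this[OF one_le_power[OF 1]] show "\<bar>1 / sqrt (1 + p\<^sup>2) ^ 3\<bar> \<le> (1::real)" .
qed

lemma power2_sum_le: "(a + b)\<^sup>2 \<le> 2 * a\<^sup>2 + 2 * (b::real)\<^sup>2"
  using sum_squares_bound[of a b] by (simp add: power2_sum)

text \<open>Here \<open>A\<close> is a continuous version of the intrinsic gradient of
  \<open>f\<close>. Local square integrability of \<open>ft\<close> is what dominates the integrand
  after two differentiations in \<epsilon>, where the square of \<open>B\<close> appears.\<close>

locale intrinsic_graph_variation =
  fixes f fy ft A :: "real \<times> real \<Rightarrow> real"
  assumes wy: "has_weak_derivative UNIV (1, 0) f fy" and wt: "has_weak_derivative UNIV (0, 1) f ft"
    and cont_f: "continuous_on UNIV f" and cont_A: "continuous_on UNIV A"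
    and meas_ft[measurable]: "ft \<in> borel_measurable borel"
    and ft_sq: "\<And>K. compact K \<Longrightarrow> set_integrable lborel K (\<lambda>x. (ft x)\<^sup>2)"
    and AE_A: "AE x in lebesgue. fy x + f x * ft x = A x"
begin

lemma f_C1W: "f \<in> W1p_loc 1 UNIV" "f \<in> C1W UNIV"
proof -
  have "fy \<in> Lp_loc 1 UNIV" "ft \<in> Lp_loc 1 UNIV" "f \<in> Lp_loc 1 UNIV"
    using wy wt by (simp_all add: has_weak_derivative_def)
  then show *: "f \<in> W1p_loc 1 UNIV"
    unfolding W1p_loc_def using wy wt by blast
  have "AE x in lebesgue. nabla UNIV f f x = A x"
    using AE_nabla[OF wy wt, of f] AE_A by eventually_elim simp
  then show "f \<in> C1W UNIV"
    unfolding C1W_def using * cont_f cont_A by auto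
qed

context
  fixes \<phi> \<phi>y \<phi>t :: "real \<times> real \<Rightarrow> real"
  assumes \<phi>: "C1_compact \<phi> \<phi>y \<phi>t"
begin

text \<open>The linearization at \<open>f\<close>, in direction \<phi>, of the nonlinear map sending
  a function to its own intrinsic gradient; the last summand comes from varying the coefficient of
  the \<open>t\<close>-derivative.\<close>

definition B :: "real \<times> real \<Rightarrow> real" where "B x = \<phi>y x + f x * \<phi>t x + ft x * \<phi> x"

text \<open>The intrinsic gradient of f + \<epsilon> \<phi>. It is an exact quadratic polynomial in
  \<epsilon>, because the operator is linear in its coefficient and in its argument.\<close>

definition P :: "real \<Rightarrow> real \<times> real \<Rightarrow> real" where "P \<epsilon> x = A x + \<epsilon> * B x + \<epsilon>\<^sup>2 * (\<phi> x * \<phi>t x)"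

lemma meas[measurable]:
  "f \<in> borel_measurable borel" "A \<in> borel_measurable borel" "\<phi> \<in> borel_measurable borel"
  "\<phi>y \<in> borel_measurable borel" "\<phi>t \<in> borel_measurable borel" "spt \<phi> \<in> sets borel"
  using cont_f cont_A C1_compactD[OF \<phi>] by (simp_all add: borel_measurable_continuous_onI borel_compact)

lemma meas_B[measurable]: "B \<in> borel_measurable borel"
  unfolding B_def[abs_def] by measurable

lemma meas_P[measurable]: "P \<epsilon> \<in> borel_measurable borel"
  unfolding P_def[abs_def] by measurable

lemma outside: "x \<notin> spt \<phi> \<Longrightarrow> \<phi> x = 0" "x \<notin> spt \<phi> \<Longrightarrow> \<phi>y x = 0" "x \<notin> spt \<phi> \<Longrightarrow> \<phi>t x = 0"
   "x \<notin> spt \<phi> \<Longrightarrow> B x = 0"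
  using C1_compact_outside_spt[OF \<phi>] by (simp_all add: B_def)

lemma AE_nabla_P:
  "AE x in lebesgue. nabla UNIV (\<lambda>x. f x + \<epsilon> * \<phi> x) (\<lambda>x. f x + \<epsilon> * \<phi> x) x = P \<epsilon> x"
proof -
  have "has_weak_derivative UNIV (1, 0) (\<lambda>x. f x + \<epsilon> * \<phi> x) (\<lambda>x. fy x + \<epsilon> * \<phi>y x)"
    "has_weak_derivative UNIV (0, 1) (\<lambda>x. f x + \<epsilon> * \<phi> x) (\<lambda>x. ft x + \<epsilon> * \<phi>t x)"
    using wy wt has_weak_derivative_C1_compact[OF \<phi>] by (simp_all add: has_weak_derivative_add_scale)
  from AE_nabla[OF this, of "\<lambda>x. f x + \<epsilon> * \<phi> x"] AE_A
  show ?thesis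
    by eventually_elim (simp add: P_def B_def algebra_simps power2_eq_square)
qed

lemma integrable_D: "integrable lborel (\<lambda>x. \<phi> x * \<phi>t x)"
  using C1_compactD[OF \<phi>]
  by (intro integrable_continuous_compact_support[where K = "spt \<phi>"]) (auto intro!: continuous_on_mult outside)

lemma integrable_B: "integrable lborel (\<lambda>x. (B x)\<^sup>2)" "integrable lborel B"
proof -
  note D = C1_compactD[OF \<phi>]
  have 1: "integrable lborel (\<lambda>x. indicator (spt \<phi>) x :: real)"
    using D(4) by (rule integrable_indicator_compact)
  obtain M where M: "M \<ge> 0" "\<forall>x\<in>spt \<phi>. \<bar>\<phi> x\<bar> \<le> M" by (rule continuous_on_compact_bound[OF D(1) D(4)])
  have c: "continuous_on UNIV (\<lambda>x. \<phi>y x + f x * \<phi>t x)"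
    using D cont_f by (auto intro!: continuous_intros)
  obtain N where N: "N \<ge> 0" "\<forall>x\<in>spt \<phi>. \<bar>\<phi>y x + f x * \<phi>t x\<bar> \<le> N" by (rule continuous_on_compact_bound[OF c D(4)])
  show sq: "integrable lborel (\<lambda>x. (B x)\<^sup>2)"
  proof (rule Bochner_Integration.integrable_bound)
    show "integrable lborel (\<lambda>x. 2 * N\<^sup>2 * indicator (spt \<phi>) x + 2 * M\<^sup>2 * (indicator (spt \<phi>) x *\<^sub>R (ft x)\<^sup>2))"
      using 1 ft_sq[OF D(4)] by (simp add: set_integrable_def)
    have "(B x)\<^sup>2 \<le> 2 * N\<^sup>2 + 2 * M\<^sup>2 * (ft x)\<^sup>2" if x: "x \<in> spt \<phi>" for x
    proof -
      have "(B x)\<^sup>2 \<le> 2 * (\<phi>y x + f x * \<phi>t x)\<^sup>2 + 2 * (ft x * \<phi> x)\<^sup>2"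
        unfolding B_def by (rule power2_sum_le)
      also have "\<dots> \<le> 2 * N\<^sup>2 + 2 * M\<^sup>2 * (ft x)\<^sup>2"
      proof -
        have "(\<phi>y x + f x * \<phi>t x)\<^sup>2 \<le> N\<^sup>2" using N x by (simp add: abs_le_square_iff[symmetric])
        moreover have "(\<phi> x)\<^sup>2 \<le> M\<^sup>2" using M x by (simp add: abs_le_square_iff[symmetric])
        then have 2: "(ft x * \<phi> x)\<^sup>2 \<le> (ft x)\<^sup>2 * M\<^sup>2" by (simp add: power_mult_distrib mult_left_mono)
        ultimately show ?thesis using 2 by (simp add: mult.assoc mult.commute[of "M\<^sup>2"])
      qed
      finally show ?thesis .
    qed
    then have "norm ((B x)\<^sup>2) \<le> norm (2 * N\<^sup>2 * indicator (spt \<phi>) x + 2 * M\<^sup>2 * (indicator (spt \<phi>) x *\<^sub>R (ft x)\<^sup>2))" for x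
      by (cases "x \<in> spt \<phi>") (simp_all add: outside)
    then show "AE x in lborel. norm ((B x)\<^sup>2) \<le> norm (2 * N\<^sup>2 * indicator (spt \<phi>) x + 2 * M\<^sup>2 * (indicator (spt \<phi>) x *\<^sub>R (ft x)\<^sup>2))"
      by (rule AE_I2)
  qed measurable
  show "integrable lborel B"
  proof (rule Bochner_Integration.integrable_bound)
    show "integrable lborel (\<lambda>x. indicator (spt \<phi>) x + (B x)\<^sup>2)" using 1 sq by simp
    have "\<bar>b\<bar> \<le> 1 + b\<^sup>2" for b :: real
      using sum_squares_bound[of 1 "\<bar>b\<bar>"] by simp
    then have "norm (B x) \<le> norm (indicator (spt \<phi>) x + (B x)\<^sup>2)" for x
      by (cases "x \<in> spt \<phi>") (simp_all add: outside)
    then show "AE x in lborel. norm (B x) \<le> norm (indicator (spt \<phi>) x + (B x)\<^sup>2)" by (rule AE_I2)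
  qed measurable
qed

lemma integrable_area: "integrable lborel (\<lambda>x. indicator (spt \<phi>) x * sqrt (1 + (P \<epsilon> x)\<^sup>2))"
proof -
  note D = C1_compactD[OF \<phi>]
  have 1: "integrable lborel (\<lambda>x. indicator (spt \<phi>) x :: real)"
    using D(4) by (rule integrable_indicator_compact)
  obtain M where M: "M \<ge> 0" "\<forall>x\<in>spt \<phi>. \<bar>A x\<bar> \<le> M" by (rule continuous_on_compact_bound[OF cont_A D(4)])
  show ?thesis
  proof (rule Bochner_Integration.integrable_bound)
  show "integrable lborel (\<lambda>x. (1 + M) * indicator (spt \<phi>) x + \<bar>\<epsilon>\<bar> * \<bar>B x\<bar> + \<epsilon>\<^sup>2 * \<bar>\<phi> x * \<phi>t x\<bar>)"
    using 1 integrable_B integrable_D by (intro Bochner_Integration.integrable_add integrable_mult_right integrable_abs) auto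
  have "norm (indicator (spt \<phi>) x * sqrt (1 + (P \<epsilon> x)\<^sup>2)) \<le> norm ((1 + M) * indicator (spt \<phi>) x + \<bar>\<epsilon>\<bar> * \<bar>B x\<bar> + \<epsilon>\<^sup>2 * \<bar>\<phi> x * \<phi>t x\<bar>)" for x
  proof (cases "x \<in> spt \<phi>")
    case True
    have "sqrt (1 + (P \<epsilon> x)\<^sup>2) \<le> 1 + \<bar>P \<epsilon> x\<bar>" by (rule sqrt_one_plus_square_bounds)
    also have "\<bar>P \<epsilon> x\<bar> \<le> \<bar>A x\<bar> + \<bar>\<epsilon> * B x\<bar> + \<bar>\<epsilon>\<^sup>2 * (\<phi> x * \<phi>t x)\<bar>" unfolding P_def by linarith
    also have "\<bar>A x\<bar> \<le> M" using M True by blast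
    finally show ?thesis using True M(1) by (simp add: abs_mult add_nonneg_nonneg)
  qed simp
  then show "AE x in lborel. norm (indicator (spt \<phi>) x * sqrt (1 + (P \<epsilon> x)\<^sup>2)) \<le> norm ((1 + M) * indicator (spt \<phi>) x + \<bar>\<epsilon>\<bar> * \<bar>B x\<bar> + \<epsilon>\<^sup>2 * \<bar>\<phi> x * \<phi>t x\<bar>)"
    by (rule AE_I2)
  qed measurable
qed

lemma area_along_eq:
  "area_along UNIV f \<phi> \<epsilon> = ennreal (LINT x|lborel. indicator (spt \<phi>) x * sqrt (1 + (P \<epsilon> x)\<^sup>2))"
proof -
  have "area_along UNIV f \<phi> \<epsilon> = (\<integral>\<^sup>+x. ennreal (indicator (spt \<phi>) x * sqrt (1 + (P \<epsilon> x)\<^sup>2)) \<partial>lebesgue)"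
    unfolding area_along_def area_def
  proof (rule nn_integral_cong_AE)
    show "AE x in lebesgue. ennreal (sqrt (1 + (nabla UNIV (\<lambda>x. f x + \<epsilon> * \<phi> x) (\<lambda>x. f x + \<epsilon> * \<phi> x) x)\<^sup>2)) * indicator (spt \<phi>) x =
        ennreal (indicator (spt \<phi>) x * sqrt (1 + (P \<epsilon> x)\<^sup>2))"
      using AE_nabla_P[of \<epsilon>] by eventually_elim (simp add: indicator_def)
  qed
  also have "\<dots> = ennreal (LINT x|lborel. indicator (spt \<phi>) x * sqrt (1 + (P \<epsilon> x)\<^sup>2))"
    unfolding nn_integral_completion by (rule nn_integral_eq_integral[OF integrable_area]) simp
  finally show ?thesis .
qed

text \<open>The formula is established on a whole neighbourhood of 0, since the second variation
  differentiates it once more.\<close>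

lemma area_along_derivative:
  assumes "\<bar>\<epsilon>\<bar> < 1"
  shows "((\<lambda>\<epsilon>. enn2real (area_along UNIV f \<phi> \<epsilon>)) has_real_derivative
     (LINT x|lborel. P \<epsilon> x / sqrt (1 + (P \<epsilon> x)\<^sup>2) * (B x + 2 * \<epsilon> * (\<phi> x * \<phi>t x)))) (at \<epsilon>)"
    and "integrable lborel (\<lambda>x. P \<epsilon> x / sqrt (1 + (P \<epsilon> x)\<^sup>2) * (B x + 2 * \<epsilon> * (\<phi> x * \<phi>t x)))"
proof -
  define D where "D x = \<phi> x * \<phi>t x" for x
  have Dm[measurable]: "D \<in> borel_measurable borel" unfolding D_def[abs_def] by measurable
  have Do: "D x = 0" if "x \<notin> spt \<phi>" for x using that by (simp add: D_def outside)
  define h where "h e x = indicator (spt \<phi>) x * sqrt (1 + (P e x)\<^sup>2)" for e x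
  define h' where "h' e x = P e x / sqrt (1 + (P e x)\<^sup>2) * (B x + 2 * e * D x)" for e x
  \<comment> \<open>Parameters within distance 1 of \<epsilon> satisfy \<bar>e\<bar> < 2, so 2
    \<bar>e\<bar> is at most 4.\<close>
  define w where "w x = \<bar>B x\<bar> + 4 * \<bar>D x\<bar>" for x
  have w: "integrable lborel w" unfolding w_def D_def
    using integrable_B(2) integrable_D by (intro Bochner_Integration.integrable_add integrable_mult_right integrable_abs) auto
  have bound: "\<bar>h' e x\<bar> \<le> w x" if "\<bar>e\<bar> < 2" for e x
  proof -
    have "\<bar>h' e x\<bar> \<le> 1 * \<bar>B x + 2 * e * D x\<bar>"
      unfolding h'_def abs_mult[of "P e x / sqrt (1 + (P e x)\<^sup>2)"] by (intro mult_right_mono sqrt_one_plus_square_bounds) simp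
    also have "\<dots> \<le> \<bar>B x\<bar> + 2 * \<bar>e\<bar> * \<bar>D x\<bar>" using abs_triangle_ineq[of "B x" "2 * e * D x"] by (simp add: abs_mult)
    also have "2 * \<bar>e\<bar> * \<bar>D x\<bar> \<le> 4 * \<bar>D x\<bar>" using that by (intro mult_right_mono) auto
    finally show ?thesis by (simp add: w_def)
  qed
  have dP: "((\<lambda>e. P e x) has_real_derivative B x + 2 * e * D x) (at e)" for e x
    unfolding P_def D_def by (auto intro!: derivative_eq_intros simp: power2_eq_square)
  have der: "((\<lambda>e. h e x) has_real_derivative h' e x) (at e)" for e x
  proof (cases "x \<in> spt \<phi>")
    case True
    then show ?thesis
      using DERIV_chain2[OF DERIV_sqrt_one_plus_square dP[where e = e and x = x]] by (simp add: h_def h'_def)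
  qed (simp add: h_def h'_def outside Do)
  have e: "\<bar>e\<bar> < 2" if "\<bar>e - \<epsilon>\<bar> < 1" for e using that assms by linarith
  have "((\<lambda>e. LINT x|lborel. h e x) has_real_derivative (LINT x|lborel. h' \<epsilon> x)) (at \<epsilon>)"
    by (rule has_real_derivative_integral(2)[where r = 1 and w = w])
       (use bound e w der integrable_area in \<open>auto simp: h_def[abs_def]\<close>)
  moreover have "enn2real (area_along UNIV f \<phi> e) = (LINT x|lborel. h e x)" for e
    unfolding area_along_eq h_def by (rule enn2real_ennreal) (auto intro!: integral_nonneg_AE)
  ultimately show "((\<lambda>\<epsilon>. enn2real (area_along UNIV f \<phi> \<epsilon>)) has_real_derivative
     (LINT x|lborel. P \<epsilon> x / sqrt (1 + (P \<epsilon> x)\<^sup>2) * (B x + 2 * \<epsilon> * (\<phi> x * \<phi>t x)))) (at \<epsilon>)"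
    by (simp add: h'_def D_def)
  have "integrable lborel (h' \<epsilon>)"
  proof (rule Bochner_Integration.integrable_bound[OF w])
    show "h' \<epsilon> \<in> borel_measurable lborel" unfolding h'_def[abs_def] by measurable
    show "AE x in lborel. norm (h' \<epsilon> x) \<le> norm (w x)"
    proof (rule AE_I2)
      fix x show "norm (h' \<epsilon> x) \<le> norm (w x)" using bound[of \<epsilon> x] assms by simp
    qed
  qed
  then show "integrable lborel (\<lambda>x. P \<epsilon> x / sqrt (1 + (P \<epsilon> x)\<^sup>2) * (B x + 2 * \<epsilon> * (\<phi> x * \<phi>t x)))"
    by (simp add: h'_def[abs_def] D_def)
qed

lemma has_first_variation_eq:
  "has_first_variation UNIV f \<phi> (LINT x|lborel. A x / sqrt (1 + (A x)\<^sup>2) * B x)"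
  unfolding has_first_variation_def
  using area_along_derivative(1)[of 0] by (auto simp: area_along_eq P_def)

text \<open>One more differentiation by the product rule: the outer derivative gives the weight
  times the squared linearization, and the quadratic term of \<open>P\<close> contributes 2 \<phi>
  \<phi>_t.\<close>

lemma has_second_variation_eq:
  "has_second_variation UNIV f \<phi>
     (LINT x|lborel. 1 / sqrt (1 + (A x)\<^sup>2) ^ 3 * (B x)\<^sup>2 + A x / sqrt (1 + (A x)\<^sup>2) * (2 * (\<phi> x * \<phi>t x)))"
  unfolding has_second_variation_def
proof (intro conjI exI)
  show "\<forall>\<^sub>F \<epsilon> in nhds 0. area_along UNIV f \<phi> \<epsilon> < \<infinity>" by (simp add: area_along_eq)
  define D where "D x = \<phi> x * \<phi>t x" for x
  define h where "h e x = P e x / sqrt (1 + (P e x)\<^sup>2) * (B x + 2 * e * D x)" for e x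
  define h' where "h' e x = 1 / sqrt (1 + (P e x)\<^sup>2) ^ 3 * (B x + 2 * e * D x)\<^sup>2
    + P e x / sqrt (1 + (P e x)\<^sup>2) * (2 * D x)" for e x
  show "\<forall>\<^sub>F \<epsilon> in nhds 0. ((\<lambda>\<epsilon>. enn2real (area_along UNIV f \<phi> \<epsilon>)) has_real_derivative (LINT x|lborel. h \<epsilon> x)) (at \<epsilon>)"
  proof -
    have "((\<lambda>\<epsilon>. enn2real (area_along UNIV f \<phi> \<epsilon>)) has_real_derivative (LINT x|lborel. h \<epsilon> x)) (at \<epsilon>)" if "\<bar>\<epsilon>\<bar> < 1" for \<epsilon>
      unfolding h_def D_def by (rule area_along_derivative(1)[OF that])
    then show ?thesis
      unfolding eventually_nhds_metric by (intro exI[of _ 1]) (simp add: dist_real_def)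
  qed
  have c: "continuous_on UNIV D" unfolding D_def using C1_compactD[OF \<phi>] by (intro continuous_on_mult)
  obtain N where N: "N \<ge> 0" "\<forall>x\<in>spt \<phi>. \<bar>D x\<bar> \<le> N" by (rule continuous_on_compact_bound[OF c C1_compactD(4)[OF \<phi>]])
  \<comment> \<open>Boundedness of \<open>D\<close> reduces the integrability of its square to that
    of \<open>D\<close>.\<close>
  have DN: "(D x)\<^sup>2 \<le> N * \<bar>D x\<bar>" for x
  proof (cases "x \<in> spt \<phi>")
    case True
    then have "\<bar>D x\<bar> * \<bar>D x\<bar> \<le> N * \<bar>D x\<bar>" using N by (intro mult_right_mono) auto
    then show ?thesis by (simp add: power2_eq_square)
  qed (simp add: D_def outside)
  define w where "w x = 2 * (B x)\<^sup>2 + 8 * (N * \<bar>D x\<bar>) + 2 * \<bar>D x\<bar>" for x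
  have w: "integrable lborel w" unfolding w_def D_def
    using integrable_B(1) integrable_D by (intro Bochner_Integration.integrable_add integrable_mult_right integrable_abs) auto
  have bound: "\<bar>h' e x\<bar> \<le> w x" if "\<bar>e\<bar> < 1" for e x
  proof -
    have "\<bar>h' e x\<bar> \<le> \<bar>1 / sqrt (1 + (P e x)\<^sup>2) ^ 3 * (B x + 2 * e * D x)\<^sup>2\<bar> + \<bar>P e x / sqrt (1 + (P e x)\<^sup>2) * (2 * D x)\<bar>"
      unfolding h'_def by (rule abs_triangle_ineq)
    also have "\<dots> \<le> 1 * \<bar>(B x + 2 * e * D x)\<^sup>2\<bar> + 1 * \<bar>2 * D x\<bar>"
      unfolding abs_mult[of "1 / sqrt (1 + (P e x)\<^sup>2) ^ 3"] abs_mult[of "P e x / sqrt (1 + (P e x)\<^sup>2)"]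
      by (intro add_mono mult_right_mono sqrt_one_plus_square_bounds) simp_all
    also have "\<dots> = (B x + 2 * e * D x)\<^sup>2 + 2 * \<bar>D x\<bar>" by (simp add: abs_mult)
    also have "(B x + 2 * e * D x)\<^sup>2 \<le> 2 * (B x)\<^sup>2 + 2 * (2 * e * D x)\<^sup>2"
      by (rule power2_sum_le)
    also have "(2 * e * D x)\<^sup>2 \<le> 4 * (D x)\<^sup>2"
      using that mult_right_mono[of "e\<^sup>2" 1 "(D x)\<^sup>2"] by (simp add: power_mult_distrib abs_square_le_1)
    also have "(D x)\<^sup>2 \<le> N * \<bar>D x\<bar>" by (rule DN)
    finally show ?thesis by (simp add: w_def)
  qed
  have dP: "((\<lambda>e. P e x) has_real_derivative B x + 2 * e * D x) (at e)" for e x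
    unfolding P_def D_def by (auto intro!: derivative_eq_intros simp: power2_eq_square)
  have der: "((\<lambda>e. h e x) has_real_derivative h' e x) (at e)" for e x
    unfolding h_def h'_def
    by (rule DERIV_cong[OF DERIV_mult[OF DERIV_chain2[OF DERIV_div_sqrt_one_plus_square dP]]])
       (auto intro!: derivative_eq_intros simp: power2_eq_square)
  have "((\<lambda>e. LINT x|lborel. h e x) has_real_derivative (LINT x|lborel. h' 0 x)) (at 0)"
    by (rule has_real_derivative_integral(2)[where r = 1 and w = w])
       (use bound w der area_along_derivative(2) in \<open>auto simp: h_def[abs_def] D_def\<close>)
  then show "((\<lambda>e. LINT x|lborel. h e x) has_real_derivative
     (LINT x|lborel. 1 / sqrt (1 + (A x)\<^sup>2) ^ 3 * (B x)\<^sup>2 + A x / sqrt (1 + (A x)\<^sup>2) * (2 * (\<phi> x * \<phi>t x)))) (at 0)"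
    by (simp add: h'_def D_def P_def)
qed

end

end

section \<open>The Cantor function\<close>

definition clamp01 :: "real \<Rightarrow> real" where "clamp01 x = max 0 (min 1 x)"

text \<open>The usual distinction of three thirds is hidden in the clamping: on the left third the
  second summand is 0, on the right third the first is 1, and on the middle third both hold, giving
  1/2.\<close>

fun cantor_approx :: "nat \<Rightarrow> real \<Rightarrow> real" where
  "cantor_approx 0 x = clamp01 x"
| "cantor_approx (Suc n) x = (cantor_approx n (3 * x) + cantor_approx n (3 * x - 2)) / 2"

lemma cantor_approx_le_0: "x \<le> 0 \<Longrightarrow> cantor_approx n x = 0"
  by (induction n arbitrary: x) (auto simp: clamp01_def)

lemma cantor_approx_ge_1: "x \<ge> 1 \<Longrightarrow> cantor_approx n x = 1"
  by (induction n arbitrary: x) (auto simp: clamp01_def)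

lemma mono_cantor_approx: "x \<le> y \<Longrightarrow> cantor_approx n x \<le> cantor_approx n y"
proof (induction n arbitrary: x y)
  case (Suc n)
  from Suc.IH[of "3 * x" "3 * y"] Suc.IH[of "3 * x - 2" "3 * y - 2"] Suc.prems show ?case by simp
qed (auto simp: clamp01_def)

lemma continuous_cantor_approx: "continuous_on UNIV (cantor_approx n)"
proof (induction n)
  case 0
  show ?case by (simp add: clamp01_def[abs_def] continuous_intros cong: continuous_on_cong)
next
  case (Suc n)
  have "continuous_on UNIV (\<lambda>x. cantor_approx n (3 * x))" "continuous_on UNIV (\<lambda>x. cantor_approx n (3 * x - 2))"
    by (rule continuous_on_compose2[OF Suc]; auto intro!: continuous_intros)+
  then show ?case by (simp add: continuous_intros cong: continuous_on_cong)
qed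

lemma cantor_approx_bounds: "0 \<le> cantor_approx n x" "cantor_approx n x \<le> 1"
  using mono_cantor_approx[of "min x 0" x n] mono_cantor_approx[of x "max x 1" n]
    cantor_approx_le_0[of "min x 0" n] cantor_approx_ge_1[of "max x 1" n] by auto

text \<open>One of the two summands is always constant, so each step halves the distance.\<close>

lemma cantor_approx_step: "\<bar>cantor_approx (Suc n) x - cantor_approx n x\<bar> \<le> (1 / 2) ^ n"
proof (induction n arbitrary: x)
  case 0
  show ?case using cantor_approx_bounds[of "Suc 0" x] cantor_approx_bounds[of 0 x] by (simp only: power_0)
next
  case (Suc n)
  have half: "\<bar>(a + k) / 2 - (b + k) / 2\<bar> \<le> (1 / 2) ^ Suc n" if "\<bar>a - b\<bar> \<le> (1 / 2) ^ n" for a b k :: real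
    using that by (simp add: diff_divide_distrib[symmetric])
  consider "x \<le> 2/3" | "x \<ge> 1/3" by linarith
  then show ?case
  proof cases
    case 1
    then have "cantor_approx k (3 * x - 2) = 0" for k by (intro cantor_approx_le_0) simp
    then have "cantor_approx (Suc k) x = (cantor_approx k (3 * x) + 0) / 2" for k by simp
    then show ?thesis using half[OF Suc.IH[of "3 * x"]] by presburger
  next
    case 2
    then have "cantor_approx k (3 * x) = 1" for k by (intro cantor_approx_ge_1) simp
    then have "cantor_approx (Suc k) x = (cantor_approx k (3 * x - 2) + 1) / 2" for k by simp
    then show ?thesis using half[OF Suc.IH[of "3 * x - 2"]] by presburger
  qed
qed

definition cantor_function :: "real \<Rightarrow> real" where
  "cantor_function x = lim (\<lambda>n. cantor_approx n x)"

text \<open>The approximations are partial sums of a telescoping series dominated by a geometric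
  one. Uniformity is what passes continuity on to the limit.\<close>

lemma uniform_limit_cantor: "uniform_limit UNIV cantor_approx cantor_function sequentially"
proof -
  have sumb: "summable (\<lambda>n. (1 / 2 :: real) ^ n)" by (rule summable_geometric) simp
  have "uniformly_convergent_on UNIV (\<lambda>n x. \<Sum>k<n. cantor_approx (Suc k) x - cantor_approx k x)"
    using cantor_approx_step by (intro Weierstrass_m_test'[OF _ sumb]) simp
  then obtain l where l: "uniform_limit UNIV (\<lambda>n x. \<Sum>k<n. cantor_approx (Suc k) x - cantor_approx k x) l sequentially"
    by (auto simp: uniformly_convergent_on_def)
  have tel: "(\<Sum>k<n. cantor_approx (Suc k) x - cantor_approx k x) = cantor_approx n x - cantor_approx 0 x" for n x
    by (rule sum_lessThan_telescope)
  have "uniform_limit UNIV (\<lambda>n x. (\<Sum>k<n. cantor_approx (Suc k) x - cantor_approx k x) + cantor_approx 0 x) (\<lambda>x. l x + cantor_approx 0 x) sequentially"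
    by (intro uniform_limit_intros l)
  then have u: "uniform_limit UNIV cantor_approx (\<lambda>x. l x + cantor_approx 0 x) sequentially"
    unfolding tel by simp
  have "cantor_function x = l x + cantor_approx 0 x" for x
    unfolding cantor_function_def by (rule limI) (rule tendsto_uniform_limitI[OF u UNIV_I])
  then show ?thesis using u by (simp add: cantor_function_def[abs_def] fun_eq_iff[symmetric] cong: uniform_limit_cong')
qed

lemma cantor_function_tendsto: "(\<lambda>n. cantor_approx n x) \<longlonglongrightarrow> cantor_function x"
  by (rule tendsto_uniform_limitI[OF uniform_limit_cantor UNIV_I])

lemma cantor_function_eq:
  "cantor_function x = (cantor_function (3 * x) + cantor_function (3 * x - 2)) / 2"
proof (rule LIMSEQ_unique)
  show "(\<lambda>n. cantor_approx (Suc n) x) \<longlonglongrightarrow> cantor_function x"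
    by (rule LIMSEQ_Suc[OF cantor_function_tendsto])
  show "(\<lambda>n. cantor_approx (Suc n) x) \<longlonglongrightarrow> (cantor_function (3 * x) + cantor_function (3 * x - 2)) / 2"
    by (simp del: One_nat_def) (intro tendsto_intros cantor_function_tendsto, simp)
qed

lemma cantor_function_le_0: "x \<le> 0 \<Longrightarrow> cantor_function x = 0"
  using cantor_function_tendsto[of x] by (simp add: cantor_approx_le_0 LIMSEQ_const_iff)

lemma cantor_function_ge_1: "x \<ge> 1 \<Longrightarrow> cantor_function x = 1"
  using cantor_function_tendsto[of x] by (simp add: cantor_approx_ge_1 LIMSEQ_const_iff)

lemma continuous_cantor_function: "continuous_on UNIV cantor_function"
  by (rule uniform_limit_theorem[OF _ uniform_limit_cantor]) (auto simp: continuous_cantor_approx)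

lemma mono_cantor_function: "mono cantor_function"
  by (intro monoI LIMSEQ_le[OF cantor_function_tendsto cantor_function_tendsto]) (auto intro: mono_cantor_approx)

section \<open>The Cantor set is null, and the Cantor function is locally constant off it\<close>

lemma compact_cantor_level: "compact (cantor_level n)"
  by (induction n) (auto intro!: compact_Un compact_continuous_image continuous_intros)

lemma closed_cantor_set: "closed cantor_set"
  unfolding cantor_set_def using compact_cantor_level by (intro closed_INT) (auto intro: compact_imp_closed)

text \<open>Each level is the union of two affine copies of the previous one, scaled by 1/3, so
  subadditivity gives a factor 2/3 per level.\<close>

lemma emeasure_cantor_level: "emeasure lborel (cantor_level n) \<le> ennreal ((2 / 3) ^ n)"
proof (induction n)
  case (Suc n)
  have m: "cantor_level k \<in> sets borel" for k using compact_cantor_level[of k] by (simp add: borel_compact)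
  have img: "(\<lambda>x. x / 3 + a) ` S = (\<lambda>x. 3 * x - 3 * a) -` S" for a :: real and S
  proof safe
    fix x assume "3 * x - 3 * a \<in> S"
    then show "x \<in> (\<lambda>x. x / 3 + a) ` S" by (intro image_eqI[of _ _ "3 * x - 3 * a"]) (simp_all add: field_simps)
  qed simp
  have sc: "emeasure lborel ((\<lambda>x. x / 3 + a) ` cantor_level n) \<le> ennreal ((2 / 3) ^ n / 3)" for a :: real
  proof -
    have "emeasure lborel ((\<lambda>x. x / 3 + a) ` cantor_level n) = emeasure lebesgue ((\<lambda>x. x / 3 + a) ` cantor_level n)"
    proof -
      have "(\<lambda>x. x / 3 + a) ` cantor_level n \<in> sets borel"
        by (intro borel_compact compact_continuous_image compact_cantor_level continuous_intros) auto
      then show ?thesis by simp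
    qed
    also have "(\<lambda>x. x / 3 + a) ` cantor_level n = (\<lambda>x. (1 / 3) *\<^sub>R x + a) ` cantor_level n" by simp
    also have "emeasure lebesgue \<dots> = ennreal (1 / 3) * emeasure lebesgue (cantor_level n)"
      using emeasure_lebesgue_affine[of "1 / 3" a "cantor_level n"] by simp
    also have "emeasure lebesgue (cantor_level n) = emeasure lborel (cantor_level n)" using m[of n] by simp
    also have "ennreal (1 / 3) * \<dots> \<le> ennreal (1 / 3) * ennreal ((2 / 3) ^ n)" by (rule mult_left_mono[OF Suc]) simp
    finally show ?thesis by (simp add: ennreal_mult'[symmetric])
  qed
  have "emeasure lborel (cantor_level (Suc n)) \<le> emeasure lborel ((\<lambda>x. x / 3) ` cantor_level n) + emeasure lborel ((\<lambda>x. (x + 2) / 3) ` cantor_level n)"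
    unfolding cantor_level.simps
    by (intro emeasure_subadditive)
       (auto intro!: borel_compact compact_continuous_image compact_cantor_level continuous_intros)
  also have "\<dots> \<le> ennreal ((2 / 3) ^ n / 3) + ennreal ((2 / 3) ^ n / 3)"
    using sc[of 0] sc[of "2 / 3"] by (intro add_mono) (simp_all add: add_divide_distrib)
  also have "\<dots> = ennreal ((2 / 3) ^ Suc n)" by (simp add: ennreal_plus[symmetric] del: ennreal_plus)
  finally show ?case .
qed simp

lemma null_sets_cantor_set: "cantor_set \<in> null_sets lborel"
proof (rule null_setsI)
  show "cantor_set \<in> sets lborel" using closed_cantor_set by simp
  have "emeasure lborel cantor_set \<le> ennreal ((2 / 3) ^ n)" for n
  proof -
    have "emeasure lborel cantor_set \<le> emeasure lborel (cantor_level n)"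
      using compact_cantor_level[of n] by (intro emeasure_mono) (auto simp: cantor_set_def borel_compact)
    then show ?thesis using emeasure_cantor_level[of n] by (rule order_trans)
  qed
  moreover have "(\<lambda>n. ennreal ((2 / 3) ^ n)) \<longlonglongrightarrow> ennreal 0"
    by (intro tendsto_ennrealI LIMSEQ_realpow_zero) auto
  ultimately have "emeasure lborel cantor_set \<le> ennreal 0"
    by (intro LIMSEQ_le_const) auto
  then show "emeasure lborel cantor_set = 0" by simp
qed

text \<open>A point outside level n + 1 has both 3 u and 3 u - 2 outside level n, and the functional
  equation transports local constancy from these two points, with a third of the radius. Off level 0
  the function is constantly 0 or 1.\<close>

lemma cantor_function_locally_constant_off_level:
  assumes "u \<notin> cantor_level n"
  shows "\<exists>r>0. \<forall>s. \<bar>s - u\<bar> < r \<longrightarrow> cantor_function s = cantor_function u"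
  using assms
proof (induction n arbitrary: u)
  case 0
  then consider "u < 0" | "u > 1" by fastforce
  then show ?case
  proof cases
    case 1
    then show ?thesis by (intro exI[of _ "- u"]) (auto simp: cantor_function_le_0)
  next
    case 2
    then show ?thesis by (intro exI[of _ "u - 1"]) (auto simp: cantor_function_ge_1)
  qed
next
  case (Suc n)
  have "3 * u \<notin> cantor_level n"
  proof
    assume "3 * u \<in> cantor_level n"
    then have "3 * u / 3 \<in> cantor_level (Suc n)" by (simp only: cantor_level.simps) blast
    then show False using Suc.prems by simp
  qed
  moreover have "3 * u - 2 \<notin> cantor_level n"
  proof
    assume "3 * u - 2 \<in> cantor_level n"
    then have "((3 * u - 2) + 2) / 3 \<in> cantor_level (Suc n)" by (simp only: cantor_level.simps) blast
    then show False using Suc.prems by simp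
  qed
  ultimately obtain r1 r2 where r: "r1 > 0" "\<And>s. \<bar>s - 3 * u\<bar> < r1 \<Longrightarrow> cantor_function s = cantor_function (3 * u)"
    "r2 > 0" "\<And>s. \<bar>s - (3 * u - 2)\<bar> < r2 \<Longrightarrow> cantor_function s = cantor_function (3 * u - 2)"
    using Suc.IH by meson
  show ?case
  proof (intro exI[of _ "min r1 r2 / 3"] conjI allI impI)
    show "0 < min r1 r2 / 3" using r by simp
    fix s assume s: "\<bar>s - u\<bar> < min r1 r2 / 3"
    then have "\<bar>3 * s - 3 * u\<bar> < r1" "\<bar>(3 * s - 2) - (3 * u - 2)\<bar> < r2" by (auto simp: abs_if split: if_splits)
    then have "cantor_function (3 * s) = cantor_function (3 * u)" "cantor_function (3 * s - 2) = cantor_function (3 * u - 2)"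
      by (auto intro: r)
    then show "cantor_function s = cantor_function u"
      using cantor_function_eq[of s] cantor_function_eq[of u] by simp
  qed
qed

section \<open>The graph foliated by parabolas\<close>

text \<open>Local constancy off the null set \<open>C\<close> expresses that the measure dc is
  carried by \<open>C\<close>. The geometry below sees the Cantor function only through these
  properties.\<close>

locale devil_staircase =
  fixes c :: "real \<Rightarrow> real" and C :: "real set"
  assumes mono_c: "mono c" and cont_c: "continuous_on UNIV c"
    and c_le_0: "\<And>u. u \<le> 0 \<Longrightarrow> c u = 0" and c_ge_1: "\<And>u. u \<ge> 1 \<Longrightarrow> c u = 1"
    and closed_C: "closed C" and null_C: "C \<in> null_sets lborel"
    and locally_constant: "\<And>u. u \<notin> C \<Longrightarrow> \<exists>r>0. \<forall>s. \<bar>s - u\<bar> < r \<longrightarrow> c s = c u"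
begin

section \<open>The foot of a leaf as a coordinate\<close>

lemma c_nonneg: "0 \<le> c u" and c_le_one: "c u \<le> 1"
  using monoD[OF mono_c, of "min u 0" u] monoD[OF mono_c, of u "max u 1"] c_le_0[of "min u 0"] c_ge_1[of "max u 1"]
  by auto

definition chi :: "real \<Rightarrow> real \<Rightarrow> real" where "chi y u = u + c u * y\<^sup>2 / 2"

text \<open>Distinct leaves never meet, because a higher foot comes with at least as large a
  curvature.\<close>

lemma chi_strict_mono: "u < w \<Longrightarrow> chi y u < chi y w"
  using monoD[OF mono_c, of u w] by (simp add: chi_def add_less_le_mono mult_right_mono)

lemma chi_less_iff: "chi y u < chi y w \<longleftrightarrow> u < w"
  using chi_strict_mono[of u w y] chi_strict_mono[of w u y] by (cases u w rule: linorder_cases) auto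

lemma continuous_chi: "continuous_on UNIV (chi y)"
  unfolding chi_def[abs_def] using cont_c by (intro continuous_intros) auto

lemma ex_chi: "\<exists>u. chi y u = t"
proof -
  \<comment> \<open>As \<open>c\<close> takes values between 0 and 1, the foot of the leaf through
    (y, t) lies between t - y^2 / 2 and t.\<close>
  have "chi y (t - y\<^sup>2 / 2) \<le> t"
    using c_le_one[of "t - y\<^sup>2 / 2"] mult_right_mono[of "c (t - y\<^sup>2 / 2)" 1 "y\<^sup>2 / 2"] by (simp add: chi_def)
  moreover have "t \<le> chi y t" using c_nonneg by (simp add: chi_def)
  ultimately have "\<exists>u\<ge>t - y\<^sup>2 / 2. u \<le> t \<and> chi y u = t"
    by (intro IVT') (auto intro: continuous_on_subset[OF continuous_chi])
  then show ?thesis by blast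
qed

text \<open>The foot of the leaf through (y, t), that is, the inverse of
  \<open>chi y\<close>.\<close>

definition tau :: "real \<Rightarrow> real \<Rightarrow> real" where "tau y t = (THE u. chi y u = t)"

lemma chi_tau [simp]: "chi y (tau y t) = t" and tau_chi [simp]: "tau y (chi y u) = u"
proof -
  have unique: "u = w" if "chi y u = chi y w" for u w
    using that chi_less_iff[of y u w] chi_less_iff[of y w u] by (cases u w rule: linorder_cases) auto
  then have "\<exists>!u. chi y u = t" for t using ex_chi[of y t] by metis
  then show "chi y (tau y t) = t" unfolding tau_def by (rule theI')
  show "tau y (chi y u) = u" unfolding tau_def using unique by (intro the_equality) auto
qed

text \<open>An increment of \<open>chi y\<close> is the sum of the increment of the foot and that of
  \<open>c\<close> times y^2 / 2. Both have the same sign, so each is bounded by the total.\<close>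

lemma tau_lipschitz_snd:
  "\<bar>tau y t1 - tau y t2\<bar> \<le> \<bar>t1 - t2\<bar>" "\<bar>c (tau y t1) - c (tau y t2)\<bar> * (y\<^sup>2 / 2) \<le> \<bar>t1 - t2\<bar>"
proof -
  have *: "w - u \<le> chi y w - chi y u \<and> 0 \<le> (c w - c u) * (y\<^sup>2 / 2) \<and> (c w - c u) * (y\<^sup>2 / 2) \<le> chi y w - chi y u" if "u \<le> w" for u w
    using that monoD[OF mono_c that] mult_nonneg_nonneg[of "c w - c u" "y\<^sup>2 / 2"] by (simp add: chi_def left_diff_distrib)
  consider "tau y t1 \<le> tau y t2" | "tau y t2 \<le> tau y t1" by linarith
  then have "\<bar>tau y t1 - tau y t2\<bar> \<le> \<bar>t1 - t2\<bar> \<and> \<bar>c (tau y t1) - c (tau y t2)\<bar> * (y\<^sup>2 / 2) \<le> \<bar>t1 - t2\<bar>"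
  proof cases
    case 1 then show ?thesis using *[OF 1] monoD[OF mono_c 1] by (auto simp: abs_if)
  next
    case 2 then show ?thesis using *[OF 2] monoD[OF mono_c 2] by (auto simp: abs_if)
  qed
  then show "\<bar>tau y t1 - tau y t2\<bar> \<le> \<bar>t1 - t2\<bar>" "\<bar>c (tau y t1) - c (tau y t2)\<bar> * (y\<^sup>2 / 2) \<le> \<bar>t1 - t2\<bar>" by blast+
qed

text \<open>Sliding along a leaf from \<open>y1\<close> to \<open>y2\<close> changes the height by
  at most half the difference of the squares; the estimate on a fixed vertical line applies
  afterwards. The control of \<open>c\<close> degenerates as \<open>y2\<close> tends to 0, which is
  where \<open>f\<close> may be singular.\<close>

lemma tau_lipschitz:
  "\<bar>tau y1 t1 - tau y2 t2\<bar> \<le> \<bar>t1 - t2\<bar> + \<bar>y1\<^sup>2 - y2\<^sup>2\<bar> / 2"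
  "\<bar>c (tau y1 t1) - c (tau y2 t2)\<bar> * (y2\<^sup>2 / 2) \<le> \<bar>t1 - t2\<bar> + \<bar>y1\<^sup>2 - y2\<^sup>2\<bar> / 2"
proof -
  define u where "u = tau y1 t1"
  have "chi y2 u - t1 = c u * ((y2\<^sup>2 - y1\<^sup>2) / 2)"
    using chi_tau[of y1 t1] unfolding u_def[symmetric] by (simp add: chi_def field_simps)
  also have "\<bar>\<dots>\<bar> \<le> 1 * \<bar>(y2\<^sup>2 - y1\<^sup>2) / 2\<bar>"
    unfolding abs_mult using c_nonneg c_le_one by (intro mult_right_mono) auto
  finally have "\<bar>chi y2 u - t1\<bar> \<le> \<bar>y1\<^sup>2 - y2\<^sup>2\<bar> / 2" by (simp add: abs_minus_commute)
  then have "\<bar>chi y2 u - t2\<bar> \<le> \<bar>t1 - t2\<bar> + \<bar>y1\<^sup>2 - y2\<^sup>2\<bar> / 2" by linarith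
  then show "\<bar>tau y1 t1 - tau y2 t2\<bar> \<le> \<bar>t1 - t2\<bar> + \<bar>y1\<^sup>2 - y2\<^sup>2\<bar> / 2"
    "\<bar>c (tau y1 t1) - c (tau y2 t2)\<bar> * (y2\<^sup>2 / 2) \<le> \<bar>t1 - t2\<bar> + \<bar>y1\<^sup>2 - y2\<^sup>2\<bar> / 2"
    using tau_lipschitz_snd[of y2 "chi y2 u" t2] by (simp_all add: u_def)
qed

lemma continuous_tau: "continuous_on UNIV (\<lambda>x. tau (fst x) (snd x))"
proof (rule continuous_at_imp_continuous_on, rule ballI)
  fix x :: "real \<times> real"
  let ?g = "\<lambda>z. \<bar>snd z - snd x\<bar> + \<bar>(fst z)\<^sup>2 - (fst x)\<^sup>2\<bar> / 2"
  have "(?g \<longlongrightarrow> ?g x) (at x)"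
    by (intro tendsto_intros) auto
  then have lim: "(?g \<longlongrightarrow> 0) (at x)" by simp
  have "norm (tau (fst z) (snd z) - tau (fst x) (snd x)) \<le> ?g z" for z
    unfolding real_norm_def by (rule tau_lipschitz(1))
  then have "\<forall>\<^sub>F z in at x. norm (tau (fst z) (snd z) - tau (fst x) (snd x)) \<le> ?g z"
    by (intro always_eventually allI)
  then have "((\<lambda>z. tau (fst z) (snd z) - tau (fst x) (snd x)) \<longlongrightarrow> 0) (at x)"
    by (rule Lim_null_comparison[OF _ lim])
  then show "isCont (\<lambda>x. tau (fst x) (snd x)) x"
    unfolding isCont_def by (rule LIM_zero_cancel)
qed

definition A :: "real \<times> real \<Rightarrow> real" where "A x = c (tau (fst x) (snd x))"

definition f :: "real \<times> real \<Rightarrow> real" where "f x = fst x * A x"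

lemma continuous_A: "continuous_on UNIV A"
  unfolding A_def[abs_def] by (rule continuous_on_compose2[OF cont_c continuous_tau]) simp

lemma continuous_f: "continuous_on UNIV f"
  unfolding f_def[abs_def] by (intro continuous_intros continuous_A)

lemma A_bounds: "0 \<le> A x" "A x \<le> 1"
  by (simp_all add: A_def c_nonneg c_le_one)

lemma A_chi [simp]: "A (y, chi y u) = c u"
  by (simp add: A_def)

lemma f_chi [simp]: "f (y, chi y u) = y * c u"
  by (simp add: f_def)

lemma locally_lipschitz_f:
  assumes "{0} \<times> C \<subseteq> S"
  shows "locally_lipschitz_on (UNIV - S) f"
  unfolding locally_lipschitz_on_def
proof
  fix x0 assume x0: "x0 \<in> UNIV - S"
  obtain y0 t0 where x0': "x0 = (y0, t0)" by (cases x0)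
  show "\<exists>r>0. \<exists>L. L-lipschitz_on (cball x0 r \<inter> (UNIV - S)) f"
  proof (cases "y0 = 0")
    case False
    define r where "r = \<bar>y0\<bar> / 2"
    \<comment> \<open>In this ball y2^2 / 2 is at least y0^2 / 8, and \<bar>y1^2 - y2^2\<bar> / 2 is
      at most 2 \<bar>y0\<bar> times the distance of the points.\<close>
    define L where "L = 8 / y0\<^sup>2 * (1 + 2 * \<bar>y0\<bar>)"
    have r: "r > 0" and L: "L \<ge> 0" using False by (simp_all add: r_def L_def)
    have near: "\<bar>y0\<bar> / 2 \<le> \<bar>y\<bar> \<and> \<bar>y\<bar> \<le> 2 * \<bar>y0\<bar>" if "(y, t) \<in> cball x0 r" for y t
    proof -
      have "dist y0 y \<le> r" using that dist_fst_le[of x0 "(y, t)"] by (simp add: x0')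
      then show ?thesis by (simp add: r_def dist_real_def abs_if split: if_splits)
    qed
    have "(1 + 2 * \<bar>y0\<bar> * L)-lipschitz_on (cball x0 r) f"
    proof (rule lipschitz_onI)
      show "0 \<le> 1 + 2 * \<bar>y0\<bar> * L" using L by simp
      fix p q assume pq: "p \<in> cball x0 r" "q \<in> cball x0 r"
      obtain y1 t1 y2 t2 where p: "p = (y1, t1)" and q: "q = (y2, t2)" by (cases p, cases q)
      define d where "d = dist p q"
      have dy: "\<bar>y1 - y2\<bar> \<le> d" and dt: "\<bar>t1 - t2\<bar> \<le> d"
        using dist_fst_le[of p q] dist_snd_le[of p q] by (simp_all add: p q d_def dist_real_def)
      have n1: "\<bar>y1\<bar> \<le> 2 * \<bar>y0\<bar>" and n2: "\<bar>y0\<bar> / 2 \<le> \<bar>y2\<bar>" "\<bar>y2\<bar> \<le> 2 * \<bar>y0\<bar>"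
        using near pq by (auto simp: p q)
      have "\<bar>y1\<^sup>2 - y2\<^sup>2\<bar> = \<bar>y1 + y2\<bar> * \<bar>y1 - y2\<bar>" by (simp add: abs_mult[symmetric] power2_eq_square algebra_simps)
      also have "\<dots> \<le> (4 * \<bar>y0\<bar>) * d" using n1 n2 dy by (intro mult_mono) auto
      finally have sq: "\<bar>y1\<^sup>2 - y2\<^sup>2\<bar> / 2 \<le> 2 * \<bar>y0\<bar> * d" by simp
      have "(y0 / 2)\<^sup>2 \<le> y2\<^sup>2" using n2(1) by (simp add: abs_le_square_iff[symmetric])
      then have "\<bar>A p - A q\<bar> * (y0\<^sup>2 / 8) \<le> \<bar>A p - A q\<bar> * (y2\<^sup>2 / 2)"
        by (intro mult_left_mono) (auto simp: power2_eq_square)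
      also have "\<dots> \<le> d + 2 * \<bar>y0\<bar> * d"
        using tau_lipschitz(2)[of y1 t1 y2 t2] sq dt by (simp add: A_def p q)
      finally have dA: "\<bar>A p - A q\<bar> \<le> L * d"
        using False by (simp add: L_def field_simps)
      have "f p - f q = (y1 - y2) * A p + y2 * (A p - A q)" by (simp add: f_def p q algebra_simps)
      also have "\<bar>\<dots>\<bar> \<le> \<bar>y1 - y2\<bar> * \<bar>A p\<bar> + \<bar>y2\<bar> * \<bar>A p - A q\<bar>"
        unfolding abs_mult[symmetric] by (rule abs_triangle_ineq)
      also have "\<dots> \<le> d * 1 + (2 * \<bar>y0\<bar>) * (L * d)"
        using dy dA n2 A_bounds[of p] by (intro add_mono mult_mono) auto
      finally show "dist (f p) (f q) \<le> (1 + 2 * \<bar>y0\<bar> * L) * dist p q"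
        by (simp add: dist_real_def d_def algebra_simps)
    qed
    then show ?thesis using r by (blast intro: lipschitz_on_subset)
  next
    case True
    then have "t0 \<notin> C" using x0 x0' assms by auto
    then obtain r0 where r0: "r0 > 0" "\<And>s. \<bar>s - t0\<bar> < r0 \<Longrightarrow> c s = c t0" using locally_constant by blast
    \<comment> \<open>Since r is at most 1, y^2 is at most r, so feet of leaves through the ball
      stay within r + r / 2 < r0 of t0. There \<open>c\<close> is constant and \<open>f\<close> is
      linear in \<open>y\<close>.\<close>
    define r where "r = min 1 (r0 / 3)"
    have r: "0 < r" "r \<le> 1" "3 * r \<le> r0" using r0 by (auto simp: r_def)
    have val: "f p = fst p * c t0" if "p \<in> cball x0 r" for p
    proof -
      obtain y t where p: "p = (y, t)" by (cases p)
      have y: "\<bar>y\<bar> \<le> r" and t: "\<bar>t - t0\<bar> \<le> r"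
        using that dist_fst_le[of x0 p] dist_snd_le[of x0 p] True by (simp_all add: x0' p dist_real_def abs_minus_commute)
      have "y\<^sup>2 \<le> r" using y r mult_mono[of "\<bar>y\<bar>" r "\<bar>y\<bar>" 1] by (simp add: power2_eq_square abs_mult[symmetric])
      then have "\<bar>tau y t - t0\<bar> < r0"
        using tau_lipschitz(1)[of y t 0 "chi 0 t0"] t r tau_chi[of 0 t0] by (simp add: chi_def)
      from r0(2)[OF this] show ?thesis by (simp add: f_def A_def p)
    qed
    have "1-lipschitz_on (cball x0 r) f"
    proof (rule lipschitz_onI)
      fix p q assume pq: "p \<in> cball x0 r" "q \<in> cball x0 r"
      have "dist (f p) (f q) = \<bar>fst p - fst q\<bar> * \<bar>c t0\<bar>"
        by (simp add: val[OF pq(1)] val[OF pq(2)] dist_real_def abs_mult[symmetric] left_diff_distrib)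
      also have "\<dots> \<le> dist p q * 1"
        using dist_fst_le[of p q] c_nonneg[of t0] c_le_one[of t0] by (intro mult_mono) (auto simp: dist_real_def)
      finally show "dist (f p) (f q) \<le> 1 * dist p q" by simp
    qed simp
    then show ?thesis using r by (blast intro: lipschitz_on_subset)
  qed
qed

section \<open>The graph is not a coset\<close>

lemma not_intrinsic_plane: "\<not> intrinsic_plane (intrinsic_graph UNIV f)"
proof
  interpret H: group Heis by (rule group_Heis)
  let ?\<Gamma> = "intrinsic_graph UNIV f"
  have mem: "(f (y, t), y, t - y * f (y, t) / 2) \<in> ?\<Gamma>" for y t
    unfolding intrinsic_graph_eq by force
  assume "intrinsic_plane ?\<Gamma>"
  then obtain W p where W: "subgroup W Heis" and P: "?\<Gamma> = p <#\<^bsub>Heis\<^esub> W \<or> ?\<Gamma> = W #>\<^bsub>Heis\<^esub> p"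
    unfolding intrinsic_plane_def lie_subgroup2_def by blast
  have "(0, 0, 0) \<in> ?\<Gamma>" using mem[of 0 0] by (simp add: f_def)
  then have one: "\<one>\<^bsub>Heis\<^esub> \<in> ?\<Gamma>" by (simp add: Heis_def)
  have p: "p \<in> carrier Heis" by (simp add: Heis_def)
  \<comment> \<open>A coset that contains the identity is represented by it, hence equals the
    subgroup.\<close>
  have "?\<Gamma> = W"
    using P
  proof
    assume *: "?\<Gamma> = p <#\<^bsub>Heis\<^esub> W"
    have "\<one>\<^bsub>Heis\<^esub> <#\<^bsub>Heis\<^esub> W = W"
      using W by (simp add: H.lcos_mult_one subgroup.subset)
    then show ?thesis
      using H.l_repr_independence[OF one[unfolded *] p W] * by simp
  next
    assume *: "?\<Gamma> = W #>\<^bsub>Heis\<^esub> p"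
    then show ?thesis
      using H.repr_independence[OF one[unfolded *] p W] W by (simp add: H.coset_mult_one subgroup.subset)
  qed
  then have sub: "subgroup ?\<Gamma> Heis" using W by simp
  have c1: "f (1, 0) = 0"
  proof -
    have "tau 1 0 = 0" using tau_chi[of 1 0] by (simp add: chi_def c_le_0)
    then show ?thesis by (simp add: f_def A_def c_le_0)
  qed
  have c2: "f (1, 2) = 1"
  proof -
    have "tau 1 2 = 3/2" using tau_chi[of 1 "3/2"] by (simp add: chi_def c_ge_1)
    then show ?thesis by (simp add: f_def A_def c_ge_1)
  qed
  \<comment> \<open>One point lies over a leaf with c = 1, the other over a leaf with c = 0, both at
    y = 1. Their quotient has second coordinate 0 but first coordinate 1, whereas \<open>f\<close>
    vanishes on y = 0.\<close>
  have "(1, 1, 3/2) \<otimes>\<^bsub>Heis\<^esub> inv\<^bsub>Heis\<^esub> (0, 1, 0) \<in> ?\<Gamma>"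
    using mem[of 1 2] mem[of 1 0] c1 c2 sub
    by (intro subgroup.m_closed[OF sub] subgroup.m_inv_closed[OF sub]) simp_all
  moreover have "inv\<^bsub>Heis\<^esub> (0, 1, 0) = (0, -1, 0)"
    by (rule H.inv_equality) (simp_all add: Heis_def)
  ultimately have "(1, 0, 1) \<in> ?\<Gamma>" by (simp add: Heis_def)
  then show False unfolding intrinsic_graph_eq by (auto simp: f_def)
qed

end

section \<open>Integration along the characteristics\<close>

lemma borel_measurable_fst_real [measurable]: "fst \<in> borel_measurable (borel :: (real \<times> real) measure)"
  and borel_measurable_snd_real [measurable]: "snd \<in> borel_measurable (borel :: (real \<times> real) measure)"
  by (intro borel_measurable_continuous_onI continuous_intros)+

context devil_staircase
begin

text \<open>The leaf through \<open>(0, kap v)\<close> is \<open>t = kap v + v y\<^sup>2 / 2\<close>; the value off \<open>(0, 1)\<close> is junk.\<close>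

definition kap :: "real \<Rightarrow> real" where
  "kap v = (if v \<in> {0<..<1} then Sup {u. c u \<le> v} else 0)"

text \<open>Below, \<open>kap v\<close> is the largest point where \<open>c\<close> is at most
  \<open>v\<close>: the supremum is attained by continuity, and the intermediate value theorem turns
  the inequality there into equality. Taking the largest point gives the equivalence with strict
  inequalities.\<close>

lemma
  assumes "0 < v" "v < 1"
  shows less_kap_iff: "kap v < u \<longleftrightarrow> v < c u" and c_kap: "c (kap v) = v"
proof -
  let ?S = "{u. c u \<le> v}"
  have k: "kap v = Sup ?S" using assms by (simp add: kap_def)
  have ne: "?S \<noteq> {}" using c_le_0[of 0] assms by (intro ex_in_conv[THEN iffD1] exI[of _ 0]) simp
  have bdd: "bdd_above ?S"
  proof (rule bdd_aboveI)
    fix u assume "u \<in> ?S" then show "u \<le> 1" using c_ge_1[of u] assms by (cases "u \<le> 1") auto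
  qed
  have "closed ?S" using cont_c by (intro closed_Collect_le) auto
  then have "kap v \<in> ?S" unfolding k by (rule closed_contains_Sup[OF ne bdd])
  then have le: "c (kap v) \<le> v" by simp
  obtain w where w: "c w = v"
    using IVT'[of c 0 v 1] c_le_0[of 0] c_ge_1[of 1] assms continuous_on_subset[OF cont_c] by auto
  have "w \<le> kap v" unfolding k by (rule cSup_upper[OF _ bdd]) (simp add: w)
  then show "c (kap v) = v" using monoD[OF mono_c, of w "kap v"] le w by simp
  show "kap v < u \<longleftrightarrow> v < c u"
  proof
    assume "kap v < u"
    then have "u \<notin> ?S" unfolding k using cSup_upper[OF _ bdd, of u] by auto
    then show "v < c u" by simp
  next
    assume "v < c u"
    then show "kap v < u" using monoD[OF mono_c, of u "kap v"] le by (cases "kap v < u") auto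
  qed
qed

text \<open>Off \<open>C\<close> the value \<open>v\<close> would persist slightly to the right of
  \<open>kap v\<close>, against its maximality.\<close>

lemma kap_in_C:
  assumes "0 < v" "v < 1" shows "kap v \<in> C"
proof (rule ccontr)
  assume "kap v \<notin> C"
  then obtain r where r: "r > 0" "\<And>s. \<bar>s - kap v\<bar> < r \<Longrightarrow> c s = c (kap v)" using locally_constant by blast
  have "c (kap v + r / 2) = v" using r(2)[of "kap v + r / 2"] r(1) c_kap[OF assms] by simp
  then show False using less_kap_iff[OF assms, of "kap v + r / 2"] r(1) by simp
qed

lemma borel_measurable_c [measurable]: "c \<in> borel_measurable borel"
  by (rule borel_measurable_continuous_onI[OF cont_c])

lemma borel_measurable_kap [measurable]: "kap \<in> borel_measurable borel"
proof (rule borel_measurable_iff_less[THEN iffD2], rule allI)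
  fix a
  have "{v \<in> space borel. kap v < a} = ({0<..<1} \<inter> {..<c a}) \<union> (if 0 < a then - {0<..<1} else {})"
    using less_kap_iff(1)[of _ a] by (auto simp: kap_def[of "_ :: real"] split: if_splits)
  then show "{v \<in> space borel. kap v < a} \<in> sets borel" by simp
qed

lemma borel_measurable_chi [measurable]:
  assumes "g \<in> borel_measurable M" "h \<in> borel_measurable M"
  shows "(\<lambda>x. chi (g x) (h x)) \<in> borel_measurable M"
  unfolding chi_def using assms by measurable

text \<open>The formula \<open>dt = du + (y\<^sup>2 / 2) dc(u)\<close>, with \<open>dc\<close> the image of Lebesgue measure on \<open>(0, 1)\<close> under \<open>kap\<close>.\<close>

lemma emeasure_lborel_split:
  assumes "S \<in> sets borel"
  shows "emeasure lborel S = (\<integral>\<^sup>+u. indicator S (chi y u) \<partial>lborel)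
    + (\<integral>\<^sup>+v. ennreal (indicator {0<..<1} v * (y\<^sup>2 / 2)) * indicator S (chi y (kap v)) \<partial>lborel)"
proof -
  define \<mu> where "\<mu> S = (\<integral>\<^sup>+u. indicator S (chi y u) \<partial>lborel)
    + (\<integral>\<^sup>+v. ennreal (indicator {0<..<1} v * (y\<^sup>2 / 2)) * indicator S (chi y (kap v)) \<partial>lborel)" for S
  have meas: "(\<lambda>u. indicator S (chi y u) :: ennreal) \<in> borel_measurable lborel"
    "(\<lambda>v. ennreal (indicator {0<..<1} v * (y\<^sup>2 / 2)) * indicator S (chi y (kap v))) \<in> borel_measurable lborel"
    if [measurable]: "S \<in> sets borel" for S
    by measurable
  define M where "M = measure_of UNIV (sets borel) \<mu>"
  have sets_M: "sets M = sets borel" using sets.sigma_sets_eq[of "borel :: real measure"] by (simp add: M_def)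
  have sets_lM: "sets M = sets lborel" by (simp add: sets_M)
  have em: "emeasure M S = \<mu> S" if "S \<in> sets borel" for S
  proof (rule emeasure_measure_of[OF M_def])
    show "positive (sets M) \<mu>" by (simp add: positive_def \<mu>_def)
    show "countably_additive (sets M) \<mu>"
    proof (rule countably_additiveI)
      fix F :: "nat \<Rightarrow> real set" assume F: "range F \<subseteq> sets M" "disjoint_family F"
      then have Fm: "F i \<in> sets borel" for i by (auto simp: sets_M)
      have ind: "(indicator (\<Union>i. F i) x :: ennreal) = (\<Sum>i. indicator (F i) x)" for x
        using suminf_indicator[OF F(2), of x] by simp
      have "\<mu> (\<Union>i. F i) = (\<integral>\<^sup>+u. (\<Sum>i. indicator (F i) (chi y u)) \<partial>lborel)
        + (\<integral>\<^sup>+v. (\<Sum>i. ennreal (indicator {0<..<1} v * (y\<^sup>2 / 2)) * indicator (F i) (chi y (kap v))) \<partial>lborel)"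
        unfolding \<mu>_def ind by (simp add: ennreal_suminf_cmult)
      also have "\<dots> = (\<Sum>i. \<integral>\<^sup>+u. indicator (F i) (chi y u) \<partial>lborel)
        + (\<Sum>i. \<integral>\<^sup>+v. ennreal (indicator {0<..<1} v * (y\<^sup>2 / 2)) * indicator (F i) (chi y (kap v)) \<partial>lborel)"
        using meas[OF Fm] by (simp only: nn_integral_suminf)
      also have "\<dots> = (\<Sum>i. \<mu> (F i))"
        unfolding \<mu>_def by (rule suminf_add) simp_all
      finally show "(\<Sum>i. \<mu> (F i)) = \<mu> (\<Union>i. F i)" ..
    qed
  qed (use that in \<open>auto simp: sets_M\<close>)
  have "lborel = M"
  proof (rule lborel_eqI)
    fix l r :: real assume lr: "\<And>b. b \<in> Basis \<Longrightarrow> l \<bullet> b \<le> r \<bullet> b"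
    define a b where "a = tau y l" and "b = tau y r"
    have l: "l = chi y a" and r: "r = chi y b" by (simp_all add: a_def b_def)
    have ab: "a \<le> b" using lr[of 1] chi_less_iff[of y b a] by (simp add: l r linorder_not_less[symmetric])
    have "(\<integral>\<^sup>+u. indicator {l<..<r} (chi y u) \<partial>lborel) = (\<integral>\<^sup>+u. indicator {a<..<b} u \<partial>lborel)"
      by (intro nn_integral_cong) (simp add: l r chi_less_iff indicator_def)
    also have "\<dots> = ennreal (b - a)" using ab by simp
    finally have 1: "(\<integral>\<^sup>+u. indicator {l<..<r} (chi y u) \<partial>lborel) = ennreal (b - a)" .
    let ?V = "{v. 0 < v \<and> v < 1 \<and> a < kap v \<and> kap v < b}"
    have Vm: "?V \<in> sets borel" by measurable
    \<comment> \<open>The values whose leaf passes strictly between the end points form an interval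
      from \<open>c a\<close> to \<open>c b\<close>, up to its end points.\<close>
    have V1: "{c a<..<c b} \<subseteq> ?V"
    proof
      fix v assume v: "v \<in> {c a<..<c b}"
      then have v01: "0 < v" "v < 1" using c_nonneg[of a] c_le_one[of b] by auto
      have "a < kap v"
        using v c_kap[OF v01] monoD[OF mono_c, of "kap v" a] by (cases "a < kap v") auto
      then show "v \<in> ?V" using v v01 less_kap_iff[OF v01] by auto
    qed
    have V2: "?V \<subseteq> {c a..c b}"
    proof
      fix v assume v: "v \<in> ?V"
      then have "c a \<le> c (kap v)" by (intro monoD[OF mono_c]) auto
      then show "v \<in> {c a..c b}" using v less_kap_iff[of v b] c_kap[of v] by auto
    qed
    have cab: "c a \<le> c b" using ab by (rule monoD[OF mono_c])
    have "emeasure lborel ?V \<le> emeasure lborel {c a..c b}" by (rule emeasure_mono[OF V2]) simp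
    moreover have "emeasure lborel {c a<..<c b} \<le> emeasure lborel ?V" by (rule emeasure_mono[OF V1]) (use Vm in simp)
    ultimately have V: "emeasure lborel ?V = ennreal (c b - c a)" using cab by (simp add: antisym)
    have "(\<integral>\<^sup>+v. ennreal (indicator {0<..<1} v * (y\<^sup>2 / 2)) * indicator {l<..<r} (chi y (kap v)) \<partial>lborel)
      = (\<integral>\<^sup>+v. ennreal (y\<^sup>2 / 2) * indicator ?V v \<partial>lborel)"
      by (intro nn_integral_cong) (auto simp: l r chi_less_iff indicator_def)
    also have "\<dots> = ennreal (y\<^sup>2 / 2) * ennreal (c b - c a)"
      using Vm by (simp add: nn_integral_cmult_indicator V)
    finally have 2: "(\<integral>\<^sup>+v. ennreal (indicator {0<..<1} v * (y\<^sup>2 / 2)) * indicator {l<..<r} (chi y (kap v)) \<partial>lborel)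
      = ennreal (y\<^sup>2 / 2 * (c b - c a))" using cab ennreal_mult[of "y\<^sup>2 / 2" "c b - c a"] by simp
    have "emeasure M (box l r) = \<mu> {l<..<r}" by (simp add: em)
    also have "\<dots> = ennreal (b - a + y\<^sup>2 / 2 * (c b - c a))"
      unfolding \<mu>_def 1 2 using ab cab by (simp add: ennreal_plus)
    also have "b - a + y\<^sup>2 / 2 * (c b - c a) = r - l" by (simp add: l r chi_def algebra_simps diff_divide_distrib)
    finally show "emeasure M (box l r) = ennreal (\<Prod>b\<in>Basis. (r - l) \<bullet> b)" by simp
  qed (simp add: sets_M)
  then have "emeasure lborel S = emeasure M S" by simp
  then show ?thesis using em[OF assms] by (simp add: \<mu>_def)
qed

lemma nn_integral_lborel_split:
  assumes "h \<in> borel_measurable borel"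
  shows "(\<integral>\<^sup>+t. h t \<partial>lborel) = (\<integral>\<^sup>+u. h (chi y u) \<partial>lborel)
    + (\<integral>\<^sup>+v. ennreal (indicator {0<..<1} v * (y\<^sup>2 / 2)) * h (chi y (kap v)) \<partial>lborel)"
  using assms
proof (induction h rule: borel_measurable_induct)
  case (cong f g)
  then show ?case by simp
next
  case (set S)
  then show ?case using emeasure_lborel_split[of S y] by simp
next
  case (mult h a)
  note [measurable] = mult(2)
  show ?case
    by (simp add: nn_integral_cmult mult distrib_left mult.left_commute[of _ a])
next
  case (add h g)
  note [measurable] = add(1,3)
  have 1: "(\<integral>\<^sup>+u. g (chi y u) + h (chi y u) \<partial>lborel) = (\<integral>\<^sup>+u. g (chi y u) \<partial>lborel) + (\<integral>\<^sup>+u. h (chi y u) \<partial>lborel)"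
    by (rule nn_integral_add) measurable
  have 2: "(\<integral>\<^sup>+v. ennreal (indicator {0<..<1} v * (y\<^sup>2 / 2)) * (g (chi y (kap v)) + h (chi y (kap v))) \<partial>lborel)
    = (\<integral>\<^sup>+v. ennreal (indicator {0<..<1} v * (y\<^sup>2 / 2)) * g (chi y (kap v)) \<partial>lborel)
    + (\<integral>\<^sup>+v. ennreal (indicator {0<..<1} v * (y\<^sup>2 / 2)) * h (chi y (kap v)) \<partial>lborel)"
    unfolding distrib_left by (rule nn_integral_add) measurable
  have 3: "(\<integral>\<^sup>+t. g t + h t \<partial>lborel) = (\<integral>\<^sup>+t. g t \<partial>lborel) + (\<integral>\<^sup>+t. h t \<partial>lborel)"
    by (rule nn_integral_add) measurable
  show ?case unfolding 1 2 3 add(6) add(7) by (simp only: ac_simps)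
next
  case (seq U)
  note [measurable] = seq(1)
  have inc1: "incseq (\<lambda>i u. U i (chi y u))" using seq(3) by (auto simp: incseq_def le_fun_def)
  have inc2: "incseq (\<lambda>i v. ennreal (indicator {0<..<1} v * (y\<^sup>2 / 2)) * U i (chi y (kap v)))"
    using seq(3) by (auto simp: incseq_def le_fun_def intro!: mult_left_mono)
  have "(\<integral>\<^sup>+t. (SUP i. U i t) \<partial>lborel) = (SUP i. \<integral>\<^sup>+t. U i t \<partial>lborel)"
    by (rule nn_integral_monotone_convergence_SUP[OF seq(3)]) measurable
  also have "\<dots> = (SUP i. (\<integral>\<^sup>+u. U i (chi y u) \<partial>lborel)
    + (\<integral>\<^sup>+v. ennreal (indicator {0<..<1} v * (y\<^sup>2 / 2)) * U i (chi y (kap v)) \<partial>lborel))"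
    by (simp add: seq)
  also have "\<dots> = (SUP i. \<integral>\<^sup>+u. U i (chi y u) \<partial>lborel)
    + (SUP i. \<integral>\<^sup>+v. ennreal (indicator {0<..<1} v * (y\<^sup>2 / 2)) * U i (chi y (kap v)) \<partial>lborel)"
    using inc1 inc2 by (intro ennreal_SUP_add) (auto simp: incseq_def le_fun_def intro!: nn_integral_mono)
  also have "(SUP i. \<integral>\<^sup>+u. U i (chi y u) \<partial>lborel) = (\<integral>\<^sup>+u. (SUP i. U i (chi y u)) \<partial>lborel)"
    by (rule nn_integral_monotone_convergence_SUP[OF inc1, symmetric]) measurable
  also have "(SUP i. \<integral>\<^sup>+v. ennreal (indicator {0<..<1} v * (y\<^sup>2 / 2)) * U i (chi y (kap v)) \<partial>lborel)
      = (\<integral>\<^sup>+v. (SUP i. ennreal (indicator {0<..<1} v * (y\<^sup>2 / 2)) * U i (chi y (kap v))) \<partial>lborel)"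
    by (rule nn_integral_monotone_convergence_SUP[OF inc2, symmetric]) measurable
  finally show ?case by (simp add: SUP_mult_left_ennreal image_comp)
qed

section \<open>Splitting integrals over the plane into regular and singular parts\<close>

definition regular :: "real \<times> real \<Rightarrow> real \<times> real" where
  "regular x = (fst x, chi (fst x) (snd x))"

definition singular :: "real \<times> real \<Rightarrow> real \<times> real" where
  "singular x = (fst x, chi (fst x) (kap (snd x)))"

text \<open>The density of dt with respect to dv on the vertical line through y. The indicator
  removes the junk values of \<open>kap\<close>.\<close>

definition weight :: "real \<times> real \<Rightarrow> real" where
  "weight x = indicator {0<..<1} (snd x) * ((fst x)\<^sup>2 / 2)"

lemma weight_nonneg: "weight x \<ge> 0"
  by (simp add: weight_def)

lemma measurable_char [measurable]:
  "regular \<in> borel_measurable borel" "singular \<in> borel_measurable borel" "weight \<in> borel_measurable borel"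
  unfolding regular_def[abs_def] singular_def[abs_def] weight_def[abs_def] borel_prod[symmetric] by measurable

lemma nn_integral_char:
  fixes h :: "real \<times> real \<Rightarrow> ennreal"
  assumes [measurable]: "h \<in> borel_measurable borel"
  shows "(\<integral>\<^sup>+x. h x \<partial>lborel) = (\<integral>\<^sup>+x. h (regular x) \<partial>lborel) + (\<integral>\<^sup>+x. ennreal (weight x) * h (singular x) \<partial>lborel)"
proof -
  have fub: "(\<integral>\<^sup>+x. g x \<partial>lborel) = (\<integral>\<^sup>+y. \<integral>\<^sup>+t. g (y, t) \<partial>lborel \<partial>lborel)" if "g \<in> borel_measurable borel"
    for g :: "real \<times> real \<Rightarrow> ennreal"
    using lborel.nn_integral_fst[of g lborel] that by (simp add: lborel_prod)
  have h': "(\<lambda>t. h (y, t)) \<in> borel_measurable borel" for y by measurable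
  have m: "(\<lambda>x. h (regular x)) \<in> borel_measurable borel" "(\<lambda>x. ennreal (weight x) * h (singular x)) \<in> borel_measurable borel"
    by measurable
  have m1: "(\<lambda>y. \<integral>\<^sup>+u. h (regular (y, u)) \<partial>lborel) \<in> borel_measurable lborel"
    using lborel.borel_measurable_nn_integral_fst[of "\<lambda>x. h (regular x)" lborel] m(1) by (simp add: lborel_prod)
  have m2: "(\<lambda>y. \<integral>\<^sup>+v. ennreal (weight (y, v)) * h (singular (y, v)) \<partial>lborel) \<in> borel_measurable lborel"
    using lborel.borel_measurable_nn_integral_fst[of "\<lambda>x. ennreal (weight x) * h (singular x)" lborel] m(2) by (simp add: lborel_prod)
  have "(\<integral>\<^sup>+x. h x \<partial>lborel) = (\<integral>\<^sup>+y. ((\<integral>\<^sup>+u. h (regular (y, u)) \<partial>lborel)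
      + (\<integral>\<^sup>+v. ennreal (weight (y, v)) * h (singular (y, v)) \<partial>lborel)) \<partial>lborel)"
    unfolding fub[OF assms]
  proof (rule nn_integral_cong)
    fix y
    show "(\<integral>\<^sup>+t. h (y, t) \<partial>lborel) = (\<integral>\<^sup>+u. h (regular (y, u)) \<partial>lborel)
      + (\<integral>\<^sup>+v. ennreal (weight (y, v)) * h (singular (y, v)) \<partial>lborel)"
      using nn_integral_lborel_split[OF h', of y y] by (simp add: regular_def singular_def weight_def)
  qed
  also have "\<dots> = (\<integral>\<^sup>+y. (\<integral>\<^sup>+u. h (regular (y, u)) \<partial>lborel) \<partial>lborel)
      + (\<integral>\<^sup>+y. (\<integral>\<^sup>+v. ennreal (weight (y, v)) * h (singular (y, v)) \<partial>lborel) \<partial>lborel)"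
    by (rule nn_integral_add[OF m1 m2])
  finally show ?thesis unfolding fub[OF m(1)] fub[OF m(2)] .
qed

lemma integral_char:
  fixes h :: "real \<times> real \<Rightarrow> real"
  assumes [measurable]: "h \<in> borel_measurable borel" and int: "integrable lborel h"
  shows "integrable lborel (\<lambda>x. h (regular x))" "integrable lborel (\<lambda>x. weight x * h (singular x))"
    and "integral\<^sup>L lborel h = (LINT x|lborel. h (regular x)) + (LINT x|lborel. weight x * h (singular x))"
proof -
  have e: "ennreal (weight x) * ennreal r = ennreal (weight x * r)" for x r
    by (simp add: ennreal_mult' weight_nonneg)
  have split: "(\<integral>\<^sup>+x. ennreal (g x) \<partial>lborel) = (\<integral>\<^sup>+x. ennreal (g (regular x)) \<partial>lborel) + (\<integral>\<^sup>+x. ennreal (weight x * g (singular x)) \<partial>lborel)"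
    if [measurable]: "g \<in> borel_measurable borel" for g
    using nn_integral_char[of "\<lambda>x. ennreal (g x)"] that by (simp add: e)
  have "(\<integral>\<^sup>+x. ennreal (norm (h x)) \<partial>lborel) < \<infinity>" using int by (simp add: integrable_iff_bounded)
  then have "(\<integral>\<^sup>+x. ennreal (norm (h (regular x))) \<partial>lborel) < \<infinity>" "(\<integral>\<^sup>+x. ennreal (weight x * norm (h (singular x))) \<partial>lborel) < \<infinity>"
    using split[of "\<lambda>x. norm (h x)"] by simp_all
  then show i: "integrable lborel (\<lambda>x. h (regular x))" "integrable lborel (\<lambda>x. weight x * h (singular x))"
    by (simp_all add: integrable_iff_bounded abs_mult weight_nonneg)
  have fin: "(\<integral>\<^sup>+x. ennreal (h (regular x)) \<partial>lborel) < \<infinity>" "(\<integral>\<^sup>+x. ennreal (- h (regular x)) \<partial>lborel) < \<infinity>"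
    "(\<integral>\<^sup>+x. ennreal (weight x * h (singular x)) \<partial>lborel) < \<infinity>" "(\<integral>\<^sup>+x. ennreal (- (weight x * h (singular x))) \<partial>lborel) < \<infinity>"
    using i by (simp_all add: real_integrable_def less_top)
  show "integral\<^sup>L lborel h = (LINT x|lborel. h (regular x)) + (LINT x|lborel. weight x * h (singular x))"
    unfolding real_lebesgue_integral_def[OF int] real_lebesgue_integral_def[OF i(1)] real_lebesgue_integral_def[OF i(2)]
    using split[of h] split[of "\<lambda>x. - h x"] fin by (simp add: enn2real_plus)
qed

text \<open>In the coordinates (y, u) of the regular part, leaves with foot in \<open>C\<close> form
  a null set; there \<open>ft\<close> can be replaced by 0.\<close>

lemma AE_not_C: "AE x in lborel. snd (x :: real \<times> real) \<notin> C"
proof (rule AE_I)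
  have C: "C \<in> sets lborel" "emeasure lborel C = 0" using null_C by auto
  have "emeasure (lborel \<Otimes>\<^sub>M lborel) ((UNIV :: real set) \<times> C) = emeasure lborel (UNIV :: real set) * emeasure lborel C"
    by (rule lborel.emeasure_pair_measure_Times) (use C in auto)
  then show "emeasure lborel (UNIV \<times> C :: (real \<times> real) set) = 0" using C by (simp add: lborel_prod)
  show "UNIV \<times> C \<in> sets (lborel :: (real \<times> real) measure)"
    using C unfolding lborel_prod[symmetric] by (intro pair_measureI) auto
qed auto

text \<open>The map \<open>singular\<close> keeps \<open>y\<close>, so the integrand is bounded and
  supported in a bounded strip of \<open>y\<close> times the unit interval of \<open>v\<close>,
  although \<open>singular\<close> is only known to be measurable.\<close>

lemma integrable_singular:
  fixes \<rho> :: "real \<times> real \<Rightarrow> real" and m :: "real \<Rightarrow> real"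
  assumes \<rho>: "continuous_on UNIV \<rho>" "compact K" "\<And>x. x \<notin> K \<Longrightarrow> \<rho> x = 0" and m: "continuous_on UNIV m"
  shows "integrable lborel (\<lambda>x. indicator {0<..<1} (snd x) * m (snd x) * \<rho> (singular x))"
proof -
  obtain R where R: "R > 0" "\<forall>x\<in>K. norm x \<le> R"
    using compact_imp_bounded[OF \<rho>(2)] unfolding bounded_pos by blast
  have z: "\<rho> (y, t) = 0" if "R < \<bar>y\<bar>" for y t
  proof (rule \<rho>(3))
    have "norm (y, t) > R" using that norm_fst_le[of y t] by auto
    then show "(y, t) \<notin> K" using R(2) by fastforce
  qed
  obtain N where N: "N \<ge> 0" "\<forall>v\<in>{0..1}. \<bar>m v\<bar> \<le> N" by (rule continuous_on_compact_bound[OF m compact_Icc])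
  obtain M where M: "M \<ge> 0" "\<forall>x\<in>K. \<bar>\<rho> x\<bar> \<le> M" by (rule continuous_on_compact_bound[OF \<rho>(1,2)])
  have M': "\<bar>\<rho> x\<bar> \<le> M" for x using M \<rho>(3)[of x] by (cases "x \<in> K") auto
  have [measurable]: "\<rho> \<in> borel_measurable borel" "m \<in> borel_measurable borel"
    using \<rho>(1) m by (simp_all add: borel_measurable_continuous_onI)
  have box: "integrable lborel (indicator (cbox (- R, 0) (R, 1)) :: real \<times> real \<Rightarrow> real)"
    by (rule integrable_indicator_compact) (rule compact_cbox)
  show ?thesis
  proof (rule Bochner_Integration.integrable_bound)
    show "integrable lborel (\<lambda>x. N * M * indicator (cbox (- R, 0) (R, 1)) (x :: real \<times> real))" using box by simp
    have "\<bar>indicator {0<..<1} v * m v * \<rho> (singular (y, v))\<bar> \<le> \<bar>N * M * indicator (cbox (- R, 0) (R, 1)) (y, v)\<bar>" for y v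
    proof (cases "\<bar>y\<bar> \<le> R \<and> 0 < v \<and> v < 1")
      case True
      then have "\<bar>m v * \<rho> (singular (y, v))\<bar> \<le> N * M"
        unfolding abs_mult using N M' by (intro mult_mono) auto
      then show ?thesis using True N M by (simp add: indicator_def cbox_Pair_eq abs_le_iff)
    next
      case False
      then have eq0: "indicator {0<..<1} v * m v * \<rho> (singular (y, v)) = 0"
        using z[of y] by (auto simp: singular_def)
      show ?thesis unfolding eq0 by simp
    qed
    then show "AE x in lborel. norm (indicator {0<..<1} (snd x) * m (snd x) * \<rho> (singular x)) \<le> norm (N * M * indicator (cbox (- R, 0) (R, 1)) x)"
      by (intro AE_I2) (simp add: split_paired_all)
  qed measurable
qed

text \<open>Layer-cake representation of \<open>H (A x)\<close>: \<open>v < A (y, t)\<close> holds iff \<open>t\<close> lies above the leaf of \<open>kap v\<close>.\<close>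

lemma integral_composed_A:
  fixes H H' :: "real \<Rightarrow> real"
  assumes \<psi>: "C1_compact \<psi> \<psi>y \<psi>t"
    and H: "\<And>v. (H has_real_derivative H' v) (at v)" and H': "continuous_on UNIV H'"
  shows "(LINT x|lborel. H (A x) * \<psi>t x) = - (LINT x|lborel. indicator {0<..<1} (snd x) * H' (snd x) * \<psi> (singular x))"
    and "integrable lborel (\<lambda>x. indicator {0<..<1} (snd x) * H' (snd x) * \<psi> (singular x))"
    and "integrable lborel (\<lambda>x. H (A x) * \<psi>t x)"
proof -
  note D = C1_compactD[OF \<psi>] and out = C1_compact_outside_spt[OF \<psi>]
  obtain R where R: "R > 0" "\<And>y t. (y, t) \<in> spt \<psi> \<Longrightarrow> \<bar>y\<bar> \<le> R \<and> \<bar>t\<bar> \<le> R"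
    using spt_bounded[OF D(4)] by blast
  have z: "(y, t) \<notin> spt \<psi>" if "R < \<bar>y\<bar> \<or> R < \<bar>t\<bar>" for y t
    using R(2)[of y t] that by linarith
  obtain N where N: "N \<ge> 0" "\<forall>v\<in>{0..1}. \<bar>H' v\<bar> \<le> N" by (rule continuous_on_compact_bound[OF H' compact_Icc])
  obtain M1 where M1: "M1 \<ge> 0" "\<forall>x\<in>spt \<psi>. \<bar>\<psi>t x\<bar> \<le> M1" by (rule continuous_on_compact_bound[OF D(3,4)])
  have M1': "\<bar>\<psi>t x\<bar> \<le> M1" for x using M1 out(3)[of x] by (cases "x \<in> spt \<psi>") auto
  have [measurable]: "\<psi> \<in> borel_measurable borel" "\<psi>t \<in> borel_measurable borel" "H' \<in> borel_measurable borel"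
    using D H' by (simp_all add: borel_measurable_continuous_onI)
  have cH: "continuous_on UNIV H" using H by (intro continuous_at_imp_continuous_on ballI DERIV_isCont) auto
  have cHA: "continuous_on UNIV (\<lambda>x. H (A x) * \<psi>t x)"
    by (intro continuous_on_mult D continuous_on_compose2[OF cH continuous_A]) auto
  show i0: "integrable lborel (\<lambda>x. H (A x) * \<psi>t x)"
    by (rule integrable_continuous_compact_support[OF cHA D(4)]) (simp add: out)
  have box: "integrable lborel (indicator (cbox (- R, 0) (R, 1)) :: real \<times> real \<Rightarrow> real)"
    by (rule integrable_indicator_compact) (rule compact_cbox)
  show i1: "integrable lborel (\<lambda>x. indicator {0<..<1} (snd x) * H' (snd x) * \<psi> (singular x))"
    by (rule integrable_singular[OF D(1) D(4) out(1) H'])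
  have slice: "(LINT t|lborel. H (A (y, t)) * \<psi>t (y, t)) = - (LINT v|lborel. indicator {0<..<1} v * H' v * \<psi> (singular (y, v)))" for y
  proof -
    have ct: "continuous_on UNIV (\<lambda>t. \<psi>t (y, t))"
      by (rule continuous_on_compose2[OF D(3)]) (auto intro!: continuous_intros)
    have dt: "((\<lambda>t. \<psi> (y, t)) has_real_derivative \<psi>t (y, s)) (at s)" for s
      using C1_compact_compose[OF \<psi> DERIV_const DERIV_ident, of y s] by simp
    have tz: "\<psi> (y, s) = 0" "\<psi>t (y, s) = 0" if "R < \<bar>s\<bar>" for s using z[of y s] that out by simp_all
    note 1 = integral_derivative_bounded_support[where Q = "\<lambda>t. \<psi> (y, t)" and q = "\<lambda>t. \<psi>t (y, t)", OF dt ct tz]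
    \<comment> \<open>Both sides of the claim on this vertical line are iterated integrals of
      \<open>K\<close>: integrating in \<open>v\<close> first gives (H (A) - H 0) \<psi>_t,
      integrating in \<open>t\<close> first gives - H' times \<psi> on the leaf.\<close>
    define K where "K x = indicator {0<..<1} (snd x) * indicator {chi y (kap (snd x))<..} (fst x) * (H' (snd x) * \<psi>t (y, fst x))" for x
    have K_eq: "K x = (if 0 < snd x \<and> snd x < 1 \<and> chi y (kap (snd x)) < fst x then H' (snd x) * \<psi>t (y, fst x) else 0)" for x
      by (auto simp: K_def indicator_def)
    have Km: "K \<in> borel_measurable borel"
      unfolding K_eq[abs_def] borel_prod[symmetric] by measurable
    have Ki: "integrable lborel K"
    proof (rule Bochner_Integration.integrable_bound)
      show "integrable lborel (\<lambda>x. N * M1 * indicator (cbox (- R, 0) (R, 1)) (x :: real \<times> real))" using box by simp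
      have "\<bar>K (t, v)\<bar> \<le> \<bar>N * M1 * indicator (cbox (- R, 0) (R, 1)) (t, v)\<bar>" for t v
      proof (cases "\<bar>t\<bar> \<le> R \<and> 0 < v \<and> v < 1")
        case True
        then have "\<bar>H' v * \<psi>t (y, t)\<bar> \<le> N * M1"
          unfolding abs_mult using N M1' by (intro mult_mono) auto
        then show ?thesis using True N M1 by (simp add: K_eq indicator_def cbox_Pair_eq abs_le_iff)
      next
        case False
        then show ?thesis using tz[of t] by (auto simp: K_eq)
      qed
      then show "AE x in lborel. norm (K x) \<le> norm (N * M1 * indicator (cbox (- R, 0) (R, 1)) x)"
        by (intro AE_I2) (simp add: split_paired_all)
    qed (use Km in simp)
    have inner: "(LINT v|lborel. K (t, v)) = (H (A (y, t)) - H 0) * \<psi>t (y, t)" for t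
    proof -
      have "(LINT v|lborel. K (t, v)) = (LINT v|lborel. (H' v * indicator {0..A (y, t)} v) * \<psi>t (y, t))"
      proof (rule integral_cong_AE)
        show "(\<lambda>v. K (t, v)) \<in> borel_measurable lborel" using Km by measurable
        show "(\<lambda>v. (H' v * indicator {0..A (y, t)} v) * \<psi>t (y, t)) \<in> borel_measurable lborel" by measurable
        show "AE v in lborel. K (t, v) = (H' v * indicator {0..A (y, t)} v) * \<psi>t (y, t)"
          \<comment> \<open>At these values of \<open>v\<close> the open and closed conditions
            differ; they form a null set.\<close>
          using AE_lborel_singleton[of 0] AE_lborel_singleton[of 1] AE_lborel_singleton[of "A (y, t)"]
        proof eventually_elim
          case (elim v)
          have "chi y (kap v) < t \<longleftrightarrow> v < A (y, t)" if "0 < v" "v < 1"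
            using chi_less_iff[of y "kap v" "tau y t"] less_kap_iff(1)[OF that] by (simp add: A_def)
          then show ?case using elim A_bounds[of "(y, t)"] by (auto simp: K_eq indicator_def)
        qed
      qed
      also have "\<dots> = (LINT v|lborel. H' v * indicator {0..A (y, t)} v) * \<psi>t (y, t)" by simp
      also have "(LINT v|lborel. H' v * indicator {0..A (y, t)} v) = H (A (y, t)) - H 0"
        using H' by (intro integral_FTC_Icc_real H A_bounds) (simp add: continuous_on_eq_continuous_at)
      finally show ?thesis .
    qed
    have swap: "(LINT t|lborel. LINT v|lborel. K (t, v)) = (LINT v|lborel. LINT t|lborel. K (t, v))"
      using lborel_pair.Fubini_integral[of "\<lambda>t v. K (t, v)"] Ki by (simp add: lborel_prod case_prod_eta)
    have sing: "(LINT t|lborel. K (t, v)) = - (indicator {0<..<1} v * H' v * \<psi> (singular (y, v)))" for v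
    proof -
      have "(LINT t|lborel. K (t, v)) = (LINT t|lborel. indicator {0<..<1} v * H' v * (indicator {chi y (kap v)<..} t * \<psi>t (y, t)))"
        by (intro Bochner_Integration.integral_cong) (simp_all add: K_def)
      also have "\<dots> = indicator {0<..<1} v * H' v * (LINT t|lborel. indicator {chi y (kap v)<..} t * \<psi>t (y, t))"
        by (rule integral_mult_right_zero)
      also have "\<dots> = indicator {0<..<1} v * H' v * - \<psi> (singular (y, v))"
        by (subst 1(3)) (simp_all add: singular_def)
      finally show ?thesis by simp
    qed
    \<comment> \<open>The constant \<open>H 0\<close> can be put back afterwards, since \<psi>_t has
      integral zero along the line.\<close>
    have "(LINT t|lborel. (H (A (y, t)) - H 0) * \<psi>t (y, t)) = - (LINT v|lborel. indicator {0<..<1} v * H' v * \<psi> (singular (y, v)))"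
      using swap unfolding inner sing by simp
    moreover have "(LINT t|lborel. H (A (y, t)) * \<psi>t (y, t)) = (LINT t|lborel. (H (A (y, t)) - H 0) * \<psi>t (y, t) + H 0 * \<psi>t (y, t))"
      by (simp add: algebra_simps)
    moreover have "integrable lborel (\<lambda>t. (H (A (y, t)) - H 0) * \<psi>t (y, t))"
    proof (rule integrable_continuous_compact_support[where K = "{- R..R}"])
      have "continuous_on UNIV (\<lambda>t. A (y, t))"
        by (rule continuous_on_compose2[OF continuous_A]) (auto intro!: continuous_intros)
      then have "continuous_on UNIV (\<lambda>t. H (A (y, t)))" by (rule continuous_on_compose2[OF cH]) simp
      then show "continuous_on UNIV (\<lambda>t. (H (A (y, t)) - H 0) * \<psi>t (y, t))" using ct by (intro continuous_intros)
    qed (use tz in \<open>auto simp: abs_le_iff not_le\<close>)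
    ultimately show ?thesis using 1(1,2) by simp
  qed
  have "(LINT x|lborel. H (A x) * \<psi>t x) = (LINT y|lborel. LINT t|lborel. H (A (y, t)) * \<psi>t (y, t))"
    using lborel_pair.integral_fst[of "\<lambda>y t. H (A (y, t)) * \<psi>t (y, t)"] i0 by (simp add: lborel_prod case_prod_unfold)
  also have "\<dots> = - (LINT y|lborel. LINT v|lborel. indicator {0<..<1} v * H' v * \<psi> (singular (y, v)))"
    unfolding slice by simp
  also have "(LINT y|lborel. LINT v|lborel. indicator {0<..<1} v * H' v * \<psi> (singular (y, v))) =
     (LINT x|lborel. indicator {0<..<1} (snd x) * H' (snd x) * \<psi> (singular x))"
    using lborel_pair.integral_fst[of "\<lambda>y v. indicator {0<..<1} v * H' v * \<psi> (singular (y, v))"] i1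
    by (simp add: lborel_prod case_prod_unfold)
  finally show "(LINT x|lborel. H (A x) * \<psi>t x) = - (LINT x|lborel. indicator {0<..<1} (snd x) * H' (snd x) * \<psi> (singular x))" .
qed

end

section \<open>Weak derivatives and stability\<close>

context devil_staircase
begin

text \<open>On the line \<open>y = 0\<close>, which is null, division by zero makes \<open>ft\<close> vanish.\<close>

definition ft :: "real \<times> real \<Rightarrow> real" where
  "ft x = 2 / fst x * indicator C (tau (fst x) (snd x))"

text \<open>Chosen so that the intrinsic gradient of \<open>f\<close> is \<open>A\<close> by
  construction; the work lies in showing that this is the weak \<open>y\<close>-derivative.\<close>

definition fy :: "real \<times> real \<Rightarrow> real" where "fy x = A x - f x * ft x"

lemma measurable_graph [measurable]:
  "A \<in> borel_measurable borel" "f \<in> borel_measurable borel" "ft \<in> borel_measurable borel" "fy \<in> borel_measurable borel"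
proof -
  show [measurable]: "A \<in> borel_measurable borel" "f \<in> borel_measurable borel"
    by (intro borel_measurable_continuous_onI continuous_A continuous_f)+
  have [measurable]: "(\<lambda>x. tau (fst x) (snd x)) \<in> borel_measurable borel" "C \<in> sets borel"
    using borel_measurable_continuous_onI[OF continuous_tau] closed_C by simp_all
  show [measurable]: "ft \<in> borel_measurable borel" unfolding ft_def[abs_def] by measurable
  show "fy \<in> borel_measurable borel" unfolding fy_def[abs_def] by measurable
qed

lemma regular_simps [simp]: "fst (regular x) = fst x" "A (regular x) = c (snd x)" "f (regular x) = fst x * c (snd x)"
  by (simp_all add: regular_def)

lemma ft_regular: "snd x \<notin> C \<Longrightarrow> ft (regular x) = 0"
  by (simp add: ft_def regular_def)

lemma fst_singular [simp]: "fst (singular x) = fst x"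
  by (simp add: singular_def)

lemma singular_simps:
  assumes "0 < snd x" "snd x < 1"
  shows "A (singular x) = snd x" "f (singular x) = fst x * snd x" "ft (singular x) = 2 / fst x"
  using c_kap[OF assms] kap_in_C[OF assms] by (simp_all add: singular_def ft_def)

lemma singular_eq:
  assumes "0 < v" "v < 1" shows "singular (y, v) = (y, kap v + v * y\<^sup>2 / 2)"
  using c_kap[OF assms] by (simp add: singular_def chi_def)

lemma AE_fst_nonzero: "AE x in lborel. fst (x :: real \<times> real) \<noteq> 0"
proof (rule AE_I)
  have "emeasure (lborel \<Otimes>\<^sub>M lborel) ({0 :: real} \<times> (UNIV :: real set)) = emeasure lborel {0 :: real} * emeasure lborel (UNIV :: real set)"
    by (rule lborel.emeasure_pair_measure_Times) auto
  then show "emeasure lborel ({0} \<times> UNIV :: (real \<times> real) set) = 0" by (simp add: lborel_prod)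
  show "{0} \<times> UNIV \<in> sets (lborel :: (real \<times> real) measure)"
    unfolding lborel_prod[symmetric] by (intro pair_measureI) auto
qed auto

text \<open>The regular part of the integral vanishes, and on the singular part the weight y^2 / 2
  cancels (2 / y)^2 to the constant 2.\<close>

lemma set_integrable_ft_square:
  assumes K: "compact K" shows "set_integrable lborel K (\<lambda>x. (ft x)\<^sup>2)"
proof -
  have [measurable]: "K \<in> sets borel" using K by (simp add: borel_compact)
  obtain R where R: "R > 0" "\<forall>x\<in>K. norm x \<le> R"
    using compact_imp_bounded[OF K] unfolding bounded_pos by blast
  define h where "h x = indicator K x * (ft x)\<^sup>2" for x
  have hm [measurable]: "h \<in> borel_measurable borel" unfolding h_def[abs_def] by measurable
  have "(\<integral>\<^sup>+x. ennreal (h (regular x)) \<partial>lborel) = (\<integral>\<^sup>+x. 0 \<partial>(lborel :: (real \<times> real) measure))"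
    using AE_not_C by (intro nn_integral_cong_AE) (auto simp: h_def ft_regular elim!: eventually_mono)
  moreover have "(\<integral>\<^sup>+x. ennreal (weight x) * ennreal (h (singular x)) \<partial>lborel)
    \<le> (\<integral>\<^sup>+x. ennreal (2 * indicator (cbox (- R, 0) (R, 1)) x) \<partial>(lborel :: (real \<times> real) measure))"
  proof (rule nn_integral_mono)
    fix x :: "real \<times> real"
    have "weight x * h (singular x) \<le> 2 * indicator (cbox (- R, 0) (R, 1)) x"
    proof (cases "0 < snd x \<and> snd x < 1 \<and> singular x \<in> K \<and> fst x \<noteq> 0")
      case True
      then have "norm (singular x) \<le> R" using R(2) by blast
      then have "\<bar>fst x\<bar> \<le> R"
        using norm_fst_le[of "fst (singular x)" "snd (singular x)", unfolded prod.collapse] by simp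
      then have "x \<in> cbox (- R, 0) (R, 1)" using True by (cases x) (auto simp: cbox_Pair_eq abs_le_iff)
      moreover have "weight x * h (singular x) \<le> 2"
        using True by (simp add: weight_def h_def singular_simps indicator_def power_divide)
      ultimately show ?thesis by simp
    next
      case False
      then have eq0: "weight x * h (singular x) = 0"
        by (auto simp: weight_def h_def)
      show ?thesis unfolding eq0 by simp
    qed
    then show "ennreal (weight x) * ennreal (h (singular x)) \<le> ennreal (2 * indicator (cbox (- R, 0) (R, 1)) x)"
      by (simp add: ennreal_mult'[symmetric] weight_nonneg ennreal_leI)
  qed
  moreover have "(\<integral>\<^sup>+x. ennreal (2 * indicator (cbox (- R, 0) (R, 1)) x) \<partial>(lborel :: (real \<times> real) measure)) < \<infinity>"
    by (subst nn_integral_eq_integral) (auto intro!: integrable_mult_right integrable_indicator_compact compact_cbox)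
  ultimately have "(\<integral>\<^sup>+x. ennreal (h x) \<partial>lborel) < \<infinity>"
    using nn_integral_char[of "\<lambda>x. ennreal (h x)"] by simp
  then have "integrable lborel h"
    by (simp add: integrable_iff_bounded h_def)
  then show ?thesis by (simp add: set_integrable_def h_def[abs_def])
qed

lemma set_integrable_ft:
  assumes K: "compact K" shows "set_integrable lebesgue K ft"
proof -
  have [measurable]: "K \<in> sets borel" using K by (simp add: borel_compact)
  have "integrable lborel (\<lambda>x. indicator K x *\<^sub>R ft x)"
  proof (rule Bochner_Integration.integrable_bound)
    show "integrable lborel (\<lambda>x. indicator K x + indicator K x *\<^sub>R (ft x)\<^sup>2)"
      using set_integrable_ft_square[OF K] integrable_indicator_compact[OF K] by (simp add: set_integrable_def)
    have "\<bar>b\<bar> \<le> 1 + b\<^sup>2" for b :: real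
      using sum_squares_bound[of 1 "\<bar>b\<bar>"] by simp
    then have "norm (indicator K x *\<^sub>R ft x) \<le> norm (indicator K x + indicator K x *\<^sub>R (ft x)\<^sup>2)" for x
      by (simp add: indicator_def)
    then show "AE x in lborel. norm (indicator K x *\<^sub>R ft x) \<le> norm (indicator K x + indicator K x *\<^sub>R (ft x)\<^sup>2)"
      by (rule AE_I2)
  qed measurable
  then show ?thesis
    using set_integrable_lebesgue_iff_lborel[OF measurable_graph(3) K] by (simp add: set_integrable_def)
qed

lemma ft_Lp_loc: "ft \<in> Lp_loc 1 UNIV" "ft \<in> Lp_loc 2 UNIV"
proof -
  show "ft \<in> Lp_loc 1 UNIV" by (intro Lp_loc_1I set_integrable_ft)
  show "ft \<in> Lp_loc 2 UNIV"
    unfolding Lp_loc_def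
  proof (intro CollectI allI impI conjI)
    fix K :: "(real \<times> real) set" assume "compact K \<and> K \<subseteq> UNIV"
    then have K: "compact K" by simp
    show "set_borel_measurable lebesgue K ft"
      using set_integrable_ft[OF K] by (simp add: set_borel_measurable_def set_integrable_def borel_measurable_integrable)
    have "(\<lambda>x. (ft x)\<^sup>2) \<in> borel_measurable borel" by measurable
    then show "set_integrable lebesgue K (\<lambda>x. \<bar>ft x\<bar> powr 2)"
      using set_integrable_lebesgue_iff_lborel[OF _ K] set_integrable_ft_square[OF K] by simp
  qed
qed

lemma integrable_ft_mult:
  assumes "continuous_on UNIV \<psi>" "compact K" "\<And>x. x \<notin> K \<Longrightarrow> \<psi> x = 0"
  shows "integrable lborel (\<lambda>x. ft x * \<psi> x)"
proof -
  have [measurable]: "\<psi> \<in> borel_measurable borel" using assms(1) by (rule borel_measurable_continuous_onI)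
  have "(\<lambda>x. ft x * \<psi> x) \<in> borel_measurable lborel" by measurable
  then show ?thesis
    using integrable_Lp_loc_mult[OF ft_Lp_loc(1) assms] integrable_completion by blast
qed

lemma fy_Lp_loc: "p \<ge> 0 \<Longrightarrow> fy \<in> Lp_loc p UNIV"
proof (rule Lp_loc_locally_bounded)
  \<comment> \<open>In f ft the factor y cancels, leaving at most 2 A; hence \<open>fy\<close> stays
    bounded although \<open>ft\<close> does not.\<close>
  have "\<bar>fy x\<bar> \<le> 3" for x
    using A_bounds[of x] by (cases "fst x = 0") (auto simp: fy_def f_def ft_def indicator_def)
  then show "\<exists>M. \<forall>x\<in>K. \<bar>fy x\<bar> \<le> M" for K by blast
qed auto

text \<open>The integrand is the derivative of p (s) \<phi> along the parabola. The factor
  \<open>p\<close> is meant for the powers of \<open>y\<close> produced by the weight.\<close>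

lemma integral_along_parabola:
  assumes \<phi>: "C1_compact \<phi> \<phi>y \<phi>t"
    and p: "\<And>s. (p has_real_derivative p' s) (at s)" "continuous_on UNIV p'"
  shows "(LINT s|lborel. p s * (\<phi>y (s, b + w * s\<^sup>2 / 2) + w * s * \<phi>t (s, b + w * s\<^sup>2 / 2)) + p' s * \<phi> (s, b + w * s\<^sup>2 / 2)) = 0"
proof -
  note D = C1_compactD[OF \<phi>] and out = C1_compact_outside_spt[OF \<phi>]
  obtain R where R: "R > 0" "\<And>y t. (y, t) \<in> spt \<phi> \<Longrightarrow> \<bar>y\<bar> \<le> R \<and> \<bar>t\<bar> \<le> R"
    using spt_bounded[OF D(4)] by blast
  have z: "(y, t) \<notin> spt \<phi>" if "R < \<bar>y\<bar>" for y t
    using R(2)[of y t] that by linarith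
  have cp: "continuous_on UNIV p" using p(1) by (intro continuous_at_imp_continuous_on ballI DERIV_isCont) auto
  have cc: "continuous_on UNIV (\<lambda>s. g (s, b + w * s\<^sup>2 / 2))" if "continuous_on UNIV g" for g :: "real \<times> real \<Rightarrow> real"
    by (rule continuous_on_compose2[OF that]) (auto intro!: continuous_intros)
  have d: "((\<lambda>s. b + w * s\<^sup>2 / 2) has_real_derivative w * s) (at s)" for s
    by (auto intro!: derivative_eq_intros simp: power2_eq_square)
  show ?thesis
  proof (rule integral_derivative_bounded_support(2)[where R = R and Q = "\<lambda>s. p s * \<phi> (s, b + w * s\<^sup>2 / 2)"])
    show "((\<lambda>s. p s * \<phi> (s, b + w * s\<^sup>2 / 2)) has_real_derivative
        p s * (\<phi>y (s, b + w * s\<^sup>2 / 2) + w * s * \<phi>t (s, b + w * s\<^sup>2 / 2)) + p' s * \<phi> (s, b + w * s\<^sup>2 / 2)) (at s)" for s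
      by (rule DERIV_cong[OF DERIV_mult[OF p(1) C1_compact_compose[OF \<phi> DERIV_ident d]]]) (simp add: algebra_simps)
    show "continuous_on UNIV (\<lambda>s. p s * (\<phi>y (s, b + w * s\<^sup>2 / 2) + w * s * \<phi>t (s, b + w * s\<^sup>2 / 2)) + p' s * \<phi> (s, b + w * s\<^sup>2 / 2))"
      by (intro continuous_intros cp p(2) cc D)
  qed (simp_all add: z out)
qed

text \<open>For fixed \<open>v\<close> the map \<open>singular\<close> traces a parabola of slope v
  y, which is the value of \<open>f\<close> there; functions of \<open>v\<close> are constant
  factors on it.\<close>

lemma integral_along_singular:
  assumes \<phi>: "C1_compact \<phi> \<phi>y \<phi>t"
    and p: "\<And>s. (p has_real_derivative p' s) (at s)" "continuous_on UNIV p'" and m: "continuous_on UNIV m"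
  defines "q \<equiv> \<lambda>x. indicator {0<..<1} (snd x) * m (snd x) *
       (p (fst x) * (\<phi>y (singular x) + f (singular x) * \<phi>t (singular x)) + p' (fst x) * \<phi> (singular x))"
  shows "integrable lborel q" "integral\<^sup>L lborel q = 0"
proof -
  note D = C1_compactD[OF \<phi>] and out = C1_compact_outside_spt[OF \<phi>]
  have cp: "continuous_on UNIV p" using p(1) by (intro continuous_at_imp_continuous_on ballI DERIV_isCont) auto
  define \<rho> where "\<rho> x = p (fst x) * (\<phi>y x + f x * \<phi>t x) + p' (fst x) * \<phi> x" for x
  have "continuous_on UNIV \<rho>"
    unfolding \<rho>_def
    by (intro continuous_intros D continuous_f continuous_on_compose2[OF cp] continuous_on_compose2[OF p(2)]) auto
  from integrable_singular[OF this D(4) _ m] show i: "integrable lborel q"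
    by (simp add: \<rho>_def q_def out)
  show "integral\<^sup>L lborel q = 0"
  proof (rule integral_zero_of_slices[OF i])
    fix v
    show "(LINT y|lborel. q (y, v)) = 0"
    proof (cases "0 < v \<and> v < 1")
      case True
      have "q (y, v) = m v * (p y * (\<phi>y (y, kap v + v * y\<^sup>2 / 2) + v * y * \<phi>t (y, kap v + v * y\<^sup>2 / 2)) + p' y * \<phi> (y, kap v + v * y\<^sup>2 / 2))" for y
        using True singular_simps(2)[of "(y, v)"] by (simp add: q_def singular_eq mult.commute[of y v])
      then show ?thesis using integral_along_parabola[OF \<phi> p, of "kap v" v] by simp
    qed (auto simp: q_def)
  qed
qed

text \<open>For fixed \<open>u\<close> the map \<open>regular\<close> traces the leaf with foot
  \<open>u\<close>, whose slope is \<open>f\<close>. Integrability is a hypothesis, as it is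
  inherited from the plane through \<open>integral_char\<close>.\<close>

lemma integral_along_regular:
  assumes \<phi>: "C1_compact \<phi> \<phi>y \<phi>t"
    and p: "\<And>s. (p has_real_derivative p' s) (at s)" "continuous_on UNIV p'"
    and i: "integrable lborel (\<lambda>x. m (snd x) * (p (fst x) * (\<phi>y (regular x) + f (regular x) * \<phi>t (regular x)) + p' (fst x) * \<phi> (regular x)))"
  shows "(LINT x|lborel. m (snd x) * (p (fst x) * (\<phi>y (regular x) + f (regular x) * \<phi>t (regular x)) + p' (fst x) * \<phi> (regular x))) = 0"
proof (rule integral_zero_of_slices[OF i])
  fix u
  show "(LINT y|lborel. m (snd (y, u)) * (p (fst (y, u)) * (\<phi>y (regular (y, u)) + f (regular (y, u)) * \<phi>t (regular (y, u))) + p' (fst (y, u)) * \<phi> (regular (y, u)))) = 0"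
    using integral_along_parabola[OF \<phi> p, of u "c u"] f_chi[of _ u]
    by (simp add: regular_def chi_def mult.commute[of _ "c u"])
qed

text \<open>As \<open>A\<close> is constant on each leaf, \<open>g (A x)\<close> is a constant
  factor there. The choice g = 1 yields the weak \<open>t\<close>-derivative, and the choice p /
  sqrt (1 + p^2) yields stationarity.\<close>

lemma integral_along_characteristics:
  assumes \<phi>: "C1_compact \<phi> \<phi>y \<phi>t" and g: "continuous_on UNIV g"
  shows "(LINT x|lborel. g (A x) * (\<phi>y x + f x * \<phi>t x + ft x * \<phi> x)) = 0"
proof -
  note D = C1_compactD[OF \<phi>] and out = C1_compact_outside_spt[OF \<phi>]
  have [measurable]: "\<phi> \<in> borel_measurable borel" "\<phi>y \<in> borel_measurable borel" "\<phi>t \<in> borel_measurable borel" "g \<in> borel_measurable borel"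
    using D g by (simp_all add: borel_measurable_continuous_onI)
  have gA: "continuous_on UNIV (\<lambda>x. g (A x))" by (rule continuous_on_compose2[OF g continuous_A]) simp
  define h where "h x = g (A x) * (\<phi>y x + f x * \<phi>t x + ft x * \<phi> x)" for x
  have hm: "h \<in> borel_measurable borel" unfolding h_def[abs_def] by measurable
  have "integrable lborel (\<lambda>x. g (A x) * (\<phi>y x + f x * \<phi>t x) + ft x * (g (A x) * \<phi> x))"
  proof (rule Bochner_Integration.integrable_add)
    show "integrable lborel (\<lambda>x. g (A x) * (\<phi>y x + f x * \<phi>t x))"
      by (rule integrable_continuous_compact_support[OF _ D(4)])
         (auto intro!: continuous_intros gA D continuous_f simp: out)
    show "integrable lborel (\<lambda>x. ft x * (g (A x) * \<phi> x))"
      by (rule integrable_ft_mult[OF _ D(4)]) (auto intro!: continuous_intros gA D simp: out)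
  qed
  then have hi: "integrable lborel h"
    by (simp add: h_def[abs_def] algebra_simps)
  note split = integral_char[OF hm hi]
  define q where "q x = g (c (snd x)) * (1 * (\<phi>y (regular x) + f (regular x) * \<phi>t (regular x)) + 0 * \<phi> (regular x))" for x
  have qm: "q \<in> borel_measurable lborel" unfolding q_def[abs_def] by simp measurable
  have AE: "AE x in lborel. h (regular x) = q x"
    using AE_not_C by eventually_elim (simp add: h_def q_def ft_regular)
  have qi: "integrable lborel q"
    using integrable_cong_AE[OF _ qm AE] split(1) hm by simp
  have "(LINT x|lborel. h (regular x)) = integral\<^sup>L lborel q"
    using AE qm hm by (intro integral_cong_AE) auto
  also have "\<dots> = 0"
    unfolding q_def
    by (rule integral_along_regular[OF \<phi>, where p = "\<lambda>s. 1" and p' = "\<lambda>s. 0"]) (use qi in \<open>auto simp: q_def[abs_def]\<close>)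
  finally have 1: "(LINT x|lborel. h (regular x)) = 0" .
  \<comment> \<open>With ft = 2 / y the weighted integrand becomes the leaf derivative of (y^2 / 2)
    \<phi>; on y = 0 both sides vanish.\<close>
  have "weight x * h (singular x) = indicator {0<..<1} (snd x) * g (snd x) *
     ((fst x)\<^sup>2 / 2 * (\<phi>y (singular x) + f (singular x) * \<phi>t (singular x)) + fst x * \<phi> (singular x))" for x
    by (cases "0 < snd x \<and> snd x < 1"; cases "fst x = 0")
       (auto simp: weight_def h_def singular_simps field_simps power2_eq_square)
  moreover have "(LINT x|lborel. indicator {0<..<1} (snd x) * g (snd x) *
     ((fst x)\<^sup>2 / 2 * (\<phi>y (singular x) + f (singular x) * \<phi>t (singular x)) + fst x * \<phi> (singular x))) = 0"
    by (rule integral_along_singular(2)[OF \<phi> _ _ g, where p = "\<lambda>s. s\<^sup>2 / 2"]) (auto intro!: derivative_eq_intros continuous_intros)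
  ultimately have 2: "(LINT x|lborel. weight x * h (singular x)) = 0" by simp
  show ?thesis using split(3) 1 2 by (simp add: h_def[abs_def])
qed

text \<open>The case g = 1 of the integration along characteristics; the term with the
  \<open>y\<close>-derivative of the test function integrates to zero.\<close>

lemma weak_derivative_t: "has_weak_derivative UNIV (0, 1) f ft"
  unfolding has_weak_derivative_def
proof (intro conjI ballI)
  show "f \<in> Lp_loc 1 UNIV" by (intro Lp_loc_continuous continuous_f) simp
  fix \<eta> assume "\<eta> \<in> test_functions UNIV"
  define \<eta>y \<eta>t where "\<eta>y = (\<lambda>x. frechet_derivative \<eta> (at x) (1, 0))" and "\<eta>t = (\<lambda>x. frechet_derivative \<eta> (at x) (0, 1))"
  have \<eta>: "C1_compact \<eta> \<eta>y \<eta>t" unfolding \<eta>y_def \<eta>t_def by (rule test_function_C1_compact) fact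
  note D = C1_compactD[OF \<eta>] and out = C1_compact_outside_spt[OF \<eta>]
  have i: "integrable lborel \<eta>y" "integrable lborel (\<lambda>x. f x * \<eta>t x)" "integrable lborel (\<lambda>x. ft x * \<eta> x)"
    by (rule integrable_continuous_compact_support[OF D(2) D(4)], simp add: out,
        rule integrable_continuous_compact_support[OF continuous_on_mult[OF continuous_f D(3)] D(4)], simp add: out,
        rule integrable_ft_mult[OF D(1) D(4)], simp add: out)
  have "(LINT x|lborel. 1 * (\<eta>y x + f x * \<eta>t x + ft x * \<eta> x)) = 0"
    by (rule integral_along_characteristics[OF \<eta>, of "\<lambda>_. 1"]) simp
  then have "(LINT x|lborel. f x * \<eta>t x) = - (LINT x|lborel. ft x * \<eta> x)"
    using i C1_compact_integral_partial(1)[OF \<eta>] by simp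
  then show "(LINT x:UNIV|lebesgue. f x * frechet_derivative \<eta> (at x) (0, 1)) = - (LINT x:UNIV|lebesgue. ft x * \<eta> x)"
    using borel_measurable_integrable[OF i(2)] borel_measurable_integrable[OF i(3)]
    by (simp add: set_lebesgue_integral_def integral_completion \<eta>t_def)
qed (rule ft_Lp_loc)

text \<open>Adding f^2 \<eta>_t completes f \<eta>_y to \<open>f\<close> times a leaf derivative.
  The regular part of the result is exact; the singular part is not, and its integral is precisely
  that of the added term, as computed by the layer-cake formula.\<close>

lemma weak_derivative_y: "has_weak_derivative UNIV (1, 0) f fy"
  unfolding has_weak_derivative_def
proof (intro conjI ballI)
  show "f \<in> Lp_loc 1 UNIV" by (intro Lp_loc_continuous continuous_f) simp
  show "fy \<in> Lp_loc 1 UNIV" by (rule fy_Lp_loc) simp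
  fix \<eta> assume "\<eta> \<in> test_functions UNIV"
  define \<eta>y \<eta>t where "\<eta>y = (\<lambda>x. frechet_derivative \<eta> (at x) (1, 0))" and "\<eta>t = (\<lambda>x. frechet_derivative \<eta> (at x) (0, 1))"
  have \<eta>: "C1_compact \<eta> \<eta>y \<eta>t" unfolding \<eta>y_def \<eta>t_def by (rule test_function_C1_compact) fact
  note D = C1_compactD[OF \<eta>] and out = C1_compact_outside_spt[OF \<eta>]
  have [measurable]: "\<eta> \<in> borel_measurable borel" "\<eta>y \<in> borel_measurable borel" "\<eta>t \<in> borel_measurable borel"
    using D by (simp_all add: borel_measurable_continuous_onI)
  have i: "integrable lborel (\<lambda>x. f x * \<eta>y x)" "integrable lborel (\<lambda>x. A x * \<eta> x)" "integrable lborel (\<lambda>x. (f x)\<^sup>2 * \<eta>t x)"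
    by (rule integrable_continuous_compact_support[OF _ D(4)], auto intro!: continuous_intros D continuous_f continuous_A simp: out)+
  have ift: "integrable lborel (\<lambda>x. ft x * (f x * \<eta> x))"
    by (rule integrable_ft_mult[OF _ D(4)]) (auto intro!: continuous_intros D continuous_f simp: out)
  define h where "h x = f x * \<eta>y x + (f x)\<^sup>2 * \<eta>t x + A x * \<eta> x - ft x * (f x * \<eta> x)" for x
  have hm: "h \<in> borel_measurable borel" unfolding h_def[abs_def] by measurable
  have hi: "integrable lborel h" unfolding h_def[abs_def] using i ift by simp
  note split = integral_char[OF hm hi]
  \<comment> \<open>On the regular part this is c (u) times the leaf derivative of y \<eta>.\<close>
  define q where "q x = c (snd x) * (fst x * (\<eta>y (regular x) + f (regular x) * \<eta>t (regular x)) + 1 * \<eta> (regular x))" for x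
  have qm: "q \<in> borel_measurable lborel" unfolding q_def[abs_def] by simp measurable
  have AE: "AE x in lborel. h (regular x) = q x"
    using AE_not_C by eventually_elim (simp add: h_def q_def ft_regular algebra_simps power2_eq_square)
  have qi: "integrable lborel q"
    using integrable_cong_AE[OF _ qm AE] split(1) hm by simp
  have "(LINT x|lborel. h (regular x)) = integral\<^sup>L lborel q"
    using AE qm hm by (intro integral_cong_AE) auto
  also have "\<dots> = 0"
    unfolding q_def
    by (rule integral_along_regular[OF \<eta>, where p = "\<lambda>s. s" and p' = "\<lambda>s. 1"]) (use qi in \<open>auto simp: q_def[abs_def]\<close>)
  finally have 1: "(LINT x|lborel. h (regular x)) = 0" .

  \<comment> \<open>The layer-cake formula is applied to y^2 \<eta> with H v = v^2, because f^2
    \<eta>_t = A^2 y^2 \<eta>_t.\<close>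
  have cp: "C1_compact (\<lambda>x. (fst x)\<^sup>2 * \<eta> x) (\<lambda>x. (fst x)\<^sup>2 * \<eta>y x + 2 * fst x * \<eta> x) (\<lambda>x. (fst x)\<^sup>2 * \<eta>t x + 0 * \<eta> x)"
    by (rule C1_compact_times[OF \<eta>]) (auto intro!: continuous_intros derivative_eq_intros)
  have H: "((\<lambda>v. v\<^sup>2) has_real_derivative 2 * v) (at v)" for v :: real
    by (auto intro!: derivative_eq_intros)
  note L2 = integral_composed_A[OF cp H continuous_on_mult_left[OF continuous_on_id, of UNIV 2]]
  have f2: "(LINT x|lborel. (f x)\<^sup>2 * \<eta>t x) = - (LINT x|lborel. indicator {0<..<1} (snd x) * (2 * snd x) * ((fst x)\<^sup>2 * \<eta> (singular x)))"
    using L2(1) by (simp add: f_def power_mult_distrib mult_ac)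
  have f2i: "integrable lborel (\<lambda>x. indicator {0<..<1} (snd x) * (2 * snd x) * ((fst x)\<^sup>2 * \<eta> (singular x)))"
    using L2(2) by simp

  \<comment> \<open>The weighted singular part is (v / 2) (y^3 D\<eta> - y^2 \<eta>), with D the
    leaf derivative. Adding 2 v y^2 \<eta> turns the coefficient - 1 into 3, which makes it v / 2
    times the leaf derivative of y^3 \<eta>.\<close>
  have "(LINT x|lborel. weight x * h (singular x) + indicator {0<..<1} (snd x) * (2 * snd x) * ((fst x)\<^sup>2 * \<eta> (singular x))) =
    (LINT x|lborel. indicator {0<..<1} (snd x) * (snd x / 2) *
       (fst x ^ 3 * (\<eta>y (singular x) + f (singular x) * \<eta>t (singular x)) + 3 * (fst x)\<^sup>2 * \<eta> (singular x)))"
  proof (rule Bochner_Integration.integral_cong[OF refl])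
    fix x :: "real \<times> real"
    show "weight x * h (singular x) + indicator {0<..<1} (snd x) * (2 * snd x) * ((fst x)\<^sup>2 * \<eta> (singular x)) =
       indicator {0<..<1} (snd x) * (snd x / 2) *
       (fst x ^ 3 * (\<eta>y (singular x) + f (singular x) * \<eta>t (singular x)) + 3 * (fst x)\<^sup>2 * \<eta> (singular x))"
      by (cases "0 < snd x \<and> snd x < 1"; cases "fst x = 0")
         (auto simp: weight_def h_def singular_simps field_simps power2_eq_square power3_eq_cube)
  qed
  also have "\<dots> = 0"
    by (rule integral_along_singular(2)[OF \<eta>, where p = "\<lambda>s. s ^ 3" and m = "\<lambda>v. v / 2"])
       (auto intro!: derivative_eq_intros continuous_intros)
  finally have 2: "(LINT x|lborel. weight x * h (singular x)) + (LINT x|lborel. indicator {0<..<1} (snd x) * (2 * snd x) * ((fst x)\<^sup>2 * \<eta> (singular x))) = 0"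
    using split(2) f2i by simp

  have fyi: "integrable lborel (\<lambda>x. fy x * \<eta> x)"
    using Bochner_Integration.integrable_diff[OF i(2) ift] by (simp add: fy_def algebra_simps)
  have "integral\<^sup>L lborel h = (LINT x|lborel. f x * \<eta>y x + (f x)\<^sup>2 * \<eta>t x + fy x * \<eta> x)"
    unfolding h_def fy_def by (simp add: algebra_simps)
  also have "\<dots> = (LINT x|lborel. f x * \<eta>y x) + (LINT x|lborel. (f x)\<^sup>2 * \<eta>t x) + (LINT x|lborel. fy x * \<eta> x)"
    using i fyi by simp
  finally have "(LINT x|lborel. f x * \<eta>y x) = - (LINT x|lborel. fy x * \<eta> x)"
    using split(3) 1 2 f2 by simp
  then show "(LINT x:UNIV|lebesgue. f x * frechet_derivative \<eta> (at x) (1, 0)) = - (LINT x:UNIV|lebesgue. fy x * \<eta> x)"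
    using borel_measurable_integrable[OF i(1)] borel_measurable_integrable[OF fyi]
    by (simp add: set_lebesgue_integral_def integral_completion \<eta>y_def)
qed

sublocale variation: intrinsic_graph_variation f fy ft A
  by unfold_locales
     (simp_all add: weak_derivative_y weak_derivative_t continuous_f continuous_A set_integrable_ft_square measurable_graph fy_def)

lemma f_W12_loc: "f \<in> W1p_loc 2 UNIV"
  unfolding W1p_loc_def
  using weak_derivative_y weak_derivative_t fy_Lp_loc[of 2] ft_Lp_loc(2) Lp_loc_continuous[OF continuous_f, of 2]
  by auto

section \<open>Stationarity and stability\<close>

lemma continuous_div_sqrt: "continuous_on UNIV (\<lambda>p::real. p / sqrt (1 + p\<^sup>2))"
  by (rule continuous_at_imp_continuous_on) (blast intro: DERIV_isCont[OF DERIV_div_sqrt_one_plus_square])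

lemma continuous_inverse_sqrt_cubed: "continuous_on UNIV (\<lambda>p::real. 1 / sqrt (1 + p\<^sup>2) ^ 3)"
proof -
  have "sqrt (1 + p\<^sup>2) \<noteq> 0" for p :: real
    using sqrt_one_plus_square_bounds(4)[of p] by linarith
  then show ?thesis by (intro continuous_intros) auto
qed

lemma stationary_f: "stationary_on UNIV f"
  unfolding stationary_on_def
proof (intro conjI ballI)
  fix \<phi> assume "\<phi> \<in> test_functions UNIV"
  note \<phi> = test_function_C1_compact[OF this]
  have "(LINT x|lborel. A x / sqrt (1 + (A x)\<^sup>2) * variation.B \<phi> (\<lambda>x. frechet_derivative \<phi> (at x) (1, 0)) (\<lambda>x. frechet_derivative \<phi> (at x) (0, 1)) x) = 0"
    unfolding variation.B_def[OF \<phi>]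
    by (rule integral_along_characteristics[OF \<phi> continuous_div_sqrt])
  then show "has_first_variation UNIV f \<phi> 0"
    using variation.has_first_variation_eq[OF \<phi>] by simp
qed (rule variation.f_C1W)

lemma second_variation_nonneg:
  assumes \<phi>: "C1_compact \<phi> \<phi>y \<phi>t"
  defines "B \<equiv> \<lambda>x. \<phi>y x + f x * \<phi>t x + ft x * \<phi> x"
  assumes B2: "integrable lborel (\<lambda>x. (B x)\<^sup>2)"
  shows "0 \<le> (LINT x|lborel. 1 / sqrt (1 + (A x)\<^sup>2) ^ 3 * (B x)\<^sup>2 + A x / sqrt (1 + (A x)\<^sup>2) * (2 * (\<phi> x * \<phi>t x)))"
proof -
  note D = C1_compactD[OF \<phi>] and out = C1_compact_outside_spt[OF \<phi>]
  define G where "G p = 1 / sqrt (1 + p\<^sup>2) ^ 3" for p :: real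
  have G: "0 \<le> G p" "G p \<le> 1" for p
    using sqrt_one_plus_square_bounds(3)[of p] by (simp_all add: G_def)
  have cG: "continuous_on UNIV G" unfolding G_def[abs_def] by (rule continuous_inverse_sqrt_cubed)
  have [measurable]: "\<phi> \<in> borel_measurable borel" "\<phi>y \<in> borel_measurable borel" "\<phi>t \<in> borel_measurable borel" "G \<in> borel_measurable borel"
    using D cG by (simp_all add: borel_measurable_continuous_onI)
  define h where "h x = G (A x) * (B x)\<^sup>2" for x
  have hm: "h \<in> borel_measurable borel" unfolding h_def[abs_def] B_def by measurable
  have hi: "integrable lborel h"
  proof (rule Bochner_Integration.integrable_bound[OF B2])
    show "AE x in lborel. norm (h x) \<le> norm ((B x)\<^sup>2)"
      using G by (intro AE_I2) (simp add: h_def abs_mult mult_left_le_one_le)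
  qed (use hm in simp)
  note split = integral_char[OF hm hi]
  \<comment> \<open>The regular part is nonnegative and can be discarded; the negative term has to
    be absorbed by the singular part alone.\<close>
  have "0 \<le> (LINT x|lborel. h (regular x))"
    by (intro integral_nonneg_AE AE_I2) (simp add: h_def G)
  then have h_ge: "(LINT x|lborel. weight x * h (singular x)) \<le> integral\<^sup>L lborel h" using split(3) by simp

  \<comment> \<open>This \<open>X\<close> is \<open>y\<close> times the leaf derivative of \<phi>,
    so y B = X + 2 \<phi> on the singular part where y is nonzero.\<close>
  define X where "X x = fst x * (\<phi>y (singular x) + f (singular x) * \<phi>t (singular x))" for x
  define q where "q x = indicator {0<..<1} (snd x) * G (snd x) * ((X x + 2 * \<phi> (singular x))\<^sup>2 / 2)" for x
  have Xm [measurable]: "X \<in> borel_measurable borel" unfolding X_def[abs_def] by measurable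
  have qm: "q \<in> borel_measurable lborel" unfolding q_def[abs_def] by measurable
  have AE: "AE x in lborel. weight x * h (singular x) = q x"
    using AE_fst_nonzero
  proof eventually_elim
    case (elim x)
    show ?case
    proof (cases "0 < snd x \<and> snd x < 1")
      case True
      have "(fst x)\<^sup>2 * (B (singular x))\<^sup>2 = (X x + 2 * \<phi> (singular x))\<^sup>2"
        unfolding power_mult_distrib[symmetric] X_def B_def using True elim by (simp add: singular_simps algebra_simps)
      then show ?thesis using True by (simp add: weight_def h_def q_def singular_simps)
    qed (auto simp: weight_def q_def)
  qed
  have qi: "integrable lborel q"
    using integrable_cong_AE[OF _ qm AE] split(2) hm by simp
  have q_eq: "(LINT x|lborel. weight x * h (singular x)) = integral\<^sup>L lborel q"
    using AE qm hm by (intro integral_cong_AE) auto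

  \<comment> \<open>Since 2 \<phi> \<phi>_t is the \<open>t\<close>-derivative of \<phi>^2, the
    layer-cake formula with H p = p / sqrt (1 + p^2) turns the remaining term into - G \<phi>^2 on
    the singular part.\<close>
  have sq: "C1_compact (\<lambda>x. \<phi> x * \<phi> x) (\<lambda>x. \<phi> x * \<phi>y x + \<phi>y x * \<phi> x) (\<lambda>x. \<phi> x * \<phi>t x + \<phi>t x * \<phi> x)"
    by (rule C1_compact_times[OF \<phi> D(1,2,3,5)])
  note L2 = integral_composed_A[OF sq DERIV_div_sqrt_one_plus_square continuous_inverse_sqrt_cubed]
  have third: "(LINT x|lborel. A x / sqrt (1 + (A x)\<^sup>2) * (2 * (\<phi> x * \<phi>t x))) =
      - (LINT x|lborel. indicator {0<..<1} (snd x) * G (snd x) * (\<phi> (singular x) * \<phi> (singular x)))"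
    using L2(1) by (simp add: G_def mult_ac)
  have third_i: "integrable lborel (\<lambda>x. A x / sqrt (1 + (A x)\<^sup>2) * (2 * (\<phi> x * \<phi>t x)))"
    using L2(3) by (simp add: mult_ac)
  have L2i: "integrable lborel (\<lambda>x. indicator {0<..<1} (snd x) * G (snd x) * (\<phi> (singular x) * \<phi> (singular x)))"
    using L2(2) by (simp add: G_def)

  \<comment> \<open>This is G / 2 times the leaf derivative of y \<phi>^2. Subtracting it leaves the
    integral unchanged.\<close>
  define r where "r x = indicator {0<..<1} (snd x) * (G (snd x) / 2) *
    (fst x * ((\<phi> (singular x) * \<phi>y (singular x) + \<phi>y (singular x) * \<phi> (singular x))
       + f (singular x) * (\<phi> (singular x) * \<phi>t (singular x) + \<phi>t (singular x) * \<phi> (singular x))) + 1 * (\<phi> (singular x) * \<phi> (singular x)))" for x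
  have r: "integrable lborel r" "integral\<^sup>L lborel r = 0"
    unfolding r_def[abs_def]
    by (rule integral_along_singular[OF sq, where p = "\<lambda>s. s" and p' = "\<lambda>s. 1" and m = "\<lambda>v. G v / 2"];
        auto intro!: continuous_intros cG)+
  have "0 \<le> (LINT x|lborel. q x - indicator {0<..<1} (snd x) * G (snd x) * (\<phi> (singular x) * \<phi> (singular x)) - r x)"
  proof (intro integral_nonneg_AE AE_I2)
    fix x :: "real \<times> real"
    \<comment> \<open>Completing the square: (X + 2 \<phi>)^2 / 2 - \<phi>^2 - (X \<phi> + \<phi>^2
      / 2) = (X + \<phi>)^2 / 2.\<close>
    have e: "q x - indicator {0<..<1} (snd x) * G (snd x) * (\<phi> (singular x) * \<phi> (singular x)) - r x =
       indicator {0<..<1} (snd x) * G (snd x) * ((X x + \<phi> (singular x))\<^sup>2 / 2)"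
      unfolding q_def r_def X_def by (simp add: field_simps power2_eq_square)
    show "0 \<le> q x - indicator {0<..<1} (snd x) * G (snd x) * (\<phi> (singular x) * \<phi> (singular x)) - r x"
      unfolding e by (simp add: G)
  qed
  then have "0 \<le> integral\<^sup>L lborel q - (LINT x|lborel. indicator {0<..<1} (snd x) * G (snd x) * (\<phi> (singular x) * \<phi> (singular x)))"
    using qi L2i r by simp
  then have "0 \<le> integral\<^sup>L lborel h + (LINT x|lborel. A x / sqrt (1 + (A x)\<^sup>2) * (2 * (\<phi> x * \<phi>t x)))"
    using h_ge q_eq third by simp
  also have "\<dots> = (LINT x|lborel. h x + A x / sqrt (1 + (A x)\<^sup>2) * (2 * (\<phi> x * \<phi>t x)))"
    using hi third_i by simp
  finally show ?thesis by (simp add: h_def G_def)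
qed

lemma stable_f: "stable_on UNIV f"
  unfolding stable_on_def
proof (intro conjI ballI stationary_f)
  fix \<phi> assume "\<phi> \<in> test_functions UNIV"
  note \<phi> = test_function_C1_compact[OF this]
  show "\<exists>b\<ge>0. has_second_variation UNIV f \<phi> b"
    using variation.has_second_variation_eq[OF \<phi>] second_variation_nonneg[OF \<phi>] variation.integrable_B(1)[OF \<phi>]
    unfolding variation.B_def[OF \<phi>] by blast
qed

end

theorem theorem1p4:
  shows "\<exists>f :: real \<times> real \<Rightarrow> real.
    f \<in> W1p_loc 2 UNIV \<inter> C1W UNIV \<and>
    locally_lipschitz_on (UNIV - {0} \<times> cantor_set) f \<and>
    stable_on UNIV f \<and>
    \<not> intrinsic_plane (intrinsic_graph UNIV f)"
proof -
  interpret devil_staircase cantor_function cantor_set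
  proof
    fix u assume "u \<notin> cantor_set"
    then obtain n where "u \<notin> cantor_level n" by (auto simp: cantor_set_def)
    then show "\<exists>r>0. \<forall>s. \<bar>s - u\<bar> < r \<longrightarrow> cantor_function s = cantor_function u"
      by (rule cantor_function_locally_constant_off_level)
  qed (simp_all add: mono_cantor_function continuous_cantor_function cantor_function_le_0
      cantor_function_ge_1 closed_cantor_set null_sets_cantor_set)
  show ?thesis
    using f_W12_loc variation.f_C1W(2) locally_lipschitz_f[OF order_refl] stable_f not_intrinsic_plane
    by blast
qed

end
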